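(* Let $D\subseteq\mathbb{C}$ be a bounded Jordan domain with at least two boundary curves and let $f:\partial D\to\mathbb{R}$ be piecewise continuous. Let $\sigma,\tau,D_1,D_2,\phi_1,\phi_2,A_j,B_j,h,K,m$ and the kernels $\mathbf{K}^{(n)},\mathbf{K}$ be as defined in the context, and let $u_f$ be the solution of the Dirichlet problem on $D$ with boundary data $f$. Then for all $z\in D$, $$u_f(z)=h(z)+\int_{B_2}\mathbf{K}(z,\zeta_1)\,h(\phi_2(\zeta_1))\,ds_{\zeta_1}.$$ Furthermore, for all $z\in D$ and every integer $t\ge 1$, $$\left|h(z)+\sum_{n=1}^{t}\frac{1}{(2\pi)^{2n}}\int_{B_2}\mathbf{K}^{(n)}(z,\zeta_1)\,h(\phi_2(\zeta_1))\,ds_{\zeta_1}-u_f(z)\right|\le\left(\frac{m}{2\pi}\right)^{t+1}\frac{2\pi}{2\pi-m}\,\|f\|_\infty .$$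
   Context: Setting. $D\subseteq\mathbb{C}$ is a bounded Jordan domain: a bounded domain whose boundary consists of $n\ge 2$ pairwise disjoint Jordan curves (no smoothness is assumed). $f:\partial D\to\mathbb{R}$ is piecewise continuous (in particular bounded, with finitely many discontinuities), and $\|f\|_\infty=\sup_{\partial D}|f|$. $u_f$ denotes the unique bounded harmonic function on $D$ with $\lim_{z\to\zeta}u_f(z)=f(\zeta)$ for all $\zeta\in\partial D$ at which $f$ is continuous. Arcs and maps. $\sigma_1,\dots,\sigma_{n-1},\tau_1,\dots,\tau_{n-1}$ are pairwise disjoint arcs, each having its endpoints on $\partial D$ and otherwise contained in $D$; $\sigma=\bigcup_j\sigma_j$, $\tau=\bigcup_j\tau_j$; and $D_1=D\setminus\sigma$, $D_2=D\setminus\tau$ are simply connected domains. $\mathbb{D}$ is the open unit disk. For $j=1,2$, $\phi_j$ is a continuous map of $\overline{\mathbb{D}}$ onto $\overline{D_j}$ that is conformal on $\mathbb{D}$ (such maps exist; each point of $\overline{D}\setminus\sigma$ has exactly one preimage under $\phi_1$, and each point of $\overline{D}\setminus\tau$ has exactly one preimage under $\phi_2$, so $\phi_1^{-1}$, $\phi_2^{-1}$ are well defined on these sets). Put $A_j=\phi_j^{-1}[\partial D]$, $B_1=\phi_1^{-1}[\sigma]$, $B_2=\phi_2^{-1}[\tau]$, all subsets of the unit circle. $P(z,\zeta)=\frac{1-|z|^2}{|z-\zeta|^2}$ is the Poisson kernel and $ds_\zeta$ is arc length in $\zeta$. Integrands below may be undefined at the finitely many preimages of endpoints of the arcs, which does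 not affect the integrals. The function $h$. $H_1(z)=\frac{1}{2\pi}\int_{A_1}P(\phi_1^{-1}(z),\zeta)f(\phi_1(\zeta))\,ds_\zeta$ for $z\in D_1$ (the harmonic function on $D_1$ with boundary values $f$ on $\partial D$ and $0$ on $\sigma\setminus\partial D$); $H_2(z)=\frac{1}{2\pi}\int_{A_2}P(\phi_2^{-1}(z),\zeta)f(\phi_2(\zeta))\,ds_\zeta$ for $z\in D_2$ (the harmonic function on $D_2$ with boundary values $f$ on $\partial D$ and $0$ on $\tau\setminus\partial D$); $H_3(z)=\frac{1}{2\pi}\int_{B_1}P(\phi_1^{-1}(z),\zeta)H_2(\phi_1(\zeta))\,ds_\zeta$ for $z\in D_1$ (the harmonic function on $D_1$ with boundary values $H_2$ on $\sigma$ and $0$ elsewhere); $h=H_1+H_3$ on $D_1$. The kernel $K$. For $\zeta_1\in B_2$ and $z\in D_1$, $K(z,\zeta_1)=\int_{B_1}P(\phi_2^{-1}(\phi_1(\zeta)),\zeta_1)\,P(\phi_1^{-1}(z),\zeta)\,ds_\zeta$, i.e. $K(\cdot,\zeta_1)$ is the harmonic function on $D_1$ with boundary values $2\pi P(\phi_2^{-1}(\zeta),\zeta_1)$ for $\zeta\in\sigma$ and $0$ for boundary points not in $\sigma$. Values on $\sigma$. For $z\in\sigma\cap D$, $h(z)$ and $K(z,\zeta_1)$ are understood as their boundary values (continuous extensions): $h(z)=H_2(z)$ and $K(z,\zeta_1)=2\pi P(\phi_2^{-1}(z),\zeta_1)$. The constant $m$. $m=\max\left\{\int_{B_2}P(\phi_2^{-1}(\zeta),\zeta_1)\,ds_{\zeta_1}:\zeta\in\sigma\right\}$;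 one has $m<2\pi$. Iterated kernels. For $\zeta_1\in B_2$, $\mathbf{K}^{(1)}(z,\zeta_1)=K(z,\zeta_1)$, and for $n\ge 1$ $$\mathbf{K}^{(n+1)}(z,\zeta_1)=\int_{B_2^n}K(z,\zeta_{n+1})\prod_{j=1}^{n}K(\phi_2(\zeta_{j+1}),\zeta_j)\,ds_{\zeta_2}\cdots ds_{\zeta_{n+1}},$$ and $\mathbf{K}(z,\zeta_1)=\sum_{n=1}^{\infty}\frac{1}{(2\pi)^{2n}}\mathbf{K}^{(n)}(z,\zeta_1)$. (In the iterated kernels, $n$ is an index unrelated to the number of boundary curves.) *)

theory Defs
  imports "HOL-Complex_Analysis.Complex_Analysis"
begin

section \<open>Domains, boundary data and the Dirichlet problem\<close>

definition region :: "complex set \<Rightarrow> bool" where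
  "region S \<longleftrightarrow> open S \<and> connected S \<and> S \<noteq> {}"

definition jordan_loop :: "(real \<Rightarrow> complex) \<Rightarrow> bool" where
  "jordan_loop \<gamma> \<longleftrightarrow> simple_path \<gamma> \<and> pathfinish \<gamma> = pathstart \<gamma>"

definition bounded_jordan_domain :: "nat \<Rightarrow> complex set \<Rightarrow> bool" where
  "bounded_jordan_domain n D \<longleftrightarrow> region D \<and> bounded D \<and>
     (\<exists>\<gamma>. (\<forall>i\<in>{1..n}. jordan_loop (\<gamma> i)) \<and>
          disjoint_family_on (\<lambda>i. path_image (\<gamma> i)) {1..n} \<and>
          frontier D = (\<Union>i\<in>{1..n}. path_image (\<gamma> i)))"

text \<open>
  Piecewise continuity along each boundary curve: finitely many discontinuities and finite
  one-sided limits everywhere. If the frontier of \<open>D\<close> is a disjoint union of finitely many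
  Jordan curves, the loops considered here are exactly the parametrisations of these curves.
\<close>
definition piecewise_continuous_frontier :: "complex set \<Rightarrow> (complex \<Rightarrow> real) \<Rightarrow> bool" where
  "piecewise_continuous_frontier D f \<longleftrightarrow>
     (\<forall>\<gamma>. jordan_loop \<gamma> \<and> path_image \<gamma> \<subseteq> frontier D \<longrightarrow>
        (\<exists>F. finite F \<and> continuous_on ({0..1} - F) (f \<circ> \<gamma>)) \<and>
        (\<forall>t\<in>{0..<1}. \<exists>l. ((f \<circ> \<gamma>) \<longlongrightarrow> l) (at_right t)) \<and>
        (\<forall>t\<in>{0<..1}. \<exists>l. ((f \<circ> \<gamma>) \<longlongrightarrow> l) (at_left t)))"

text \<open>A \<open>C\<^sup>2\<close> function with vanishing Laplacian.\<close>
definition harmonic_on :: "(complex \<Rightarrow> real) \<Rightarrow> complex set \<Rightarrow> bool" where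
  "harmonic_on u S \<longleftrightarrow>
     (\<exists>ux uy uxx uxy uyx uyy.
        (\<forall>z\<in>S. (u has_derivative (\<lambda>w. ux z * Re w + uy z * Im w)) (at z) \<and>
               (ux has_derivative (\<lambda>w. uxx z * Re w + uxy z * Im w)) (at z) \<and>
               (uy has_derivative (\<lambda>w. uyx z * Re w + uyy z * Im w)) (at z) \<and>
               uxx z + uyy z = 0) \<and>
        continuous_on S uxx \<and> continuous_on S uxy \<and>
        continuous_on S uyx \<and> continuous_on S uyy)"

definition dirichlet_solution ::
  "complex set \<Rightarrow> (complex \<Rightarrow> real) \<Rightarrow> (complex \<Rightarrow> real) \<Rightarrow> bool" where
  "dirichlet_solution D f u \<longleftrightarrow> harmonic_on u D \<and> bounded (u ` D) \<and>
     (\<forall>\<zeta>\<in>frontier D. continuous (at \<zeta> within frontier D) f \<longrightarrow> (u \<longlongrightarrow> f \<zeta>) (at \<zeta> within D))"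

definition frontier_sup_norm :: "complex set \<Rightarrow> (complex \<Rightarrow> real) \<Rightarrow> real" where
  "frontier_sup_norm D f = (SUP \<zeta>\<in>frontier D. \<bar>f \<zeta>\<bar>)"


section \<open>Cuts and Riemann maps\<close>

definition crosscut :: "complex set \<Rightarrow> (real \<Rightarrow> complex) \<Rightarrow> bool" where
  "crosscut D \<gamma> \<longleftrightarrow> arc \<gamma> \<and> pathstart \<gamma> \<in> frontier D \<and> pathfinish \<gamma> \<in> frontier D \<and>
     path_image \<gamma> - {pathstart \<gamma>, pathfinish \<gamma>} \<subseteq> D"

definition riemann_map_closed :: "(complex \<Rightarrow> complex) \<Rightarrow> complex set \<Rightarrow> bool" where
  "riemann_map_closed \<phi> S \<longleftrightarrow>
     continuous_on (cball 0 1) \<phi> \<and> \<phi> ` cball 0 1 = closure S \<and>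
     \<phi> holomorphic_on ball 0 1 \<and> inj_on \<phi> (ball 0 1) \<and> \<phi> ` ball 0 1 = S"

definition disk_preimage :: "(complex \<Rightarrow> complex) \<Rightarrow> complex set \<Rightarrow> complex set" where
  "disk_preimage \<phi> E = {\<zeta> \<in> cball 0 1. \<phi> \<zeta> \<in> E}"

text \<open>Meaningful only at points having exactly one preimage in the closed unit disk.\<close>
definition disk_inv :: "(complex \<Rightarrow> complex) \<Rightarrow> complex \<Rightarrow> complex" where
  "disk_inv \<phi> = inv_into (cball 0 1) \<phi>"

text \<open>Arc length on the unit circle, as a measure on the plane of total mass \<open>2 * pi\<close>.\<close>
definition arc_length :: "complex measure" where
  "arc_length = distr (restrict_space lborel {0..<2*pi}) borel cis"

definition poisson :: "complex \<Rightarrow> complex \<Rightarrow> real" where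
  "poisson z \<zeta> = (1 - (cmod z)\<^sup>2) / (cmod (z - \<zeta>))\<^sup>2"


section \<open>The approximation \<open>h\<close> and the kernels\<close>

text \<open>
  Throughout, \<open>S\<close> and \<open>T\<close> are the unions \<open>\<sigma>\<close> and \<open>\<tau>\<close> of the two systems of cuts, so that
  \<open>A\<^sub>j = disk_preimage \<phi>\<^sub>j (frontier D)\<close>, \<open>B\<^sub>1 = disk_preimage \<phi>\<^sub>1 S\<close> and
  \<open>B\<^sub>2 = disk_preimage \<phi>\<^sub>2 T\<close>. The functions \<open>H\<^sub>1\<close> and \<open>H\<^sub>2\<close> are given by the same formula,
  with \<open>\<phi> = \<phi>\<^sub>1\<close> and \<open>\<phi> = \<phi>\<^sub>2\<close> respectively.
\<close>

definition H_cut :: "complex set \<Rightarrow> (complex \<Rightarrow> real) \<Rightarrow> (complex \<Rightarrow> complex) \<Rightarrow> complex \<Rightarrow> real" where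
  "H_cut D f \<phi> z = 1 / (2*pi) *
     (LINT \<zeta>:disk_preimage \<phi> (frontier D)|arc_length. poisson (disk_inv \<phi> z) \<zeta> * f (\<phi> \<zeta>))"

definition H3_cut ::
  "complex set \<Rightarrow> (complex \<Rightarrow> real) \<Rightarrow> complex set \<Rightarrow> (complex \<Rightarrow> complex) \<Rightarrow> (complex \<Rightarrow> complex)
    \<Rightarrow> complex \<Rightarrow> real" where
  "H3_cut D f S \<phi>1 \<phi>2 z = 1 / (2*pi) *
     (LINT \<zeta>:disk_preimage \<phi>1 S|arc_length. poisson (disk_inv \<phi>1 z) \<zeta> * H_cut D f \<phi>2 (\<phi>1 \<zeta>))"

text \<open>On \<open>S\<close>, the functions \<open>h\<close> and \<open>K\<close> are given by their boundary values from \<open>D - S\<close>.\<close>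

definition h_cut ::
  "complex set \<Rightarrow> (complex \<Rightarrow> real) \<Rightarrow> complex set \<Rightarrow> (complex \<Rightarrow> complex) \<Rightarrow> (complex \<Rightarrow> complex)
    \<Rightarrow> complex \<Rightarrow> real" where
  "h_cut D f S \<phi>1 \<phi>2 z =
     (if z \<in> S then H_cut D f \<phi>2 z else H_cut D f \<phi>1 z + H3_cut D f S \<phi>1 \<phi>2 z)"

definition K_cut ::
  "complex set \<Rightarrow> (complex \<Rightarrow> complex) \<Rightarrow> (complex \<Rightarrow> complex) \<Rightarrow> complex \<Rightarrow> complex \<Rightarrow> real" where
  "K_cut S \<phi>1 \<phi>2 z \<zeta>1 =
     (if z \<in> S then 2*pi * poisson (disk_inv \<phi>2 z) \<zeta>1
      else (LINT \<zeta>:disk_preimage \<phi>1 S|arc_length.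
              poisson (disk_inv \<phi>2 (\<phi>1 \<zeta>)) \<zeta>1 * poisson (disk_inv \<phi>1 z) \<zeta>))"

text \<open>The maximum of a continuous function on the compact set \<open>S\<close>, hence written as a supremum.\<close>
definition m_cut :: "complex set \<Rightarrow> complex set \<Rightarrow> (complex \<Rightarrow> complex) \<Rightarrow> real" where
  "m_cut S T \<phi>2 =
     (SUP \<zeta>\<in>S. LINT \<zeta>1:disk_preimage \<phi>2 T|arc_length. poisson (disk_inv \<phi>2 \<zeta>) \<zeta>1)"

text \<open>
  The iterated kernel of index \<open>n \<ge> 1\<close> (index \<open>0\<close> is never used). The integration variables
  \<open>\<zeta>\<^sub>2, \<dots>, \<zeta>\<^sub>n\<close> are the components of \<open>\<xi>\<close>; in \<open>w\<close> they are joined by the first component \<open>\<zeta>\<^sub>1\<close>.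
\<close>
definition K_iter ::
  "complex set \<Rightarrow> complex set \<Rightarrow> (complex \<Rightarrow> complex) \<Rightarrow> (complex \<Rightarrow> complex)
    \<Rightarrow> nat \<Rightarrow> complex \<Rightarrow> complex \<Rightarrow> real" where
  "K_iter S T \<phi>1 \<phi>2 n z \<zeta>1 =
     (if n \<le> 1 then K_cut S \<phi>1 \<phi>2 z \<zeta>1
      else (LINT \<xi>:(\<Pi>\<^sub>E j\<in>{2..n}. disk_preimage \<phi>2 T)|(\<Pi>\<^sub>M j\<in>{2..n}. arc_length).
              (let w = \<xi>(1 := \<zeta>1) in
               K_cut S \<phi>1 \<phi>2 z (w n) *
               (\<Prod>j\<in>{1..<n}. K_cut S \<phi>1 \<phi>2 (\<phi>2 (w (j+1))) (w j)))))"

definition K_sum ::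
  "complex set \<Rightarrow> complex set \<Rightarrow> (complex \<Rightarrow> complex) \<Rightarrow> (complex \<Rightarrow> complex)
    \<Rightarrow> complex \<Rightarrow> complex \<Rightarrow> real" where
  "K_sum S T \<phi>1 \<phi>2 z \<zeta>1 =
     (\<Sum>n. 1 / (2*pi) ^ (2 * Suc n) * K_iter S T \<phi>1 \<phi>2 (Suc n) z \<zeta>1)"

end

theory Submission
  imports Defs
begin

text \<open>
  The identity is the Neumann series of a Schwarz alternating scheme. Cut \<open>D\<close> along \<open>S\<close>.
  Transplanted to the unit disk by \<open>\<phi>1\<close>, the solution \<open>u\<close> is the Poisson integral of its own
  boundary values (\<open>poisson_solution\<close>, \<open>solution_split\<close>): these are \<open>f\<close> on the preimage of
  the boundary of \<open>D\<close> and the unknown restriction of \<open>u\<close> to \<open>S\<close> on the rest. The cuts \<open>T\<close> do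
  not meet \<open>S\<close>, so in the same way, with \<open>\<phi>2\<close> for \<open>\<phi>1\<close>, the restriction of \<open>u\<close> to \<open>S\<close> is expressed by
  \<open>f\<close> and the restriction of \<open>u\<close> to \<open>T\<close>. Substituting the second formula into the first gives
  the integral equation \<open>u = h + L u / (2 * pi)\<^sup>2\<close> of \<open>integral_equation\<close>, where \<open>L\<close> integrates
  against the kernel \<open>K\<close> over the preimage of \<open>T\<close>.

  Iterating the equation \<open>t\<close> times leaves a remainder of the form \<open>L\<^bsup>t+1\<^esup> u / (2 * pi)\<^bsup>2*(t+1)\<^esup>\<close>.
  The kernel is nonnegative of total mass at most \<open>2 * pi * m\<close>, since \<open>m / (2 * pi)\<close> bounds on \<open>S\<close>
  the harmonic measure of \<open>T\<close> in the cut domain; hence the remainder is at most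
  \<open>(m / (2 * pi))\<^bsup>t+1\<^esup>\<close> times the supremum of \<open>\<bar>u\<bar>\<close>. The latter is at most that of \<open>\<bar>f\<bar>\<close>: alternating
  between the two cut domains contracts any excess of \<open>\<bar>u\<bar>\<close> over it (\<open>u_le_on_T\<close>). That
  \<open>m < 2 * pi\<close> (\<open>m_less\<close>) follows by compactness, because the preimages of \<open>S\<close> and \<open>T\<close> under
  \<open>\<phi>2\<close> in the closed disk are disjoint compact sets. The same fact bounds the kernel.

  Multiple integrals and convergence are treated for abstract kernels in the locale
  \<open>iterated_kernel\<close>. Analytic input is needed at two places. On the disk a harmonic function is the real
  part of a holomorphic one, so that the Poisson formula reduces to Cauchy's. And the Poisson integral
  sees radial limits only up to sets of length zero: the points where boundary values are uncontrolled, the jumps of \<open>f\<close>, are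
  finitely many, and a Riemann map attains a given boundary value only on a set of length zero
  (\<open>boundary_zeros_null\<close>).
\<close>

section \<open>Poisson integrals on the unit circle\<close>
lemma sets_arc_length [simp, measurable_cong]: "sets arc_length = sets borel"
  by (simp add: arc_length_def)

lemma space_arc_length [simp]: "space arc_length = UNIV"
  by (simp add: arc_length_def)

lemma cis_measurable [measurable]: "cis \<in> borel_measurable borel"
  by (intro borel_measurable_continuous_onI continuous_intros)

interpretation arc_length: finite_measure arc_length
proof
  have "emeasure arc_length (space arc_length) = emeasure lborel {0..<2*pi}"
    unfolding arc_length_def
    by (subst emeasure_distr) (auto simp: emeasure_restrict_space space_restrict_space
        intro!: measurable_restrict_space1)
  then show "emeasure arc_length (space arc_length) \<noteq> \<infinity>"
    by simp
qed

lemma AE_arc_length_sphere: "AE \<zeta> in arc_length. \<zeta> \<in> sphere 0 1"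
  unfolding arc_length_def
  by (subst AE_distr_iff) (auto intro!: measurable_restrict_space1)

lemma arc_length_integrable_bounded:
  fixes f :: "complex \<Rightarrow> real"
  assumes [measurable]: "f \<in> borel_measurable borel"
    and "\<And>\<zeta>. cmod \<zeta> = 1 \<Longrightarrow> \<bar>f \<zeta>\<bar> \<le> c"
  shows "integrable arc_length f"
proof (rule arc_length.integrable_const_bound[where B = c])
  show "AE \<zeta> in arc_length. norm (f \<zeta>) \<le> c"
    using AE_arc_length_sphere by eventually_elim (use assms(2) in auto)
qed simp

lemma arc_length_set_integral_has_integral:
  fixes f :: "complex \<Rightarrow> complex"
  assumes f: "continuous_on (sphere 0 1) f"
  shows "((\<lambda>t. f (cis t)) has_integral (LINT \<zeta>:sphere 0 1|arc_length. f \<zeta>)) {0..2*pi}"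
proof -
  let ?f = "\<lambda>\<zeta>. indicator (sphere 0 1) \<zeta> *\<^sub>R f \<zeta>"
  have [measurable]: "?f \<in> borel_measurable borel"
    by (rule borel_measurable_continuous_on_indicator[OF _ f]) auto
  have fc: "continuous_on {0..2*pi} (\<lambda>t. f (cis t))"
    by (rule continuous_on_compose2[OF f]) (auto intro!: continuous_intros)
  have int: "set_integrable lborel {0..2*pi} (\<lambda>t. f (cis t))"
    unfolding set_integrable_def by (rule borel_integrable_compact) (use fc in auto)
  have "(LINT \<zeta>:sphere 0 1|arc_length. f \<zeta>) = (\<integral>t. ?f (cis t) \<partial>restrict_space lborel {0..<2*pi})"
    unfolding arc_length_def set_lebesgue_integral_def
    by (rule integral_distr) (auto intro!: measurable_restrict_space1)
  also have "\<dots> = (LINT t:{0..<2*pi}|lborel. f (cis t))"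
    by (subst integral_restrict_space) (auto simp: set_lebesgue_integral_def)
  also have "\<dots> = (LINT t:{0..2*pi}|lborel. f (cis t))"
    unfolding set_lebesgue_integral_def
  proof (rule integral_cong_AE)
    show "(\<lambda>t. indicator {0..2*pi} t *\<^sub>R f (cis t)) \<in> borel_measurable lborel"
      using int by (simp add: set_integrable_def borel_measurable_integrable)
    have "(\<lambda>t. indicator {0..<2*pi} t *\<^sub>R ?f (cis t)) \<in> borel_measurable lborel"
      by measurable
    then show "(\<lambda>t. indicator {0..<2*pi} t *\<^sub>R f (cis t)) \<in> borel_measurable lborel"
      by simp
    have "AE t in lborel. t \<noteq> 2*pi" by (rule AE_lborel_singleton)
    then show "AE t in lborel. indicator {0..<2*pi} t *\<^sub>R f (cis t) = indicator {0..2*pi} t *\<^sub>R f (cis t)"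
      by eventually_elim (auto simp: indicator_def)
  qed
  also have "\<dots> = integral {0..2*pi} (\<lambda>t. f (cis t))"
    by (rule set_borel_integral_eq_integral(2)[OF int])
  finally show ?thesis
    using integrable_continuous_real[OF fc] by (simp add: has_integral_integral)
qed

lemma poisson_measurable [measurable]:
  assumes [measurable]: "f \<in> borel_measurable M" "g \<in> borel_measurable M"
  shows "(\<lambda>x. poisson (f x) (g x)) \<in> borel_measurable M"
  unfolding poisson_def by measurable

lemma poisson_nonneg: "cmod z \<le> 1 \<Longrightarrow> 0 \<le> poisson z \<zeta>"
  by (simp add: poisson_def power_le_one)

lemma poisson_on_circle: "cmod z = 1 \<Longrightarrow> poisson z \<zeta> = 0"
  by (simp add: poisson_def)

lemma poisson_le_dist:
  assumes "cmod z \<le> 1" "0 < d" "d \<le> cmod (z - \<zeta>)"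
  shows "poisson z \<zeta> \<le> 1 / d\<^sup>2"
  unfolding poisson_def using assms by (intro frac_le power_mono) (auto simp: power_le_one)

lemma poisson_le:
  assumes "cmod z < 1" "cmod \<zeta> = 1"
  shows "poisson z \<zeta> \<le> 1 / (1 - cmod z)\<^sup>2"
  using assms norm_triangle_ineq2[of \<zeta> z] by (intro poisson_le_dist) (auto simp: norm_minus_commute)

lemma poisson_pos: "cmod z < 1 \<Longrightarrow> cmod \<zeta> = 1 \<Longrightarrow> 0 < poisson z \<zeta>"
  unfolding poisson_def by (intro divide_pos_pos) (auto simp: power_less_one_iff)

text \<open>
  With \<open>c = 1 - \<bar>z\<bar>\<^sup>2\<close>, the function \<open>G \<zeta> = c * F \<zeta> / (1 - cnj z * \<zeta>)\<close> is holomorphic near the closed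
  disk and agrees with \<open>F\<close> at \<open>z\<close>. On the circle \<open>1 - cnj z * \<zeta> = \<zeta> * cnj (\<zeta> - z)\<close>, so that
  the integrand \<open>G \<zeta> / (\<zeta> - z)\<close> of Cauchy's formula is \<open>F \<zeta>\<close> times the Poisson kernel, divided
  by \<open>\<zeta>\<close>.
\<close>
lemma poisson_formula_holomorphic:
  fixes F :: "complex \<Rightarrow> complex"
  assumes F: "F holomorphic_on ball 0 R" and R: "R > 1" and z: "cmod z < 1"
  shows "(LINT \<zeta>:sphere 0 1|arc_length. of_real (poisson z \<zeta>) * F \<zeta>) = 2 * pi * F z"
proof -
  define c where "c = 1 - cnj z * z"
  have c: "c = of_real (1 - (cmod z)\<^sup>2)"
    unfolding c_def using complex_norm_square[of z] by (simp add: mult.commute)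
  have c0: "c \<noteq> 0"
    unfolding c of_real_eq_0_iff using z abs_square_less_1[of "cmod z"] by simp
  define G where "G \<zeta> = c * F \<zeta> / (1 - cnj z * \<zeta>)" for \<zeta>
  have nz: "1 - cnj z * \<zeta> \<noteq> 0" if "\<zeta> \<in> cball 0 1" for \<zeta>
  proof
    assume "1 - cnj z * \<zeta> = 0"
    then have "cmod z * cmod \<zeta> = 1"
      by (metis complex_mod_cnj eq_iff_diff_eq_0 norm_mult norm_one)
    moreover have "cmod z * cmod \<zeta> \<le> cmod z"
      using that by (simp add: mult_left_le)
    ultimately show False using z by simp
  qed
  have sub: "cball 0 1 \<subseteq> ball (0::complex) R" using R by auto
  have Gh: "G holomorphic_on cball 0 1"
    unfolding G_def using nz holomorphic_on_subset[OF F sub] by (intro holomorphic_intros) auto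
  have "((\<lambda>\<zeta>. G \<zeta> / (\<zeta> - z)) has_contour_integral (2 * of_real pi * \<i> * G z)) (circlepath 0 1)"
    using z by (intro Cauchy_integral_circlepath holomorphic_on_imp_continuous_on[OF Gh]
        holomorphic_on_subset[OF Gh]) auto
  then have 1: "((\<lambda>t. G (cis t) / (cis t - z) * \<i> * cis t) has_integral (2 * of_real pi * \<i> * G z)) {0..2*pi}"
    unfolding circlepath_def by (subst (asm) has_contour_integral_part_circlepath_iff) auto
  have Gz: "G z = F z"
    using c0 by (simp add: G_def c_def)
  have eq: "-\<i> * (G (cis t) / (cis t - z) * \<i> * cis t) = of_real (poisson z (cis t)) * F (cis t)" for t
  proof -
    let ?e = "cis t"
    have ne: "?e - z \<noteq> 0" using z by auto
    have "(1 - cnj z * ?e) = ?e * cnj (?e - z)"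
      by (simp add: algebra_simps cis_cnj cis_mult)
    then have "(1 - cnj z * ?e) * (?e - z) = ?e * of_real ((cmod (z - ?e))\<^sup>2)"
      by (metis complex_norm_square mult.assoc mult.commute norm_minus_commute)
    then have "G ?e / (?e - z) = c * F ?e / (?e * of_real ((cmod (z - ?e))\<^sup>2))"
      by (simp add: G_def)
    moreover have "-\<i> * (G ?e / (?e - z) * \<i> * ?e) = G ?e / (?e - z) * ?e"
      by (simp add: algebra_simps)
    ultimately show ?thesis
      by (simp add: poisson_def c)
  qed
  have 2: "((\<lambda>t. of_real (poisson z (cis t)) * F (cis t)) has_integral (2 * pi * F z)) {0..2*pi}"
    using has_integral_mult_right[OF 1, of "-\<i>"] unfolding eq Gz by (simp add: algebra_simps)
  have "continuous_on (sphere 0 1) (\<lambda>\<zeta>. of_real (poisson z \<zeta>) * F \<zeta>)"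
    unfolding poisson_def using z R
    by (intro continuous_intros holomorphic_on_imp_continuous_on holomorphic_on_subset[OF F]) auto
  from has_integral_unique[OF arc_length_set_integral_has_integral[OF this] 2] show ?thesis .
qed

lemma poisson_set_integrable:
  assumes F: "continuous_on (sphere 0 1) F" and z: "cmod z < 1"
  shows "set_integrable arc_length (sphere 0 1) (\<lambda>\<zeta>. complex_of_real (poisson z \<zeta>) * F \<zeta>)"
proof -
  have c: "continuous_on (sphere 0 1) (\<lambda>\<zeta>. complex_of_real (poisson z \<zeta>) * F \<zeta>)"
    unfolding poisson_def using z by (intro continuous_intros F) auto
  have "compact ((\<lambda>\<zeta>. complex_of_real (poisson z \<zeta>) * F \<zeta>) ` sphere 0 1)"
    by (intro compact_continuous_image c) auto
  from compact_imp_bounded[OF this]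
  obtain B where B: "\<And>\<zeta>. \<zeta> \<in> sphere 0 1 \<Longrightarrow> cmod (complex_of_real (poisson z \<zeta>) * F \<zeta>) \<le> B"
    unfolding bounded_iff by blast
  show ?thesis
    unfolding set_integrable_def
  proof (rule arc_length.integrable_const_bound[where B = B])
    show "AE \<zeta> in arc_length. norm (indicator (sphere 0 1) \<zeta> *\<^sub>R (complex_of_real (poisson z \<zeta>) * F \<zeta>)) \<le> B"
      using AE_arc_length_sphere by eventually_elim (use B in auto)
    show "(\<lambda>\<zeta>. indicator (sphere 0 1) \<zeta> *\<^sub>R (complex_of_real (poisson z \<zeta>) * F \<zeta>)) \<in> borel_measurable arc_length"
      using borel_measurable_continuous_on_indicator[OF _ c] by (simp cong: measurable_cong_sets)
  qed
qed

lemma poisson_formula_Re: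
  assumes F: "F holomorphic_on ball 0 R" and R: "R > 1" and z: "cmod z < 1"
  shows "(\<integral>\<zeta>. indicator (sphere 0 1) \<zeta> * (poisson z \<zeta> * Re (F \<zeta>)) \<partial>arc_length) = 2 * pi * Re (F z)"
proof -
  have Fc: "continuous_on (sphere 0 1) F"
    using R by (intro holomorphic_on_imp_continuous_on holomorphic_on_subset[OF F]) auto
  have "2 * pi * Re (F z) = Re (LINT \<zeta>:sphere 0 1|arc_length. of_real (poisson z \<zeta>) * F \<zeta>)"
    by (simp add: poisson_formula_holomorphic[OF assms])
  also have "\<dots> = (\<integral>\<zeta>. Re (indicator (sphere 0 1) \<zeta> *\<^sub>R (of_real (poisson z \<zeta>) * F \<zeta>)) \<partial>arc_length)"
    unfolding set_lebesgue_integral_def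
    using integral_Re[OF poisson_set_integrable[OF Fc z, unfolded set_integrable_def]] by (rule sym)
  finally show ?thesis by simp
qed

lemma poisson_integral_one:
  assumes "cmod z < 1"
  shows "(\<integral>\<zeta>. poisson z \<zeta> \<partial>arc_length) = 2 * pi"
proof -
  have "(\<integral>\<zeta>. poisson z \<zeta> \<partial>arc_length) = (\<integral>\<zeta>. indicator (sphere 0 1) \<zeta> * (poisson z \<zeta> * Re 1) \<partial>arc_length)"
  proof (rule integral_cong_AE)
    show "AE \<zeta> in arc_length. poisson z \<zeta> = indicator (sphere 0 1) \<zeta> * (poisson z \<zeta> * Re 1)"
      using AE_arc_length_sphere by eventually_elim simp
    have [measurable]: "sphere (0::complex) 1 \<in> sets borel" by simp
    show "(\<lambda>\<zeta>. indicator (sphere 0 1) \<zeta> * (poisson z \<zeta> * Re 1)) \<in> borel_measurable arc_length"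
      unfolding one_complex.sel by measurable
  qed simp
  also have "\<dots> = 2 * pi"
    using poisson_formula_Re[of "\<lambda>_. 1" 2 z] assms by auto
  finally show ?thesis .
qed

lemma poisson_mult_integrable:
  assumes [measurable]: "b \<in> borel_measurable borel"
    and b: "AE \<zeta> in arc_length. \<bar>b \<zeta>\<bar> \<le> M" and z: "cmod z < 1"
  shows "integrable arc_length (\<lambda>\<zeta>. poisson z \<zeta> * b \<zeta>)"
proof (rule arc_length.integrable_const_bound)
  show "AE \<zeta> in arc_length. norm (poisson z \<zeta> * b \<zeta>) \<le> 1 / (1 - cmod z)\<^sup>2 * M"
    using AE_arc_length_sphere b
  proof eventually_elim
    case (elim \<zeta>)
    then have "poisson z \<zeta> * \<bar>b \<zeta>\<bar> \<le> 1 / (1 - cmod z)\<^sup>2 * M"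
      using poisson_le[OF z, of \<zeta>] poisson_nonneg[of z \<zeta>] z by (intro mult_mono) auto
    then show ?case
      using poisson_nonneg[of z \<zeta>] z by (simp add: abs_mult)
  qed
qed simp

lemma poisson_set_integral_le:
  assumes [measurable]: "B \<in> sets borel" and z: "cmod z \<le> 1"
  shows "(LINT \<zeta>:B|arc_length. poisson z \<zeta>) \<le> 2 * pi"
    and "0 \<le> (LINT \<zeta>:B|arc_length. poisson z \<zeta>)"
proof -
  show "0 \<le> (LINT \<zeta>:B|arc_length. poisson z \<zeta>)"
    unfolding set_lebesgue_integral_def
    using z by (intro integral_nonneg_AE) (auto simp: poisson_nonneg)
  show "(LINT \<zeta>:B|arc_length. poisson z \<zeta>) \<le> 2 * pi"
  proof (cases "cmod z < 1")
    case True
    have i: "integrable arc_length (poisson z)"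
      using poisson_mult_integrable[of "\<lambda>_. 1" 1 z] True by simp
    have "(LINT \<zeta>:B|arc_length. poisson z \<zeta>) \<le> (\<integral>\<zeta>. poisson z \<zeta> \<partial>arc_length)"
      unfolding set_lebesgue_integral_def
    proof (rule integral_mono)
      show "integrable arc_length (\<lambda>\<zeta>. indicator B \<zeta> *\<^sub>R poisson z \<zeta>)"
        by (rule integrable_mult_indicator[OF _ i]) simp
    qed (use i z in \<open>auto simp: poisson_nonneg indicator_def\<close>)
    then show ?thesis using True by (simp add: poisson_integral_one)
  next
    case False
    then show ?thesis using z by (simp add: poisson_on_circle)
  qed
qed

text \<open>
  The Poisson formula holds for the dilates \<open>F (r * \<zeta>)\<close>, \<open>r < 1\<close>, and survives the limit
  \<open>r \<longlonglongrightarrow> 1\<close> by dominated convergence. Radial limits almost everywhere are enough, which is how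
  the jumps of the boundary data disappear.
\<close>
lemma poisson_representation:
  assumes F: "F holomorphic_on ball 0 1" and M: "\<And>w. w \<in> ball 0 1 \<Longrightarrow> \<bar>Re (F w)\<bar> \<le> M"
    and b [measurable]: "b \<in> borel_measurable borel"
    and lim: "AE \<zeta> in arc_length. ((\<lambda>r. Re (F (of_real r * \<zeta>))) \<longlongrightarrow> b \<zeta>) (at_left 1)"
    and z: "cmod z < 1"
  shows "Re (F z) = 1 / (2 * pi) * (\<integral>\<zeta>. poisson z \<zeta> * b \<zeta> \<partial>arc_length)"
proof -
  \<comment> \<open>any sequence of radii in the open unit interval that tends to 1\<close>
  define r where "r n = 1 - 1 / (real n + 2)" for n
  have r: "0 < r n" "r n < 1" for n by (auto simp: r_def field_simps)
  have r1: "r \<longlonglongrightarrow> 1" unfolding r_def by real_asymp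
  have rl: "filterlim r (at_left 1) sequentially"
    by (rule tendsto_imp_filterlim_at_left[OF r1]) (use r in auto)
  let ?s = "\<lambda>n \<zeta>. indicator (sphere 0 1) \<zeta> * (poisson z \<zeta> * Re (F (of_real (r n) * \<zeta>)))"
  have in_ball: "of_real (r n) * \<zeta> \<in> ball 0 1" if "cmod \<zeta> = 1" for n and \<zeta> :: complex
    using that r[of n] by (simp add: norm_mult)
  have hol: "(\<lambda>w. F (of_real (r n) * w)) holomorphic_on ball 0 (1 / r n)" for n
    by (rule holomorphic_on_compose_gen[OF _ F, unfolded o_def])
       (use r[of n] in \<open>auto intro!: holomorphic_intros simp: norm_mult field_simps\<close>)
  have eq: "integral\<^sup>L arc_length (?s n) = 2 * pi * Re (F (of_real (r n) * z))" for n
    using poisson_formula_Re[OF hol _ z] r[of n] by simp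
  have [measurable]: "?s n \<in> borel_measurable borel" for n
  proof -
    have c: "continuous_on (sphere 0 1) (\<lambda>\<zeta>. poisson z \<zeta> * Re (F (of_real (r n) * \<zeta>)))"
      unfolding poisson_def using z in_ball
      by (intro continuous_intros continuous_on_compose2[OF holomorphic_on_imp_continuous_on[OF F]]) auto
    show ?thesis
      using borel_measurable_continuous_on_indicator[OF _ c] by simp
  qed
  have "(\<lambda>n. integral\<^sup>L arc_length (?s n)) \<longlonglongrightarrow> (\<integral>\<zeta>. poisson z \<zeta> * b \<zeta> \<partial>arc_length)"
  proof (rule integral_dominated_convergence[where w = "\<lambda>_. 1 / (1 - cmod z)\<^sup>2 * M"])
    show "AE \<zeta> in arc_length. (\<lambda>n. ?s n \<zeta>) \<longlonglongrightarrow> poisson z \<zeta> * b \<zeta>"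
      using lim AE_arc_length_sphere
    proof eventually_elim
      case (elim \<zeta>)
      have "(\<lambda>n. Re (F (of_real (r n) * \<zeta>))) \<longlonglongrightarrow> b \<zeta>"
        by (rule filterlim_compose[OF elim(1) rl])
      then show ?case using elim(2) by (auto intro!: tendsto_intros)
    qed
    fix n
    show "AE \<zeta> in arc_length. norm (?s n \<zeta>) \<le> 1 / (1 - cmod z)\<^sup>2 * M"
      using AE_arc_length_sphere
    proof eventually_elim
      case (elim \<zeta>)
      then have \<zeta>: "cmod \<zeta> = 1" by simp
      have "poisson z \<zeta> * \<bar>Re (F (of_real (r n) * \<zeta>))\<bar> \<le> 1 / (1 - cmod z)\<^sup>2 * M"
        using poisson_le[OF z \<zeta>] poisson_nonneg[of z \<zeta>] z M[OF in_ball[OF \<zeta>]] by (intro mult_mono) auto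
      then show ?case
        using poisson_nonneg[of z \<zeta>] z elim by (simp add: abs_mult)
    qed
  qed auto
  moreover have "(\<lambda>n. 2 * pi * Re (F (of_real (r n) * z))) \<longlonglongrightarrow> 2 * pi * Re (F z)"
  proof -
    have "isCont F z"
      using holomorphic_on_imp_continuous_on[OF F] z by (simp add: continuous_on_eq_continuous_at)
    moreover have "(\<lambda>n. of_real (r n) * z) \<longlonglongrightarrow> z"
      using tendsto_mult[OF tendsto_of_real[OF r1], of "\<lambda>_. z" z] by simp
    ultimately have "(\<lambda>n. F (of_real (r n) * z)) \<longlonglongrightarrow> F z"
      using isCont_tendsto_compose by blast
    then show ?thesis by (intro tendsto_intros)
  qed
  ultimately have "(\<integral>\<zeta>. poisson z \<zeta> * b \<zeta> \<partial>arc_length) = 2 * pi * Re (F z)"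
    unfolding eq using LIMSEQ_unique by blast
  then show ?thesis by simp
qed

text \<open>
  A special case of the uniqueness theorem of F. and M. Riesz. As \<open>g\<close> has no zero inside, it is
  \<open>exp L\<close>, and \<open>Re L \<le> ln (\<bar>g\<bar> + \<delta>)\<close>. The mean value of \<open>Re L\<close> on circles, taken to the
  boundary, bounds \<open>2 * pi * ln \<bar>g 0\<bar>\<close> by the integral of \<open>ln (\<bar>g\<bar> + \<delta>)\<close>. If \<open>g\<close>
  vanished on a set of positive length, that integral would tend to \<open>-\<infinity>\<close> as \<open>\<delta>\<close> tends to 0.
\<close>
lemma boundary_zeros_null:
  assumes g: "g holomorphic_on ball 0 1" and gc: "continuous_on (cball 0 1) g"
    and nz: "\<And>w. w \<in> ball 0 1 \<Longrightarrow> g w \<noteq> 0"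
  shows "AE \<zeta> in arc_length. \<not> (cmod \<zeta> = 1 \<and> g \<zeta> = 0)"
proof -
  have "simply_connected (ball (0::complex) 1)"
    by (simp add: convex_imp_simply_connected)
  then obtain L where L: "L holomorphic_on ball 0 1" and gL: "\<And>w. w \<in> ball 0 1 \<Longrightarrow> g w = exp (L w)"
    using simply_connected_eq_holomorphic_log[of "ball 0 1"] g nz by (metis open_ball)
  define E where "E = {\<zeta> \<in> sphere 0 1. g \<zeta> = 0}"
  have gs: "continuous_on (sphere 0 1) g" 
    by (rule continuous_on_subset[OF gc]) auto
  have "closed E"
    unfolding E_def using continuous_closed_preimage_constant[OF gs, of 0] by simp
  then have [measurable]: "E \<in> sets borel" by simp
  have "compact (g ` cball 0 1)"
    by (intro compact_continuous_image gc) auto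
  from compact_imp_bounded[OF this]
  obtain M0 where M0: "\<And>w. w \<in> cball 0 1 \<Longrightarrow> cmod (g w) \<le> M0"
    unfolding bounded_iff by blast
  define M where "M = max 1 M0"
  have M: "cmod (g w) \<le> M" if "w \<in> cball 0 1" for w using M0[OF that] by (simp add: M_def)
  have M1: "1 \<le> M" by (simp add: M_def)
  have lnM: "0 \<le> ln (M + 1)" using M1 by simp
  define \<epsilon> where "\<epsilon> = measure arc_length E"
  define m where "m = measure arc_length UNIV"
  define r where "r n = 1 - 1 / (real n + 2)" for n
  have r: "0 < r n" "r n < 1" for n by (auto simp: r_def field_simps)
  have r1: "r \<longlonglongrightarrow> 1" unfolding r_def by real_asymp
  have in_ball: "of_real (r n) * \<zeta> \<in> ball 0 1" if "cmod \<zeta> = 1" for n and \<zeta> :: complex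
    using that r[of n] by (simp add: norm_mult)
  have main: "2 * pi * Re (L 0) \<le> - K * \<epsilon> + ln (M + 1) * m" if K: "K \<ge> 0" for K
  proof -
    \<comment> \<open>so that \<open>ln (\<bar>g\<bar> + \<delta>)\<close> equals \<open>-K\<close> on \<open>E\<close>\<close>
    define \<delta> where "\<delta> = exp (-K)"
    have \<delta>: "0 < \<delta>" "\<delta> \<le> 1" using K by (auto simp: \<delta>_def)
    let ?l = "\<lambda>w. ln (cmod (g w) + \<delta>)"
    let ?s = "\<lambda>n \<zeta>. indicator (sphere 0 1) \<zeta> * ?l (of_real (r n) * \<zeta>)"
    have bd: "\<bar>?l w\<bar> \<le> K + ln (M + 1)" if "w \<in> cball 0 1" for w
    proof -
      have "ln \<delta> \<le> ?l w" using \<delta> by (intro ln_mono) (auto simp: add_pos_nonneg)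
      moreover have "?l w \<le> ln (M + 1)"
        using \<delta> M[OF that] by (intro ln_mono) (auto simp: add_nonneg_pos)
      ultimately show ?thesis unfolding abs_le_iff using K lnM by (simp add: \<delta>_def)
    qed
    have posd: "cmod (g w) + \<delta> \<noteq> 0" for w using \<delta> by (smt (verit) norm_ge_zero)
    have lc: "continuous_on (cball 0 1) ?l"
      using posd by (intro continuous_intros gc) auto
    have ms [measurable]: "?s n \<in> borel_measurable borel" for n
    proof -
      have c: "continuous_on (sphere 0 1) (\<lambda>\<zeta>. ?l (of_real (r n) * \<zeta>))"
        by (rule continuous_on_compose2[OF lc]) (use in_ball[of _ n] in \<open>auto intro!: continuous_intros simp: less_imp_le\<close>)
      show ?thesis
        using borel_measurable_continuous_on_indicator[OF _ c] by simp
    qed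
    have [measurable]: "(\<lambda>\<zeta>. indicator (sphere 0 1) \<zeta> * ?l \<zeta>) \<in> borel_measurable borel"
      using borel_measurable_continuous_on_indicator[OF _ continuous_on_subset[OF lc], of "sphere 0 1"] by simp
    have lim: "(\<lambda>n. integral\<^sup>L arc_length (?s n)) \<longlonglongrightarrow> (\<integral>\<zeta>. indicator (sphere 0 1) \<zeta> * ?l \<zeta> \<partial>arc_length)"
    proof (rule integral_dominated_convergence[where w = "\<lambda>_. K + ln (M + 1)"])
      show "AE \<zeta> in arc_length. (\<lambda>n. ?s n \<zeta>) \<longlonglongrightarrow> indicator (sphere 0 1) \<zeta> * ?l \<zeta>"
        using AE_arc_length_sphere
      proof eventually_elim
        case (elim \<zeta>)
        have "(\<lambda>n. of_real (r n) * \<zeta>) \<longlonglongrightarrow> \<zeta>"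
          using tendsto_mult[OF tendsto_of_real[OF r1], of "\<lambda>_. \<zeta>" \<zeta>] by simp
        then have "(\<lambda>n. ?l (of_real (r n) * \<zeta>)) \<longlonglongrightarrow> ?l \<zeta>"
          by (intro continuous_on_tendsto_compose[OF lc])
             (use elim in_ball in \<open>auto intro!: always_eventually intro: less_imp_le\<close>)
        then show ?case using elim by simp
      qed
      show "AE \<zeta> in arc_length. norm (?s n \<zeta>) \<le> K + ln (M + 1)" for n
        using AE_arc_length_sphere
        by eventually_elim (use bd in_ball in \<open>auto simp: less_imp_le\<close>)
    qed auto
    have "2 * pi * Re (L 0) \<le> integral\<^sup>L arc_length (?s n)" for n
    proof -
      have hol: "(\<lambda>w. L (of_real (r n) * w)) holomorphic_on ball 0 (1 / r n)"
        by (rule holomorphic_on_compose_gen[OF _ L, unfolded o_def])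
           (use r[of n] in \<open>auto intro!: holomorphic_intros simp: norm_mult field_simps\<close>)
      let ?q = "\<lambda>\<zeta>. indicator (sphere 0 1) \<zeta> * (poisson 0 \<zeta> * Re (L (of_real (r n) * \<zeta>)))"
      have "2 * pi * Re (L 0) = integral\<^sup>L arc_length ?q"
        using poisson_formula_Re[OF hol, of 0] r[of n] by simp
      also have "\<dots> \<le> integral\<^sup>L arc_length (?s n)"
      proof (rule integral_mono_AE)
        have "continuous_on (sphere 0 1) (\<lambda>\<zeta>. L (of_real (r n) * \<zeta>))"
          using in_ball by (intro continuous_on_compose2[OF holomorphic_on_imp_continuous_on[OF L]] continuous_intros) auto
        from integrable_Re[OF poisson_set_integrable[OF this, of 0, unfolded set_integrable_def]]
        show "integrable arc_length ?q" by simp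
        show "integrable arc_length (?s n)"
          by (rule arc_length_integrable_bounded[where c = "K + ln (M + 1)"])
             (use bd in_ball in \<open>auto simp: less_imp_le\<close>)
        show "AE \<zeta> in arc_length. ?q \<zeta> \<le> ?s n \<zeta>"
          using AE_arc_length_sphere
        proof eventually_elim
          case (elim \<zeta>)
          let ?w = "of_real (r n) * \<zeta>"
          have "Re (L ?w) = ln (cmod (g ?w))"
            using gL[OF in_ball, of \<zeta> n] elim by simp
          also have "\<dots> \<le> ?l ?w"
            using \<delta> nz[OF in_ball, of \<zeta> n] elim by (intro ln_mono) auto
          finally show ?case using elim by (simp add: poisson_def)
        qed
      qed
      finally show ?thesis .
    qed
    then have "2 * pi * Re (L 0) \<le> (\<integral>\<zeta>. indicator (sphere 0 1) \<zeta> * ?l \<zeta> \<partial>arc_length)"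
      using LIMSEQ_le_const[OF lim] by blast
    also have "\<dots> \<le> (\<integral>\<zeta>. - K * indicator E \<zeta> + ln (M + 1) \<partial>arc_length)"
    proof (rule integral_mono_AE)
      show "integrable arc_length (\<lambda>\<zeta>. indicator (sphere 0 1) \<zeta> * ?l \<zeta>)"
        by (rule arc_length_integrable_bounded[where c = "K + ln (M + 1)"]) (use bd in auto)
      show "integrable arc_length (\<lambda>\<zeta>. - K * indicator E \<zeta> + ln (M + 1))"
        by (rule arc_length_integrable_bounded[where c = "K + ln (M + 1)"])
           (use K lnM in \<open>auto simp: indicator_def\<close>)
      show "AE \<zeta> in arc_length. indicator (sphere 0 1) \<zeta> * ?l \<zeta> \<le> - K * indicator E \<zeta> + ln (M + 1)"
        using AE_arc_length_sphere
      proof eventually_elim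
        case (elim \<zeta>)
        then have "\<zeta> \<in> cball 0 1" by simp
        then have "?l \<zeta> \<le> ln (M + 1)"
          using \<delta> M[of \<zeta>] by (intro ln_mono) (auto simp: add_nonneg_pos)
        moreover have "?l \<zeta> = - K" "0 \<le> ln (M + 1)" if "\<zeta> \<in> E"
          using that M1 by (auto simp: E_def \<delta>_def)
        ultimately show ?case using elim by (auto simp: indicator_def)
      qed
    qed
    also have "\<dots> = - K * \<epsilon> + ln (M + 1) * m"
      by (subst Bochner_Integration.integral_add)
         (auto simp: \<epsilon>_def m_def arc_length.emeasure_eq_measure)
    finally show ?thesis .
  qed
  have "\<epsilon> = 0"
  proof (rule ccontr)
    assume "\<epsilon> \<noteq> 0"
    then have e: "\<epsilon> > 0" using measure_nonneg[of arc_length E] unfolding \<epsilon>_def by linarith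
    define K where "K = (\<bar>ln (M + 1) * m - 2 * pi * Re (L 0)\<bar> + 1) / \<epsilon>"
    have "K \<ge> 0" using e by (simp add: K_def)
    from main[OF this] e show False by (simp add: K_def)
  qed
  then have "E \<in> null_sets arc_length"
    by (simp add: \<epsilon>_def null_sets_def arc_length.emeasure_eq_measure)
  then have "AE \<zeta> in arc_length. \<zeta> \<notin> E" by (rule AE_not_in)
  then show ?thesis by (auto simp: E_def elim!: eventually_mono)
qed

section \<open>Iterated kernels\<close>

text \<open>
  The parameter set \<open>B\<close> carries the integration and \<open>p\<close> maps it to the set \<open>X\<close> of points
  where functions are evaluated, so that \<open>k\<close> can be iterated. The pointwise bound \<open>C\<close> gives
  integrability; the norm of the integral operator is controlled by the mass bound \<open>Q\<close>.
\<close>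
locale iterated_kernel = finite_measure \<mu> for \<mu> :: "'a measure" +
  fixes B :: "'a set" and X :: "'z set" and p :: "'a \<Rightarrow> 'z" and k :: "'z \<Rightarrow> 'a \<Rightarrow> real"
    and C Q :: real
  assumes B [measurable]: "B \<in> sets \<mu>"
    and p: "\<And>\<zeta>. \<zeta> \<in> B \<Longrightarrow> p \<zeta> \<in> X"
    and k_measurable: "\<And>z. z \<in> X \<Longrightarrow> (\<lambda>\<zeta>. indicator B \<zeta> * k z \<zeta>) \<in> borel_measurable \<mu>"
    and k_measurable2:
      "(\<lambda>(\<xi>, \<zeta>). indicator B \<xi> * indicator B \<zeta> * k (p \<xi>) \<zeta>) \<in> borel_measurable (\<mu> \<Otimes>\<^sub>M \<mu>)"
    and k_nonneg: "\<And>z \<zeta>. z \<in> X \<Longrightarrow> \<zeta> \<in> B \<Longrightarrow> 0 \<le> k z \<zeta>"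
    and k_le: "\<And>z \<zeta>. z \<in> X \<Longrightarrow> \<zeta> \<in> B \<Longrightarrow> k z \<zeta> \<le> C"
    and k_integral_le: "\<And>z. z \<in> X \<Longrightarrow> (LINT \<zeta>:B|\<mu>. k z \<zeta>) \<le> Q"
    and C: "0 \<le> C"
begin

text \<open>
  Tuples are functions on \<open>{2..n}\<close>, and the free first variable is put in at index 1. The kernel runs
  from the last variable down to the first.
\<close>
definition iter :: "nat \<Rightarrow> 'z \<Rightarrow> 'a \<Rightarrow> real" where
  "iter n z \<zeta>1 =
     (if n \<le> 1 then k z \<zeta>1
      else (LINT \<xi>:(\<Pi>\<^sub>E j\<in>{2..n}. B)|(\<Pi>\<^sub>M j\<in>{2..n}. \<mu>).
              (let w = \<xi>(1 := \<zeta>1) in k z (w n) * (\<Prod>j\<in>{1..<n}. k (p (w (j+1))) (w j)))))"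

text \<open>
  The kernel is only controlled for parameters in \<open>B\<close>; extension by zero gives functions that are
  bounded and measurable on the whole space.
\<close>
definition row :: "'z \<Rightarrow> 'a \<Rightarrow> real" where
  "row z \<zeta> = indicator B \<zeta> * k z \<zeta>"

definition trans :: "'a \<Rightarrow> 'a \<Rightarrow> real" where
  "trans \<xi> \<zeta> = indicator B \<xi> * indicator B \<zeta> * k (p \<xi>) \<zeta>"

lemma row_measurable [measurable]: "z \<in> X \<Longrightarrow> row z \<in> borel_measurable \<mu>"
  using k_measurable[of z] unfolding row_def[abs_def] .

lemma trans_measurable [measurable]:
  assumes [measurable]: "f \<in> measurable M \<mu>" "g \<in> measurable M \<mu>"
  shows "(\<lambda>x. trans (f x) (g x)) \<in> borel_measurable M"
  using measurable_compose[OF _ k_measurable2, of "\<lambda>x. (f x, g x)" M]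
  unfolding trans_def[abs_def] by simp

lemma abs_row_le: "z \<in> X \<Longrightarrow> \<bar>row z \<zeta>\<bar> \<le> C"
  using k_nonneg k_le C by (auto simp: row_def indicator_def)

lemma abs_trans_le: "\<bar>trans \<xi> \<zeta>\<bar> \<le> C"
  using k_nonneg k_le C p by (auto simp: trans_def indicator_def)

text \<open>
  The integrand of the iterated kernel. The factors extended by zero make the restriction of the
  integral to tuples in \<open>B\<close> automatic.
\<close>
definition chain :: "nat \<Rightarrow> 'z \<Rightarrow> (nat \<Rightarrow> 'a) \<Rightarrow> real" where
  "chain n z w = row z (w n) * (\<Prod>j\<in>{1..<n}. trans (w (j+1)) (w j))"

lemma abs_chain_le:
  assumes "z \<in> X" shows "\<bar>chain n z w\<bar> \<le> C * C ^ (n - 1)"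
proof -
  have "(\<Prod>j\<in>{1..<n}. \<bar>trans (w (j+1)) (w j)\<bar>) \<le> (\<Prod>j\<in>{1..<n}. C)"
    by (intro prod_mono) (use abs_trans_le in auto)
  then show ?thesis
    unfolding chain_def abs_mult abs_prod using abs_row_le[OF assms, of "w n"] C
    by (intro mult_mono) (auto intro: prod_nonneg)
qed

lemma chain_Suc:
  assumes "n \<ge> 1" "\<zeta> \<in> B"
  shows "chain (Suc n) z (w(Suc n := \<zeta>)) = row z \<zeta> * chain n (p \<zeta>) w"
proof -
  have "(\<Prod>j\<in>{1..<n}. trans ((w(Suc n := \<zeta>)) (j+1)) ((w(Suc n := \<zeta>)) j))
      = (\<Prod>j\<in>{1..<n}. trans (w (j+1)) (w j))"
    by (intro prod.cong) auto
  then show ?thesis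
    using assms by (simp add: chain_def prod.atLeastLessThan_Suc trans_def row_def)
qed

lemma chain_Suc_outside: "\<zeta> \<notin> B \<Longrightarrow> chain (Suc n) z (w(Suc n := \<zeta>)) = 0"
  by (simp add: chain_def row_def)

lemma chain_measurable:
  assumes [measurable]: "\<zeta> \<in> space \<mu>" and "z \<in> X" "n \<ge> 1"
  shows "(\<lambda>\<xi>. chain n z (\<xi>(1 := \<zeta>))) \<in> borel_measurable (\<Pi>\<^sub>M j\<in>{2..n}. \<mu>)"
proof -
  have m: "(\<lambda>\<xi>. (\<xi>(1 := \<zeta>)) j) \<in> measurable (\<Pi>\<^sub>M j\<in>{2..n}. \<mu>) \<mu>" if "j \<in> {1..n}" for j
    using that assms(1) by (cases "j = 1") (auto intro!: measurable_component_singleton)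
  show ?thesis
    unfolding chain_def
  proof (intro borel_measurable_times borel_measurable_prod trans_measurable)
    show "(\<lambda>\<xi>. row z ((\<xi>(1 := \<zeta>)) n)) \<in> borel_measurable (\<Pi>\<^sub>M j\<in>{2..n}. \<mu>)"
      by (rule measurable_compose[OF m row_measurable]) (use assms in auto)
    fix j assume "j \<in> {1..<n}"
    then show "(\<lambda>\<xi>. (\<xi>(1 := \<zeta>)) (j + 1)) \<in> measurable (\<Pi>\<^sub>M j\<in>{2..n}. \<mu>) \<mu>"
      and "(\<lambda>\<xi>. (\<xi>(1 := \<zeta>)) j) \<in> measurable (\<Pi>\<^sub>M j\<in>{2..n}. \<mu>) \<mu>"
      by (auto intro!: m simp del: fun_upd_apply One_nat_def)
  qed
qed

sublocale product_sigma_finite "\<lambda>_::nat. \<mu>"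
  by standard

lemma finite_measure_power: "finite_measure (\<Pi>\<^sub>M j\<in>{2..n::nat}. \<mu>)"
proof (rule finite_measureI)
  show "emeasure (\<Pi>\<^sub>M j\<in>{2..n}. \<mu>) (space (\<Pi>\<^sub>M j\<in>{2..n}. \<mu>)) \<noteq> \<infinity>"
    unfolding space_PiM by (subst emeasure_PiM) (auto simp: emeasure_eq_measure ennreal_power)
qed

lemma iter_eq_chain:
  assumes "\<zeta>1 \<in> B" "n \<ge> 1"
  shows "iter n z \<zeta>1 = (\<integral>\<xi>. chain n z (\<xi>(1 := \<zeta>1)) \<partial>(\<Pi>\<^sub>M j\<in>{2..n}. \<mu>))"
proof (cases "n = 1")
  case True
  then show ?thesis
    using assms by (simp add: iter_def chain_def PiM_empty lebesgue_integral_count_space_finite row_def)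
next
  case False
  with assms have n: "n \<ge> 2" and n1: "\<not> n \<le> 1" by simp_all
  show ?thesis
    unfolding iter_def set_lebesgue_integral_def if_not_P[OF n1]
  proof (intro Bochner_Integration.integral_cong refl)
    fix \<xi> assume \<xi>: "\<xi> \<in> space (\<Pi>\<^sub>M j\<in>{2..n}. \<mu>)"
    define w where "w = \<xi>(1 := \<zeta>1)"
    show "indicator (\<Pi>\<^sub>E j\<in>{2..n}. B) \<xi> *\<^sub>R (let w = \<xi>(1 := \<zeta>1) in
        k z (w n) * (\<Prod>j\<in>{1..<n}. k (p (w (j+1))) (w j))) = chain n z (\<xi>(1 := \<zeta>1))"
    proof (cases "\<xi> \<in> (\<Pi>\<^sub>E j\<in>{2..n}. B)")
      case True
      then have wB: "w j \<in> B" if "j \<in> {1..n}" for j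
        using that assms(1) by (cases "j = 1") (auto simp: w_def PiE_iff)
      then have "(\<Prod>j\<in>{1..<n}. k (p (w (j+1))) (w j)) = (\<Prod>j\<in>{1..<n}. trans (w (j+1)) (w j))"
        by (intro prod.cong) (auto simp: trans_def)
      then show ?thesis
        unfolding Let_def w_def[symmetric] using True wB[of n] n by (simp add: chain_def row_def)
    next
      case False
      then obtain j where j: "j \<in> {2..n}" "\<xi> j \<notin> B"
        using \<xi> by (auto simp: space_PiM PiE_iff)
      then have "trans (w ((j - 1) + 1)) (w (j - 1)) = 0"
        by (auto simp: trans_def w_def)
      then have "(\<Prod>j\<in>{1..<n}. trans (w (j+1)) (w j)) = 0"
        using j(1) by (intro prod_zero) (auto intro!: bexI[of _ "j - 1"])
      then have "chain n z w = 0"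
        by (simp add: chain_def)
      then show ?thesis using False by (simp add: w_def)
    qed
  qed
qed

text \<open>
  Integrating over the last variable after all the others peels off the factor \<open>k z\<close>. What
  remains is the chain of length \<open>n\<close> in the unshifted variables, so that no reindexing is needed.
\<close>
lemma iter_Suc:
  assumes z: "z \<in> X" and \<zeta>1: "\<zeta>1 \<in> B" and n: "n \<ge> 1"
  shows "iter (Suc n) z \<zeta>1 = (LINT \<zeta>:B|\<mu>. k z \<zeta> * iter n (p \<zeta>) \<zeta>1)"
proof -
  let ?M = "\<Pi>\<^sub>M j\<in>{2..n}. \<mu>"
  let ?M' = "\<Pi>\<^sub>M j\<in>insert (Suc n) {2..n}. \<mu>"
  have \<zeta>s: "\<zeta>1 \<in> space \<mu>" using \<zeta>1 sets.sets_into_space[OF B] by auto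
  have ins: "{2..Suc n} = insert (Suc n) {2..n}" using n by auto
  have upd: "(\<xi>(Suc n := \<zeta>))(1 := \<zeta>1) = (\<xi>(1 := \<zeta>1))(Suc n := \<zeta>)" for \<xi> :: "nat \<Rightarrow> 'a" and \<zeta>
    using n by (auto simp: fun_eq_iff)
  interpret N: finite_measure ?M by (rule finite_measure_power)
  interpret N': finite_measure ?M' using finite_measure_power[of "Suc n"] by (simp add: ins)
  interpret P: pair_sigma_finite ?M \<mu> ..
  interpret PF: finite_measure "?M \<Otimes>\<^sub>M \<mu>"
    by (rule finite_measure_pair_measure) unfold_locales
  have m: "(\<lambda>\<xi>. chain (Suc n) z (\<xi>(1 := \<zeta>1))) \<in> borel_measurable ?M'"
    using chain_measurable[OF \<zeta>s z, of "Suc n"] by (simp add: ins)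
  have m2: "(\<lambda>(\<xi>, \<zeta>). chain (Suc n) z ((\<xi>(Suc n := \<zeta>))(1 := \<zeta>1))) \<in> borel_measurable (?M \<Otimes>\<^sub>M \<mu>)"
    using measurable_compose[OF measurable_add_dim m] by (simp add: case_prod_beta)
  have "iter (Suc n) z \<zeta>1 = (\<integral>\<xi>. chain (Suc n) z (\<xi>(1 := \<zeta>1)) \<partial>?M')"
    using iter_eq_chain[OF \<zeta>1, of "Suc n"] by (simp add: ins)
  also have "\<dots> = (\<integral>\<xi>. (\<integral>\<zeta>. chain (Suc n) z ((\<xi>(Suc n := \<zeta>))(1 := \<zeta>1)) \<partial>\<mu>) \<partial>?M)"
    by (intro product_integral_insert N'.integrable_const_bound[where B = "C * C ^ n"] m)
       (use abs_chain_le[OF z, of "Suc n"] in auto)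
  also have "\<dots> = (\<integral>\<zeta>. (\<integral>\<xi>. chain (Suc n) z ((\<xi>(Suc n := \<zeta>))(1 := \<zeta>1)) \<partial>?M) \<partial>\<mu>)"
    by (intro P.Fubini_integral[symmetric] PF.integrable_const_bound[where B = "C * C ^ n"] m2)
       (use abs_chain_le[OF z, of "Suc n"] in auto)
  also have "\<dots> = (LINT \<zeta>:B|\<mu>. k z \<zeta> * iter n (p \<zeta>) \<zeta>1)"
    unfolding set_lebesgue_integral_def
  proof (intro Bochner_Integration.integral_cong refl)
    fix \<zeta>
    show "(\<integral>\<xi>. chain (Suc n) z ((\<xi>(Suc n := \<zeta>))(1 := \<zeta>1)) \<partial>?M)
        = indicator B \<zeta> *\<^sub>R (k z \<zeta> * iter n (p \<zeta>) \<zeta>1)"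
    proof (cases "\<zeta> \<in> B")
      case True
      then show ?thesis
        unfolding upd chain_Suc[OF n True] by (simp add: iter_eq_chain[OF \<zeta>1 n] row_def)
    next
      case False
      then show ?thesis
        unfolding upd chain_Suc_outside[OF False] by simp
    qed
  qed
  finally show ?thesis .
qed

text \<open>Measurability in both variables comes from the recursion, one parameter integral at a time.\<close>
lemma iter_measurable2:
  assumes "n \<ge> 1"
  shows "(\<lambda>(\<xi>, \<zeta>). indicator B \<xi> * indicator B \<zeta> * iter n (p \<xi>) \<zeta>) \<in> borel_measurable (\<mu> \<Otimes>\<^sub>M \<mu>)"
  using assms
proof (induction n rule: dec_induct)
  case base
  then show ?case using k_measurable2 by (simp add: iter_def)
next
  case (step n)
  let ?T = "\<lambda>\<xi> \<zeta>. indicator B \<xi> * indicator B \<zeta> * iter n (p \<xi>) \<zeta>"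
  have [measurable]: "(\<lambda>x. ?T (snd x) (snd (fst x))) \<in> borel_measurable ((\<mu> \<Otimes>\<^sub>M \<mu>) \<Otimes>\<^sub>M \<mu>)"
    using measurable_compose[OF _ step.IH, of "\<lambda>x. (snd x, snd (fst x))" "(\<mu> \<Otimes>\<^sub>M \<mu>) \<Otimes>\<^sub>M \<mu>"]
    by (simp add: case_prod_beta)
  have "(\<lambda>x. \<integral>\<zeta>. trans (fst x) \<zeta> * ?T \<zeta> (snd x) \<partial>\<mu>) \<in> borel_measurable (\<mu> \<Otimes>\<^sub>M \<mu>)"
    by (intro borel_measurable_lebesgue_integral) (simp add: case_prod_beta)
  also have "(\<lambda>x. \<integral>\<zeta>. trans (fst x) \<zeta> * ?T \<zeta> (snd x) \<partial>\<mu>)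
      = (\<lambda>(\<xi>, \<zeta>). indicator B \<xi> * indicator B \<zeta> * iter (Suc n) (p \<xi>) \<zeta>)"
  proof (intro ext, clarify)
    fix \<xi> \<zeta>1
    show "(\<integral>\<zeta>. trans (fst (\<xi>, \<zeta>1)) \<zeta> * ?T \<zeta> (snd (\<xi>, \<zeta>1)) \<partial>\<mu>)
        = indicator B \<xi> * indicator B \<zeta>1 * iter (Suc n) (p \<xi>) \<zeta>1"
    proof (cases "\<xi> \<in> B \<and> \<zeta>1 \<in> B")
      case True
      then show ?thesis
        using step p by (auto simp: iter_Suc set_lebesgue_integral_def trans_def indicator_def
            intro!: Bochner_Integration.integral_cong)
    qed (auto simp: trans_def)
  qed
  finally show ?case .
qed

lemma iter_measurable:
  assumes z: "z \<in> X" and "n \<ge> 1"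
  shows "(\<lambda>\<zeta>. indicator B \<zeta> * iter n z \<zeta>) \<in> borel_measurable \<mu>"
  using assms(2)
proof (cases n rule: nat.exhaust)
  case (Suc m)
  show ?thesis
  proof (cases "m = 0")
    case True
    then show ?thesis using Suc k_measurable[OF z] by (simp add: iter_def)
  next
    case False
    then have m: "m \<ge> 1" by simp
    let ?T = "\<lambda>\<xi> \<zeta>. indicator B \<xi> * indicator B \<zeta> * iter m (p \<xi>) \<zeta>"
    have [measurable]: "(\<lambda>x. ?T (snd x) (fst x)) \<in> borel_measurable (\<mu> \<Otimes>\<^sub>M \<mu>)"
      using measurable_compose[OF _ iter_measurable2[OF m], of "\<lambda>x. (snd x, fst x)" "\<mu> \<Otimes>\<^sub>M \<mu>"]
      by (simp add: case_prod_beta)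
    have "(\<lambda>\<zeta>1. \<integral>\<zeta>. row z \<zeta> * ?T \<zeta> \<zeta>1 \<partial>\<mu>) \<in> borel_measurable \<mu>"
      using z by (intro borel_measurable_lebesgue_integral) (simp add: case_prod_beta)
    also have "(\<lambda>\<zeta>1. \<integral>\<zeta>. row z \<zeta> * ?T \<zeta> \<zeta>1 \<partial>\<mu>) = (\<lambda>\<zeta>. indicator B \<zeta> * iter n z \<zeta>)"
    proof
      fix \<zeta>1
      show "(\<integral>\<zeta>. row z \<zeta> * ?T \<zeta> \<zeta>1 \<partial>\<mu>) = indicator B \<zeta>1 * iter n z \<zeta>1"
        using Suc by (auto simp: iter_Suc[OF z _ m] set_lebesgue_integral_def row_def indicator_def
            intro!: Bochner_Integration.integral_cong)
    qed
    finally show ?thesis .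
  qed
qed simp

subsection \<open>The integral operator\<close>
definition bounded_data :: "('z \<Rightarrow> real) \<Rightarrow> bool" where
  "bounded_data g \<longleftrightarrow> (\<lambda>\<zeta>. indicator B \<zeta> * g (p \<zeta>)) \<in> borel_measurable \<mu> \<and> (\<exists>c. \<forall>z\<in>X. \<bar>g z\<bar> \<le> c)"

definition kernel_op :: "('z \<Rightarrow> real) \<Rightarrow> 'z \<Rightarrow> real" where
  "kernel_op g z = (LINT \<zeta>:B|\<mu>. k z \<zeta> * g (p \<zeta>))"

lemma kernel_op_eq: "kernel_op g z = (\<integral>\<zeta>. row z \<zeta> * (indicator B \<zeta> * g (p \<zeta>)) \<partial>\<mu>)"
  unfolding kernel_op_def set_lebesgue_integral_def row_def
  by (intro Bochner_Integration.integral_cong) (auto simp: indicator_def)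

lemma kernel_op_integrable:
  assumes z: "z \<in> X" and g: "bounded_data g"
  shows "integrable \<mu> (\<lambda>\<zeta>. row z \<zeta> * (indicator B \<zeta> * g (p \<zeta>)))"
proof -
  have [measurable]: "(\<lambda>\<zeta>. indicator B \<zeta> * g (p \<zeta>)) \<in> borel_measurable \<mu>"
    using g by (simp add: bounded_data_def)
  obtain c where c: "\<And>z. z \<in> X \<Longrightarrow> \<bar>g z\<bar> \<le> c" using g by (auto simp: bounded_data_def)
  show ?thesis
  proof (rule integrable_const_bound[where B = "C * \<bar>c\<bar>"])
    have "norm (row z \<zeta> * (indicator B \<zeta> * g (p \<zeta>))) \<le> C * \<bar>c\<bar>" for \<zeta>
      unfolding real_norm_def abs_mult using abs_row_le[OF z, of \<zeta>] C
      by (intro mult_mono) (use c[OF p, of \<zeta>] in \<open>auto simp: indicator_def\<close>)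
    then show "AE \<zeta> in \<mu>. norm (row z \<zeta> * (indicator B \<zeta> * g (p \<zeta>))) \<le> C * \<bar>c\<bar>" by simp
  qed (use z in measurable)
qed

lemma row_integrable: "z \<in> X \<Longrightarrow> integrable \<mu> (row z)"
  by (rule integrable_const_bound[where B = C]) (auto simp: abs_row_le)

lemma Q_nonneg: "z \<in> X \<Longrightarrow> 0 \<le> Q"
proof -
  assume z: "z \<in> X"
  have "0 \<le> (LINT \<zeta>:B|\<mu>. k z \<zeta>)"
    unfolding set_lebesgue_integral_def
    by (intro Bochner_Integration.integral_nonneg) (use k_nonneg[OF z] in \<open>auto simp: indicator_def\<close>)
  with k_integral_le[OF z] show "0 \<le> Q" by simp
qed

lemma abs_kernel_op_le:
  assumes z: "z \<in> X" and g: "bounded_data g" and c: "\<And>z. z \<in> X \<Longrightarrow> \<bar>g z\<bar> \<le> c"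
  shows "\<bar>kernel_op g z\<bar> \<le> Q * c"
proof -
  have c0: "0 \<le> c" using c[OF z] by (meson abs_ge_zero order_trans)
  have "\<bar>kernel_op g z\<bar> \<le> (\<integral>\<zeta>. \<bar>row z \<zeta> * (indicator B \<zeta> * g (p \<zeta>))\<bar> \<partial>\<mu>)"
    unfolding kernel_op_eq by (rule integral_abs_bound)
  also have "\<dots> \<le> (\<integral>\<zeta>. row z \<zeta> * c \<partial>\<mu>)"
  proof (rule integral_mono)
    fix \<zeta>
    show "\<bar>row z \<zeta> * (indicator B \<zeta> * g (p \<zeta>))\<bar> \<le> row z \<zeta> * c"
      using k_nonneg[OF z, of \<zeta>] c[OF p, of \<zeta>]
      by (auto simp: row_def indicator_def abs_mult intro!: mult_left_mono)
  qed (use kernel_op_integrable[OF z g] row_integrable[OF z] in auto)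
  also have "\<dots> = (LINT \<zeta>:B|\<mu>. k z \<zeta>) * c"
    by (simp add: set_lebesgue_integral_def row_def)
  also have "\<dots> \<le> Q * c"
    using k_integral_le[OF z] c0 by (rule mult_right_mono)
  finally show ?thesis .
qed

lemma bounded_data_kernel_op:
  assumes g: "bounded_data g" shows "bounded_data (kernel_op g)"
proof -
  have [measurable]: "(\<lambda>\<zeta>. indicator B \<zeta> * g (p \<zeta>)) \<in> borel_measurable \<mu>"
    using g by (simp add: bounded_data_def)
  obtain c where c: "\<And>z. z \<in> X \<Longrightarrow> \<bar>g z\<bar> \<le> c" using g by (auto simp: bounded_data_def)
  have "(\<lambda>\<xi>. \<integral>\<zeta>. trans \<xi> \<zeta> * (indicator B \<zeta> * g (p \<zeta>)) \<partial>\<mu>) \<in> borel_measurable \<mu>"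
    by (intro borel_measurable_lebesgue_integral) measurable
  also have "(\<lambda>\<xi>. \<integral>\<zeta>. trans \<xi> \<zeta> * (indicator B \<zeta> * g (p \<zeta>)) \<partial>\<mu>)
      = (\<lambda>\<xi>. indicator B \<xi> * kernel_op g (p \<xi>))"
    by (auto simp: kernel_op_eq trans_def row_def fun_eq_iff indicator_def)
  finally show ?thesis
    unfolding bounded_data_def using abs_kernel_op_le[OF _ g c] by blast
qed

lemma bounded_data_power: "bounded_data g \<Longrightarrow> bounded_data ((kernel_op ^^ n) g)"
  by (induction n) (auto simp: bounded_data_kernel_op)

lemma abs_kernel_op_power_le:
  assumes z: "z \<in> X" and g: "bounded_data g" and c: "\<And>z. z \<in> X \<Longrightarrow> \<bar>g z\<bar> \<le> c"
  shows "\<bar>(kernel_op ^^ n) g z\<bar> \<le> Q ^ n * c"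
  using z
proof (induction n arbitrary: z)
  case (Suc n)
  show ?case
    using abs_kernel_op_le[OF Suc.prems bounded_data_power[OF g, of n] Suc.IH] by (simp add: mult.assoc)
qed (use c in auto)

lemma kernel_op_cong:
  assumes "\<And>z. z \<in> X \<Longrightarrow> g z = g' z"
  shows "kernel_op g = kernel_op g'"
  unfolding kernel_op_eq[abs_def] using assms p
  by (intro ext Bochner_Integration.integral_cong) (auto simp: indicator_def)

lemma bounded_data_lincomb:
  assumes "bounded_data g" "bounded_data g'"
  shows "bounded_data (\<lambda>z. g z + a * g' z)"
proof -
  have [measurable]: "(\<lambda>\<zeta>. indicator B \<zeta> * g (p \<zeta>)) \<in> borel_measurable \<mu>"
      "(\<lambda>\<zeta>. indicator B \<zeta> * g' (p \<zeta>)) \<in> borel_measurable \<mu>"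
    using assms by (auto simp: bounded_data_def)
  obtain c c' where c: "\<forall>z\<in>X. \<bar>g z\<bar> \<le> c" "\<forall>z\<in>X. \<bar>g' z\<bar> \<le> c'"
    using assms by (auto simp: bounded_data_def)
  have "(\<lambda>\<zeta>. indicator B \<zeta> * g (p \<zeta>) + a * (indicator B \<zeta> * g' (p \<zeta>))) \<in> borel_measurable \<mu>"
    by measurable
  moreover have "\<bar>g z + a * g' z\<bar> \<le> c + \<bar>a\<bar> * c'" if "z \<in> X" for z
    using c that by (intro order_trans[OF abs_triangle_ineq] add_mono) (auto simp: abs_mult intro: mult_left_mono)
  ultimately show ?thesis
    by (auto simp: bounded_data_def algebra_simps)
qed

lemma kernel_op_lincomb:
  assumes "bounded_data g" "bounded_data g'" "z \<in> X"
  shows "kernel_op (\<lambda>z. g z + a * g' z) z = kernel_op g z + a * kernel_op g' z"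
proof -
  have "kernel_op (\<lambda>z. g z + a * g' z) z
      = (\<integral>\<zeta>. row z \<zeta> * (indicator B \<zeta> * g (p \<zeta>)) + a * (row z \<zeta> * (indicator B \<zeta> * g' (p \<zeta>))) \<partial>\<mu>)"
    unfolding kernel_op_eq by (intro Bochner_Integration.integral_cong) (auto simp: algebra_simps)
  also have "\<dots> = kernel_op g z + a * kernel_op g' z"
    using kernel_op_integrable[OF assms(3) assms(1)] kernel_op_integrable[OF assms(3) assms(2)]
    by (simp add: kernel_op_eq)
  finally show ?thesis .
qed

lemma kernel_op_power_lincomb:
  assumes g: "bounded_data g" "bounded_data g'" and z: "z \<in> X"
  shows "(kernel_op ^^ n) (\<lambda>z. g z + a * g' z) z = (kernel_op ^^ n) g z + a * (kernel_op ^^ n) g' z"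
  using z
proof (induction n arbitrary: z)
  case (Suc n)
  have "(kernel_op ^^ Suc n) (\<lambda>z. g z + a * g' z) z
      = kernel_op (\<lambda>z. (kernel_op ^^ n) g z + a * (kernel_op ^^ n) g' z) z"
    using kernel_op_cong[of "(kernel_op ^^ n) (\<lambda>z. g z + a * g' z)"
        "\<lambda>z. (kernel_op ^^ n) g z + a * (kernel_op ^^ n) g' z"] Suc.IH by simp
  then show ?case
    using kernel_op_lincomb[OF bounded_data_power[OF g(1)] bounded_data_power[OF g(2)] Suc.prems, of n a n]
    by simp
qed simp

lemma iter_bounds:
  assumes "n \<ge> 1" "z \<in> X" "\<zeta> \<in> B"
  shows "0 \<le> iter n z \<zeta> \<and> iter n z \<zeta> \<le> Q ^ (n - 1) * C"
  using assms
proof (induction n arbitrary: z rule: dec_induct)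
  case base
  then show ?case by (simp add: iter_def k_nonneg k_le)
next
  case (step n)
  have m: "(\<lambda>\<xi>. indicator B \<xi> * iter n (p \<xi>) \<zeta>) \<in> borel_measurable \<mu>"
  proof -
    have "\<zeta> \<in> space \<mu>" using step.prems sets.sets_into_space[OF B] by auto
    then have "(\<lambda>\<xi>. (\<xi>, \<zeta>)) \<in> measurable \<mu> (\<mu> \<Otimes>\<^sub>M \<mu>)" by simp
    from measurable_compose[OF this iter_measurable2[OF step.hyps(1)]] show ?thesis
      using step.prems by (simp cong: if_cong)
  qed
  have i: "integrable \<mu> (\<lambda>\<xi>. row z \<xi> * (indicator B \<xi> * iter n (p \<xi>) \<zeta>))"
  proof (rule integrable_const_bound[where B = "C * (Q ^ (n - 1) * C)"])
    have "norm (row z \<xi> * (indicator B \<xi> * iter n (p \<xi>) \<zeta>)) \<le> C * (Q ^ (n - 1) * C)" for \<xi>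
    proof -
      have "\<bar>indicator B \<xi> * iter n (p \<xi>) \<zeta>\<bar> \<le> Q ^ (n - 1) * C"
        using step.IH[OF p step.prems(2), of \<xi>] Q_nonneg[OF step.prems(1)] C by (auto simp: indicator_def)
      with abs_row_le[OF step.prems(1), of \<xi>] C show ?thesis
        unfolding real_norm_def abs_mult[of "row z \<xi>"] by (intro mult_mono) auto
    qed
    then show "AE \<xi> in \<mu>. norm (row z \<xi> * (indicator B \<xi> * iter n (p \<xi>) \<zeta>)) \<le> C * (Q ^ (n - 1) * C)"
      by simp
  qed (use m row_measurable[OF step.prems(1)] in measurable)
  have eq: "iter (Suc n) z \<zeta> = (\<integral>\<xi>. row z \<xi> * (indicator B \<xi> * iter n (p \<xi>) \<zeta>) \<partial>\<mu>)"
    unfolding iter_Suc[OF step.prems step.hyps(1)] set_lebesgue_integral_def row_def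
    by (intro Bochner_Integration.integral_cong) (auto simp: indicator_def)
  have "0 \<le> iter (Suc n) z \<zeta>"
    unfolding eq using step.IH[OF p step.prems(2)] k_nonneg[OF step.prems(1)]
    by (intro Bochner_Integration.integral_nonneg) (auto simp: row_def indicator_def)
  moreover have "iter (Suc n) z \<zeta> \<le> (\<integral>\<xi>. row z \<xi> * (Q ^ (n - 1) * C) \<partial>\<mu>)"
    unfolding eq
  proof (rule integral_mono[OF i])
    fix \<xi>
    show "row z \<xi> * (indicator B \<xi> * iter n (p \<xi>) \<zeta>) \<le> row z \<xi> * (Q ^ (n - 1) * C)"
      using step.IH[OF p step.prems(2)] k_nonneg[OF step.prems(1)]
      by (auto simp: row_def indicator_def intro!: mult_left_mono)
  qed (use row_integrable[OF step.prems(1)] in auto)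
  moreover have "(\<integral>\<xi>. row z \<xi> * (Q ^ (n - 1) * C) \<partial>\<mu>) = (LINT \<zeta>:B|\<mu>. k z \<zeta>) * (Q ^ (n - 1) * C)"
    by (simp add: set_lebesgue_integral_def row_def)
  moreover have "\<dots> \<le> Q * (Q ^ (n - 1) * C)"
    using k_integral_le[OF step.prems(1)] Q_nonneg[OF step.prems(1)] C by (intro mult_right_mono) auto
  moreover have "Q * (Q ^ (n - 1) * C) = Q ^ (Suc n - 1) * C"
    using step.hyps(1) by (cases n) auto
  ultimately show ?case by linarith
qed

text \<open>
  Fubini's theorem turns the recursion for kernels into composition of operators. The remaining
  analysis takes place in terms of powers of \<open>kernel_op\<close>.
\<close>
lemma iter_integral:
  assumes n: "n \<ge> 1" and z: "z \<in> X" and g: "bounded_data g"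
  shows "(LINT \<zeta>:B|\<mu>. iter n z \<zeta> * g (p \<zeta>)) = (kernel_op ^^ n) g z"
  using n z
proof (induction n arbitrary: z rule: dec_induct)
  case base
  then show ?case by (simp add: iter_def kernel_op_def)
next
  case (step n)
  note z = step.prems
  have [measurable]: "(\<lambda>\<zeta>. indicator B \<zeta> * g (p \<zeta>)) \<in> borel_measurable \<mu>"
    using g by (simp add: bounded_data_def)
  obtain c where c: "\<And>z. z \<in> X \<Longrightarrow> \<bar>g z\<bar> \<le> c" using g by (auto simp: bounded_data_def)
  define T where "T \<xi> \<zeta> = indicator B \<xi> * indicator B \<zeta> * iter n (p \<xi>) \<zeta>" for \<xi> \<zeta>
  let ?g = "\<lambda>\<zeta>. indicator B \<zeta> * g (p \<zeta>)"
  have [measurable]: "(\<lambda>x. T (snd x) (fst x)) \<in> borel_measurable (\<mu> \<Otimes>\<^sub>M \<mu>)"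
    using measurable_compose[OF _ iter_measurable2[OF step.hyps(1)], of "\<lambda>x. (snd x, fst x)" "\<mu> \<Otimes>\<^sub>M \<mu>"]
    by (simp add: case_prod_beta T_def)
  have T: "\<bar>T \<xi> \<zeta>\<bar> \<le> Q ^ (n - 1) * C" for \<xi> \<zeta>
    using iter_bounds[OF step.hyps(1) p, of \<xi> \<zeta>] Q_nonneg[OF z] C by (auto simp: T_def indicator_def)
  interpret P: pair_sigma_finite \<mu> \<mu> ..
  interpret PF: finite_measure "\<mu> \<Otimes>\<^sub>M \<mu>"
    by (rule finite_measure_pair_measure) unfold_locales
  have "(LINT \<zeta>:B|\<mu>. iter (Suc n) z \<zeta> * g (p \<zeta>)) = (\<integral>\<zeta>. (\<integral>\<xi>. row z \<xi> * T \<xi> \<zeta> * ?g \<zeta> \<partial>\<mu>) \<partial>\<mu>)"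
    unfolding set_lebesgue_integral_def
  proof (intro Bochner_Integration.integral_cong refl)
    fix \<zeta>
    show "indicator B \<zeta> *\<^sub>R (iter (Suc n) z \<zeta> * g (p \<zeta>)) = (\<integral>\<xi>. row z \<xi> * T \<xi> \<zeta> * ?g \<zeta> \<partial>\<mu>)"
    proof (cases "\<zeta> \<in> B")
      case True
      have "iter (Suc n) z \<zeta> = (\<integral>\<xi>. row z \<xi> * T \<xi> \<zeta> \<partial>\<mu>)"
        unfolding iter_Suc[OF z True step.hyps(1)] set_lebesgue_integral_def row_def T_def
        using True by (intro Bochner_Integration.integral_cong) (auto simp: indicator_def)
      then show ?thesis using True by simp
    qed simp
  qed
  also have "\<dots> = (\<integral>\<xi>. (\<integral>\<zeta>. row z \<xi> * T \<xi> \<zeta> * ?g \<zeta> \<partial>\<mu>) \<partial>\<mu>)"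
  proof (rule P.Fubini_integral[symmetric])
    show "integrable (\<mu> \<Otimes>\<^sub>M \<mu>) (\<lambda>(\<zeta>, \<xi>). row z \<xi> * T \<xi> \<zeta> * ?g \<zeta>)"
    proof (rule PF.integrable_const_bound[where B = "C * (Q ^ (n - 1) * C) * \<bar>c\<bar>"])
      have "norm (row z \<xi> * T \<xi> \<zeta> * ?g \<zeta>) \<le> C * (Q ^ (n - 1) * C) * \<bar>c\<bar>" for \<xi> \<zeta>
        unfolding real_norm_def abs_mult using abs_row_le[OF z, of \<xi>] C T[of \<xi> \<zeta>] Q_nonneg[OF z]
        by (intro mult_mono) (use c[OF p, of \<zeta>] in \<open>auto simp: indicator_def\<close>)
      then show "AE x in \<mu> \<Otimes>\<^sub>M \<mu>. norm (case x of (\<zeta>, \<xi>) \<Rightarrow> row z \<xi> * T \<xi> \<zeta> * ?g \<zeta>) \<le> C * (Q ^ (n - 1) * C) * \<bar>c\<bar>"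
        by (auto simp: case_prod_beta)
      show "(\<lambda>(\<zeta>, \<xi>). row z \<xi> * T \<xi> \<zeta> * ?g \<zeta>) \<in> borel_measurable (\<mu> \<Otimes>\<^sub>M \<mu>)"
        using z by (simp add: case_prod_beta)
    qed
  qed
  also have "\<dots> = kernel_op ((kernel_op ^^ n) g) z"
    unfolding kernel_op_eq[of _ z]
  proof (intro Bochner_Integration.integral_cong refl)
    fix \<xi>
    show "(\<integral>\<zeta>. row z \<xi> * T \<xi> \<zeta> * ?g \<zeta> \<partial>\<mu>) = row z \<xi> * (indicator B \<xi> * (kernel_op ^^ n) g (p \<xi>))"
    proof (cases "\<xi> \<in> B")
      case True
      have "(\<integral>\<zeta>. T \<xi> \<zeta> * ?g \<zeta> \<partial>\<mu>) = (LINT \<zeta>:B|\<mu>. iter n (p \<xi>) \<zeta> * g (p \<zeta>))"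
        unfolding set_lebesgue_integral_def T_def
        using True by (intro Bochner_Integration.integral_cong) (auto simp: indicator_def)
      then show ?thesis using True step.IH[OF p[OF True]] by (simp add: mult.assoc)
    qed (simp add: row_def)
  qed
  finally show ?case by simp
qed

subsection \<open>The Neumann series\<close>

context
  fixes u h :: "'z \<Rightarrow> real" and a c :: real
  assumes u: "bounded_data u" and c: "\<And>z. z \<in> X \<Longrightarrow> \<bar>u z\<bar> \<le> c" and a: "a > 0"
    and fixpoint: "\<And>z. z \<in> X \<Longrightarrow> u z = h z + 1 / a * (LINT \<zeta>:B|\<mu>. k z \<zeta> * u (p \<zeta>))"
begin

text \<open>The equation itself shows that \<open>h\<close> is as regular as \<open>u\<close>.\<close>
lemma bounded_data_h: "bounded_data h"
proof -
  have h: "h z = u z + (- 1 / a) * kernel_op u z" if "z \<in> X" for z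
    using fixpoint[OF that] by (simp add: kernel_op_def)
  have "bounded_data (\<lambda>z. u z + (- 1 / a) * kernel_op u z)"
    by (intro bounded_data_lincomb u bounded_data_kernel_op)
  moreover have "(\<lambda>\<zeta>. indicator B \<zeta> * h (p \<zeta>)) = (\<lambda>\<zeta>. indicator B \<zeta> * (u (p \<zeta>) + (- 1 / a) * kernel_op u (p \<zeta>)))"
    using h p by (auto simp: indicator_def)
  ultimately show ?thesis
    unfolding bounded_data_def using h by simp
qed

text \<open>The equation for \<open>u\<close>, substituted into its own remainder term.\<close>
lemma neumann_expansion:
  assumes z: "z \<in> X"
  shows "u z = (\<Sum>j\<le>t. 1 / a ^ j * (kernel_op ^^ j) h z) + 1 / a ^ Suc t * (kernel_op ^^ Suc t) u z"
proof (induction t)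
  case 0
  then show ?case using fixpoint[OF z] by (simp add: kernel_op_def)
next
  case (Suc t)
  have "(kernel_op ^^ Suc t) u z = (kernel_op ^^ Suc t) (\<lambda>z. h z + 1 / a * kernel_op u z) z"
  proof -
    have "kernel_op u = kernel_op (\<lambda>z. h z + 1 / a * kernel_op u z)"
      by (rule kernel_op_cong) (use fixpoint in \<open>simp add: kernel_op_def\<close>)
    then show ?thesis
      unfolding funpow_Suc_right o_apply by (rule arg_cong)
  qed
  also have "\<dots> = (kernel_op ^^ Suc t) h z + 1 / a * (kernel_op ^^ Suc t) (kernel_op u) z"
    by (rule kernel_op_power_lincomb[OF bounded_data_h bounded_data_kernel_op[OF u] z])
  also have "(kernel_op ^^ Suc t) (kernel_op u) = (kernel_op ^^ Suc (Suc t)) u"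
    by (metis funpow_Suc_right comp_apply)
  finally have "1 / a ^ Suc t * (kernel_op ^^ Suc t) u z
     = 1 / a ^ Suc t * (kernel_op ^^ Suc t) h z + 1 / a ^ Suc (Suc t) * (kernel_op ^^ Suc (Suc t)) u z"
    using a by (simp add: field_simps)
  with Suc show ?case by simp
qed

lemma partial_sum_eq:
  assumes z: "z \<in> X"
  shows "h z + (\<Sum>j=1..t. 1 / a ^ j * (LINT \<zeta>:B|\<mu>. iter j z \<zeta> * h (p \<zeta>)))
    = u z - 1 / a ^ Suc t * (kernel_op ^^ Suc t) u z"
proof -
  have "(\<Sum>j=1..t. 1 / a ^ j * (LINT \<zeta>:B|\<mu>. iter j z \<zeta> * h (p \<zeta>))) = (\<Sum>j=1..t. 1 / a ^ j * (kernel_op ^^ j) h z)"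
    by (intro sum.cong refl) (simp add: iter_integral[OF _ z bounded_data_h])
  moreover have "(\<Sum>j\<le>t. 1 / a ^ j * (kernel_op ^^ j) h z) = h z + (\<Sum>j=1..t. 1 / a ^ j * (kernel_op ^^ j) h z)"
    unfolding atMost_atLeast0 by (subst sum.atLeast_Suc_atMost) auto
  ultimately show ?thesis using neumann_expansion[OF z, of t] by simp
qed

theorem partial_sum_error:
  assumes z: "z \<in> X"
  shows "\<bar>h z + (\<Sum>j=1..t. 1 / a ^ j * (LINT \<zeta>:B|\<mu>. iter j z \<zeta> * h (p \<zeta>))) - u z\<bar> \<le> (Q / a) ^ Suc t * c"
proof -
  have "\<bar>1 / a ^ Suc t * (kernel_op ^^ Suc t) u z\<bar> \<le> 1 / a ^ Suc t * (Q ^ Suc t * c)"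
    unfolding abs_mult using abs_kernel_op_power_le[OF z u c, of "Suc t"] a by (intro mult_mono) auto
  then show ?thesis
    unfolding partial_sum_eq[OF z] by (simp add: power_divide)
qed

theorem series_representation:
  assumes z: "z \<in> X" and Q: "Q < a"
  shows "u z = h z + (LINT \<zeta>:B|\<mu>. (\<Sum>n. 1 / a ^ Suc n * iter (Suc n) z \<zeta>) * h (p \<zeta>))"
proof -
  note Q0 = Q_nonneg[OF z]
  define q where "q = Q / a"
  have q: "0 \<le> q" "q < 1" using Q Q0 a by (auto simp: q_def)
  obtain d where d: "\<And>z. z \<in> X \<Longrightarrow> \<bar>h z\<bar> \<le> d" using bounded_data_h by (auto simp: bounded_data_def)
  have d0: "0 \<le> d" using d[OF z] by (meson abs_ge_zero order_trans)
  have [measurable]: "(\<lambda>\<zeta>. indicator B \<zeta> * h (p \<zeta>)) \<in> borel_measurable \<mu>"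
    using bounded_data_h by (simp add: bounded_data_def)
  have it: "\<bar>1 / a ^ Suc n * iter (Suc n) z \<zeta>\<bar> \<le> C / a * q ^ n" if "\<zeta> \<in> B" for n \<zeta>
  proof -
    have "1 / a ^ Suc n * \<bar>iter (Suc n) z \<zeta>\<bar> \<le> 1 / a ^ Suc n * (Q ^ n * C)"
      using iter_bounds[OF _ z that, of "Suc n"] a by (intro mult_left_mono) auto
    also have "\<dots> = C / a * q ^ n" by (simp add: q_def power_divide)
    finally show ?thesis using a by (simp add: abs_mult)
  qed
  define F where "F n \<zeta> = 1 / a ^ Suc n * (indicator B \<zeta> * iter (Suc n) z \<zeta>) * (indicator B \<zeta> * h (p \<zeta>))" for n \<zeta>
  have [measurable]: "F n \<in> borel_measurable \<mu>" for n
  proof -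
    have [measurable]: "(\<lambda>\<zeta>. indicator B \<zeta> * iter (Suc n) z \<zeta>) \<in> borel_measurable \<mu>"
      by (rule iter_measurable[OF z]) simp
    show ?thesis unfolding F_def by measurable
  qed
  have Fb: "norm (F n \<zeta>) \<le> C / a * d * q ^ n" for n \<zeta>
  proof (cases "\<zeta> \<in> B")
    case True
    then have "norm (F n \<zeta>) = \<bar>1 / a ^ Suc n * iter (Suc n) z \<zeta>\<bar> * \<bar>h (p \<zeta>)\<bar>"
      by (simp add: F_def abs_mult)
    also have "\<dots> \<le> (C / a * q ^ n) * d"
      using it[OF True, of n] d[OF p[OF True]] q C a by (intro mult_mono) auto
    finally show ?thesis by (simp add: mult_ac)
  qed (use q C a d0 in \<open>simp add: F_def\<close>)
  have Fi: "integrable \<mu> (F n)" for n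
    by (rule integrable_const_bound[where B = "C / a * d * q ^ n"]) (use Fb in auto)
  have geo: "summable (\<lambda>n. K * q ^ n)" for K :: real
    using q by (intro summable_mult summable_geometric) auto
  have "(LINT \<zeta>:B|\<mu>. (\<Sum>n. 1 / a ^ Suc n * iter (Suc n) z \<zeta>) * h (p \<zeta>)) = (\<integral>\<zeta>. (\<Sum>n. F n \<zeta>) \<partial>\<mu>)"
    unfolding set_lebesgue_integral_def
  proof (intro Bochner_Integration.integral_cong refl)
    fix \<zeta>
    show "indicator B \<zeta> *\<^sub>R ((\<Sum>n. 1 / a ^ Suc n * iter (Suc n) z \<zeta>) * h (p \<zeta>)) = (\<Sum>n. F n \<zeta>)"
    proof (cases "\<zeta> \<in> B")
      case True
      have "summable (\<lambda>n. 1 / a ^ Suc n * iter (Suc n) z \<zeta>)"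
        by (rule summable_comparison_test'[OF geo[of "C / a"], of 0]) (use it[OF True] in auto)
      from suminf_mult2[OF this, of "h (p \<zeta>)"] show ?thesis
        using True by (simp add: F_def)
    qed (simp add: F_def)
  qed
  also have "\<dots> = (\<Sum>n. integral\<^sup>L \<mu> (F n))"
  proof (rule integral_suminf[OF Fi])
    show "AE \<zeta> in \<mu>. summable (\<lambda>n. norm (F n \<zeta>))"
      by (intro AE_I2 summable_comparison_test'[OF geo[of "C / a * d"], of 0]) (use Fb in auto)
    have "norm (\<integral>\<zeta>. norm (F n \<zeta>) \<partial>\<mu>) \<le> C / a * d * measure \<mu> (space \<mu>) * q ^ n" for n
    proof -
      have "(\<integral>\<zeta>. norm (F n \<zeta>) \<partial>\<mu>) \<le> (\<integral>\<zeta>. C / a * d * q ^ n \<partial>\<mu>)"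
        by (rule integral_mono) (use Fi Fb in auto)
      then show ?thesis by (simp add: mult_ac)
    qed
    then show "summable (\<lambda>n. \<integral>\<zeta>. norm (F n \<zeta>) \<partial>\<mu>)"
      by (intro summable_comparison_test'[OF geo[of "C / a * d * measure \<mu> (space \<mu>)"], of 0]) auto
  qed
  also have "(\<lambda>n. integral\<^sup>L \<mu> (F n)) = (\<lambda>n. 1 / a ^ Suc n * (LINT \<zeta>:B|\<mu>. iter (Suc n) z \<zeta> * h (p \<zeta>)))"
  proof
    fix n
    have "integral\<^sup>L \<mu> (F n) = (\<integral>\<zeta>. 1 / a ^ Suc n * (indicator B \<zeta> *\<^sub>R (iter (Suc n) z \<zeta> * h (p \<zeta>))) \<partial>\<mu>)"
      by (intro Bochner_Integration.integral_cong) (auto simp: F_def indicator_def)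
    then show "integral\<^sup>L \<mu> (F n) = 1 / a ^ Suc n * (LINT \<zeta>:B|\<mu>. iter (Suc n) z \<zeta> * h (p \<zeta>))"
      by (simp add: set_lebesgue_integral_def)
  qed
  also have "(\<Sum>n. 1 / a ^ Suc n * (LINT \<zeta>:B|\<mu>. iter (Suc n) z \<zeta> * h (p \<zeta>))) = u z - h z"
  proof (rule sums_unique[symmetric])
    have "(\<lambda>t. (Q / a) ^ Suc t * c) \<longlonglongrightarrow> 0"
      using q by (intro tendsto_mult_left_zero LIMSEQ_Suc LIMSEQ_realpow_zero) (auto simp: q_def)
    then have "(\<lambda>t. (h z + (\<Sum>j=1..t. 1 / a ^ j * (LINT \<zeta>:B|\<mu>. iter j z \<zeta> * h (p \<zeta>)))) - u z) \<longlonglongrightarrow> 0"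
      by (rule Lim_null_comparison[rotated]) (use partial_sum_error[OF z] in \<open>auto intro!: always_eventually\<close>)
    then have "(\<lambda>t. (\<Sum>j=1..t. 1 / a ^ j * (LINT \<zeta>:B|\<mu>. iter j z \<zeta> * h (p \<zeta>)))) \<longlonglongrightarrow> u z - h z"
      by (simp add: tendsto_iff dist_real_def algebra_simps)
    moreover have "(\<Sum>j=1..t. 1 / a ^ j * (LINT \<zeta>:B|\<mu>. iter j z \<zeta> * h (p \<zeta>)))
        = (\<Sum>n<t. 1 / a ^ Suc n * (LINT \<zeta>:B|\<mu>. iter (Suc n) z \<zeta> * h (p \<zeta>)))" for t
      unfolding One_nat_def by (rule sum.atLeast1_atMost_eq)
    ultimately show "(\<lambda>n. 1 / a ^ Suc n * (LINT \<zeta>:B|\<mu>. iter (Suc n) z \<zeta> * h (p \<zeta>))) sums (u z - h z)"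
      unfolding sums_def by simp
  qed
  finally show ?thesis by simp
qed

end

end

section \<open>Harmonic functions pulled back to the disk\<close>
lemma second_difference_mean_value:
  fixes u :: "complex \<Rightarrow> real"
  assumes h: "h > 0"
    and V: "\<And>s t. s \<in> {0..h} \<Longrightarrow> t \<in> {0..h} \<Longrightarrow> z + of_real s * e1 + of_real t * e2 \<in> V"
    and d1: "\<And>w. w \<in> V \<Longrightarrow> ((\<lambda>r. u (w + of_real r * e1)) has_real_derivative u1 w) (at 0)"
    and d2: "\<And>w. w \<in> V \<Longrightarrow> ((\<lambda>r. u1 (w + of_real r * e2)) has_real_derivative u12 w) (at 0)"
  shows "\<exists>s\<in>{0..h}. \<exists>t\<in>{0..h}.
    u (z + of_real h * e1 + of_real h * e2) - u (z + of_real h * e1) - u (z + of_real h * e2) + u z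
      = h * h * u12 (z + of_real s * e1 + of_real t * e2)"
proof -
  have D1: "((\<lambda>r. u (z + of_real r * e1 + of_real t * e2)) has_real_derivative
      u1 (z + of_real s * e1 + of_real t * e2)) (at s)"
    if "s \<in> {0..h}" "t \<in> {0..h}" for s t
    using d1[OF V[OF that]] DERIV_shift[of "\<lambda>r. u (z + of_real r * e1 + of_real t * e2)" "u1 (z + of_real s * e1 + of_real t * e2)" 0 s]
    by (simp add: algebra_simps)
  have D2: "((\<lambda>r. u1 (z + of_real s * e1 + of_real r * e2)) has_real_derivative
      u12 (z + of_real s * e1 + of_real t * e2)) (at t)"
    if "s \<in> {0..h}" "t \<in> {0..h}" for s t
    using d2[OF V[OF that]] DERIV_shift[of "\<lambda>r. u1 (z + of_real s * e1 + of_real r * e2)" "u12 (z + of_real s * e1 + of_real t * e2)" 0 t]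
    by (simp add: algebra_simps)
  define f where "f r = u (z + of_real r * e1 + of_real h * e2) - u (z + of_real r * e1 + of_real 0 * e2)" for r
  have "(f has_real_derivative
      u1 (z + of_real s * e1 + of_real h * e2) - u1 (z + of_real s * e1 + of_real 0 * e2)) (at s)"
    if "0 \<le> s" "s \<le> h" for s
    unfolding f_def by (intro DERIV_diff D1) (use that h in auto)
  from MVT2[OF h this] obtain s where s: "0 < s" "s < h"
    and fs: "f h - f 0 = (h - 0) * (u1 (z + of_real s * e1 + of_real h * e2) - u1 (z + of_real s * e1 + of_real 0 * e2))"
    by blast
  have "((\<lambda>r. u1 (z + of_real s * e1 + of_real r * e2)) has_real_derivative
      u12 (z + of_real s * e1 + of_real t * e2)) (at t)" if "0 \<le> t" "t \<le> h" for t
    by (rule D2) (use that s in auto)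
  from MVT2[OF h this] obtain t where t: "0 < t" "t < h"
    and ft: "u1 (z + of_real s * e1 + of_real h * e2) - u1 (z + of_real s * e1 + of_real 0 * e2)
      = (h - 0) * u12 (z + of_real s * e1 + of_real t * e2)"
    by blast
  show ?thesis
    using s t fs unfolding ft by (intro bexI[of _ s] bexI[of _ t]) (auto simp: f_def)
qed

text \<open>
  Clairaut's theorem. The second difference of \<open>u\<close> over a square of side \<open>h\<close> does not depend on the
  order of the two directions, and divided by \<open>h\<^sup>2\<close> it is a value of either mixed derivative
  inside the square.
\<close>
lemma mixed_partials_eq:
  fixes u :: "complex \<Rightarrow> real"
  assumes V: "open V" "z \<in> V"
    and u: "\<And>w. w \<in> V \<Longrightarrow> (u has_derivative (\<lambda>k. ux w * Re k + uy w * Im k)) (at w)"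
    and ux: "\<And>w. w \<in> V \<Longrightarrow> (ux has_derivative (\<lambda>k. uxx w * Re k + uxy w * Im k)) (at w)"
    and uy: "\<And>w. w \<in> V \<Longrightarrow> (uy has_derivative (\<lambda>k. uyx w * Re k + uyy w * Im k)) (at w)"
    and c: "continuous_on V uxy" "continuous_on V uyx"
  shows "uxy z = uyx z"
proof (rule ccontr)
  assume ne: "uxy z \<noteq> uyx z"
  define \<epsilon> where "\<epsilon> = \<bar>uxy z - uyx z\<bar> / 2"
  have \<epsilon>: "\<epsilon> > 0" using ne by (simp add: \<epsilon>_def)
  have "isCont uxy z" "isCont uyx z" using c V by (auto simp: continuous_on_eq_continuous_at)
  then have ev: "\<forall>\<^sub>F w in nhds z. dist (uxy w) (uxy z) < \<epsilon>" "\<forall>\<^sub>F w in nhds z. dist (uyx w) (uyx z) < \<epsilon>"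
    unfolding isCont_def tendsto_at_iff_tendsto_nhds using \<epsilon> by (auto dest: tendstoD)
  have "\<forall>\<^sub>F w in nhds z. w \<in> V \<and> dist (uxy w) (uxy z) < \<epsilon> \<and> dist (uyx w) (uyx z) < \<epsilon>"
    using ev V by (intro eventually_conj eventually_nhds_in_open)
  then obtain \<delta> where \<delta>: "\<delta> > 0"
    and near: "\<And>w. dist w z < \<delta> \<Longrightarrow> w \<in> V \<and> dist (uxy w) (uxy z) < \<epsilon> \<and> dist (uyx w) (uyx z) < \<epsilon>"
    unfolding eventually_nhds_metric by blast
  define h where "h = \<delta> / 3"
  have h: "h > 0" using \<delta> by (simp add: h_def)
  have close: "dist (z + of_real s * e1 + of_real t * e2) z < \<delta>"
    if "s \<in> {0..h}" "t \<in> {0..h}" "cmod e1 = 1" "cmod e2 = 1" for s t e1 e2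
  proof -
    have "dist (z + of_real s * e1 + of_real t * e2) z = cmod (of_real s * e1 + of_real t * e2)"
      by (simp add: dist_norm algebra_simps)
    also have "\<dots> \<le> s + t"
      using norm_triangle_ineq[of "of_real s * e1" "of_real t * e2"] that by (simp add: norm_mult)
    also have "\<dots> < \<delta>" using that h by (auto simp: h_def)
    finally show ?thesis .
  qed
  have dir: "((\<lambda>r. v (w + of_real r * e)) has_real_derivative (a * Re e + b * Im e)) (at 0)"
    if "(v has_derivative (\<lambda>k. a * Re k + b * Im k)) (at w)" for v :: "complex \<Rightarrow> real" and w e a b
  proof -
    have "((\<lambda>r. w + of_real r * e) has_derivative (\<lambda>r. of_real r * e)) (at 0)"
      by (auto intro!: derivative_eq_intros)
    from has_derivative_compose[OF this, of v "\<lambda>k. a * Re k + b * Im k"] that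
    have "((\<lambda>r. v (w + of_real r * e)) has_derivative (\<lambda>r. a * Re (of_real r * e) + b * Im (of_real r * e))) (at 0)"
      by simp
    moreover have "(\<lambda>r. a * Re (of_real r * e) + b * Im (of_real r * e)) = (*) (a * Re e + b * Im e)"
      by (auto simp: algebra_simps)
    ultimately show ?thesis
      by (simp add: has_field_derivative_def)
  qed
  have "\<exists>s\<in>{0..h}. \<exists>t\<in>{0..h}. u (z + of_real h * 1 + of_real h * \<i>) - u (z + of_real h * 1) - u (z + of_real h * \<i>) + u z
      = h * h * uxy (z + of_real s * 1 + of_real t * \<i>)"
    using dir[OF u, of _ 1] dir[OF ux, of _ \<i>] close[of _ _ 1 \<i>] near
    by (intro second_difference_mean_value[OF h, of z 1 \<i> V u ux]) auto
  then obtain s t where 1: "s \<in> {0..h}" "t \<in> {0..h}"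
     "u (z + of_real h * 1 + of_real h * \<i>) - u (z + of_real h * 1) - u (z + of_real h * \<i>) + u z
      = h * h * uxy (z + of_real s * 1 + of_real t * \<i>)" by blast
  have "\<exists>s\<in>{0..h}. \<exists>t\<in>{0..h}. u (z + of_real h * \<i> + of_real h * 1) - u (z + of_real h * \<i>) - u (z + of_real h * 1) + u z
      = h * h * uyx (z + of_real s * \<i> + of_real t * 1)"
    using dir[OF u, of _ \<i>] dir[OF uy, of _ 1] close[of _ _ \<i> 1] near
    by (intro second_difference_mean_value[OF h, of z \<i> 1 V u uy]) auto
  then obtain s' t' where 2: "s' \<in> {0..h}" "t' \<in> {0..h}"
     "u (z + of_real h * \<i> + of_real h * 1) - u (z + of_real h * \<i>) - u (z + of_real h * 1) + u z
      = h * h * uyx (z + of_real s' * \<i> + of_real t' * 1)" by blast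
  have "h * h * uxy (z + of_real s * 1 + of_real t * \<i>) = h * h * uyx (z + of_real s' * \<i> + of_real t' * 1)"
    using 1(3) 2(3) by (simp add: algebra_simps)
  then have "uxy (z + of_real s * 1 + of_real t * \<i>) = uyx (z + of_real s' * \<i> + of_real t' * 1)"
    using h by simp
  moreover have "dist (uxy (z + of_real s * 1 + of_real t * \<i>)) (uxy z) < \<epsilon>"
    using near[OF close[OF 1(1,2)], of 1 \<i>] by simp
  moreover have "dist (uyx (z + of_real s' * \<i> + of_real t' * 1)) (uyx z) < \<epsilon>"
    using near[OF close[OF 2(1,2)], of \<i> 1] by simp
  moreover have "\<bar>uxy z - uyx z\<bar> \<le> \<bar>x - uxy z\<bar> + \<bar>x - uyx z\<bar>" for x by linarith
  ultimately show False
    unfolding \<epsilon>_def dist_real_def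
    by (metis add_strict_mono field_sum_of_halves not_le)
qed

text \<open>
  By Clairaut's theorem and the vanishing of the Laplacian, \<open>G = u\<^sub>x - \<i> u\<^sub>y\<close> satisfies the
  Cauchy-Riemann equations, and \<open>u \<circ> \<phi>\<close> is, up to a constant, the real part of a primitive of
  \<open>(G \<circ> \<phi>) * \<phi>'\<close> on the disk.
\<close>
lemma harmonic_compose_is_real_part:
  assumes u: "harmonic_on u V" and V: "open V"
    and \<phi>: "\<phi> holomorphic_on ball 0 1" "\<phi> ` ball 0 1 \<subseteq> V"
  shows "\<exists>F. F holomorphic_on ball 0 1 \<and> (\<forall>w\<in>ball 0 1. u (\<phi> w) = Re (F w))"
proof -
  obtain ux uy uxx uxy uyx uyy where
    ud: "\<And>z. z \<in> V \<Longrightarrow> (u has_derivative (\<lambda>w. ux z * Re w + uy z * Im w)) (at z)" and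
    uxd: "\<And>z. z \<in> V \<Longrightarrow> (ux has_derivative (\<lambda>w. uxx z * Re w + uxy z * Im w)) (at z)" and
    uyd: "\<And>z. z \<in> V \<Longrightarrow> (uy has_derivative (\<lambda>w. uyx z * Re w + uyy z * Im w)) (at z)" and
    lap: "\<And>z. z \<in> V \<Longrightarrow> uxx z + uyy z = 0" and
    c: "continuous_on V uxy" "continuous_on V uyx"
    using u unfolding harmonic_on_def by blast
  define G where "G z = complex_of_real (ux z) - \<i> * of_real (uy z)" for z
  have "(G has_field_derivative (of_real (uxx z) - \<i> * of_real (uxy z))) (at z)" if z: "z \<in> V" for z
  proof -
    have eq: "uxy z = uyx z"
      by (rule mixed_partials_eq[OF V z ud uxd uyd c])
    have eq2: "uyy z = - uxx z" using lap[OF z] by simp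
    have "(G has_derivative (\<lambda>w. of_real (uxx z * Re w + uxy z * Im w) - \<i> * of_real (uyx z * Re w + uyy z * Im w))) (at z)"
      unfolding G_def using uxd[OF z] uyd[OF z]
      by (intro has_derivative_diff has_derivative_mult_right has_derivative_of_real)
    also have "(\<lambda>w. complex_of_real (uxx z * Re w + uxy z * Im w) - \<i> * of_real (uyx z * Re w + uyy z * Im w))
        = (\<lambda>w. (of_real (uxx z) - \<i> * of_real (uxy z)) * w)"
      by (auto simp: complex_eq_iff eq2 eq[symmetric] algebra_simps)
    finally show ?thesis by (simp add: has_field_derivative_def)
  qed
  then have G: "G holomorphic_on V"
    by (auto simp: holomorphic_on_def field_differentiable_def intro: has_field_derivative_at_within)
  have "(\<lambda>w. G (\<phi> w) * deriv \<phi> w) holomorphic_on ball 0 1"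
    using holomorphic_on_compose_gen[OF \<phi>(1) G \<phi>(2)]
    by (intro holomorphic_intros \<phi>(1)) (auto simp: o_def)
  then obtain F0 where F0: "\<And>w. w \<in> ball 0 1 \<Longrightarrow> (F0 has_field_derivative (G (\<phi> w) * deriv \<phi> w)) (at w within ball 0 1)"
    using holomorphic_convex_primitive'[of "ball 0 1" "\<lambda>w. G (\<phi> w) * deriv \<phi> w"] by auto
  have D: "((\<lambda>w. u (\<phi> w) - Re (F0 w)) has_derivative (\<lambda>_. 0)) (at w within ball 0 1)" if w: "w \<in> ball 0 1" for w
  proof -
    have "(\<phi> has_field_derivative deriv \<phi> w) (at w)"
      using \<phi>(1) w by (simp add: holomorphic_derivI)
    then have "(\<phi> has_derivative (\<lambda>k. deriv \<phi> w * k)) (at w within ball 0 1)"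
      by (simp add: has_field_derivative_def has_derivative_at_withinI)
    moreover have "\<phi> w \<in> V" using \<phi>(2) w by auto
    ultimately have "((\<lambda>w. u (\<phi> w)) has_derivative
        (\<lambda>k. ux (\<phi> w) * Re (deriv \<phi> w * k) + uy (\<phi> w) * Im (deriv \<phi> w * k))) (at w within ball 0 1)"
      using has_derivative_compose[OF _ ud] by blast
    moreover have "((\<lambda>w. Re (F0 w)) has_derivative (\<lambda>k. Re ((G (\<phi> w) * deriv \<phi> w) * k))) (at w within ball 0 1)"
      using F0[OF w] unfolding has_field_derivative_def
      by (rule bounded_linear.has_derivative[OF bounded_linear_Re])
    ultimately have "((\<lambda>w. u (\<phi> w) - Re (F0 w)) has_derivative
        (\<lambda>k. (ux (\<phi> w) * Re (deriv \<phi> w * k) + uy (\<phi> w) * Im (deriv \<phi> w * k))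
              - Re ((G (\<phi> w) * deriv \<phi> w) * k))) (at w within ball 0 1)"
      by (rule has_derivative_diff)
    also have "(\<lambda>k. (ux (\<phi> w) * Re (deriv \<phi> w * k) + uy (\<phi> w) * Im (deriv \<phi> w * k))
              - Re ((G (\<phi> w) * deriv \<phi> w) * k)) = (\<lambda>_. 0)"
      by (auto simp: G_def algebra_simps)
    finally show ?thesis .
  qed
  obtain a where a: "\<And>w. w \<in> ball 0 1 \<Longrightarrow> u (\<phi> w) - Re (F0 w) = a"
    using has_derivative_zero_constant[OF convex_ball D] by blast
  have "F0 holomorphic_on ball 0 1"
    unfolding holomorphic_on_def field_differentiable_def using F0 by blast
  then have "(\<lambda>w. F0 w + of_real a) holomorphic_on ball 0 1"
    by (intro holomorphic_intros)
  moreover have "\<forall>w\<in>ball 0 1. u (\<phi> w) = Re (F0 w + of_real a)"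
    using a by force
  ultimately show ?thesis by blast
qed

section \<open>Riemann maps that extend continuously to the closed disk\<close>

text \<open>Boundary data and inverse Riemann maps are arbitrary at finitely many points.\<close>
lemma borel_measurable_continuous_off_finite:
  fixes g :: "complex \<Rightarrow> 'b::{banach, second_countable_topology}"
  assumes W: "W \<in> sets borel" and g: "continuous_on W g" and F: "finite F"
  shows "(\<lambda>z. if z \<in> W \<union> F then g z else 0) \<in> borel_measurable borel"
proof (rule measurable_discrete_difference[of "\<lambda>z. indicator W z *\<^sub>R g z" _ _ F])
  show "(\<lambda>z. indicator W z *\<^sub>R g z) \<in> borel_measurable borel"
    by (rule borel_measurable_continuous_on_indicator[OF W g])
qed (use F in \<open>auto intro: countable_finite\<close>)

locale closed_riemann_map =
  fixes \<phi> :: "complex \<Rightarrow> complex" and V :: "complex set"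
  assumes map: "riemann_map_closed \<phi> V" and V: "open V"
begin

lemma continuous: "continuous_on (cball 0 1) \<phi>"
  and image_cball: "\<phi> ` cball 0 1 = closure V"
  and holomorphic: "\<phi> holomorphic_on ball 0 1"
  and inj: "inj_on \<phi> (ball 0 1)"
  and image_ball: "\<phi> ` ball 0 1 = V"
  using map by (auto simp: riemann_map_closed_def)

lemma radial_limit:
  assumes "cmod \<zeta> = 1"
  shows "((\<lambda>r. \<phi> (of_real r * \<zeta>)) \<longlongrightarrow> \<phi> \<zeta>) (at_left (1::real))"
    and "\<forall>\<^sub>F r in at_left (1::real). of_real r * \<zeta> \<in> ball 0 1"
proof -
  show ev: "\<forall>\<^sub>F r in at_left (1::real). of_real r * \<zeta> \<in> ball 0 1"
    using eventually_at_left_real[of 0 1] by (auto elim!: eventually_mono simp: norm_mult assms)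
  have "((\<lambda>r. of_real r * \<zeta>) \<longlongrightarrow> of_real 1 * \<zeta>) (at_left (1::real))"
    by (intro tendsto_intros)
  then show "((\<lambda>r. \<phi> (of_real r * \<zeta>)) \<longlongrightarrow> \<phi> \<zeta>) (at_left (1::real))"
    by (intro continuous_on_tendsto_compose[OF continuous]) (use assms ev in \<open>auto elim!: eventually_mono\<close>)
qed

text \<open>
  If \<open>\<phi> \<zeta>\<close> were inside \<open>V\<close>, the inverse map, continuous there, would carry the radial limit
  to a point of the open disk instead of \<open>\<zeta>\<close>. Consequently points of \<open>V\<close> have no second
  preimage on the circle, and \<open>disk_inv\<close> is the true inverse on \<open>V\<close>.
\<close>
lemma circle_to_boundary:
  assumes \<zeta>: "cmod \<zeta> = 1" shows "\<phi> \<zeta> \<notin> V"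
proof
  assume "\<phi> \<zeta> \<in> V"
  obtain g where g: "g holomorphic_on \<phi> ` ball 0 1" "\<And>w. w \<in> ball 0 1 \<Longrightarrow> g (\<phi> w) = w"
    using holomorphic_has_inverse[OF holomorphic open_ball inj] by metis
  have "isCont g (\<phi> \<zeta>)"
    using holomorphic_on_imp_continuous_on[OF g(1)] V \<open>\<phi> \<zeta> \<in> V\<close>
    by (simp add: image_ball continuous_on_eq_continuous_at)
  then have "((\<lambda>r. g (\<phi> (of_real r * \<zeta>))) \<longlongrightarrow> g (\<phi> \<zeta>)) (at_left (1::real))"
    by (rule isCont_tendsto_compose[OF _ radial_limit(1)[OF \<zeta>]])
  moreover have "\<forall>\<^sub>F r in at_left (1::real). g (\<phi> (of_real r * \<zeta>)) = of_real r * \<zeta>"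
    using radial_limit(2)[OF \<zeta>] by eventually_elim (rule g(2))
  ultimately have "((\<lambda>r. of_real r * \<zeta>) \<longlongrightarrow> g (\<phi> \<zeta>)) (at_left (1::real))"
    using tendsto_cong by fast
  moreover have "((\<lambda>r. of_real r * \<zeta>) \<longlongrightarrow> of_real 1 * \<zeta>) (at_left (1::real))"
    by (intro tendsto_intros)
  ultimately have "g (\<phi> \<zeta>) = \<zeta>"
    using tendsto_unique[OF trivial_limit_at_left_real] by (metis mult_1 of_real_1)
  moreover have "\<phi> \<zeta> \<in> \<phi> ` ball 0 1"
    using \<open>\<phi> \<zeta> \<in> V\<close> by (simp only: image_ball)
  then obtain w where w: "w \<in> ball 0 1" "\<phi> \<zeta> = \<phi> w"
    by (elim imageE)
  ultimately have "w = \<zeta>" using g(2)[OF w(1)] by simp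
  with w(1) \<zeta> show False by simp
qed

lemma disk_inv_closure:
  assumes "z \<in> closure V"
  shows "disk_inv \<phi> z \<in> cball 0 1" and "\<phi> (disk_inv \<phi> z) = z"
  using inv_into_into[of z \<phi> "cball 0 1"] f_inv_into_f[of z \<phi> "cball 0 1"] assms
  unfolding disk_inv_def image_cball by simp_all

lemma disk_inv_inside:
  assumes "z \<in> V" shows "cmod (disk_inv \<phi> z) < 1"
  using disk_inv_closure[of z] circle_to_boundary[of "disk_inv \<phi> z"] assms closure_subset[of V]
  by (auto simp: less_le)

lemma disk_inv_boundary:
  assumes "z \<in> closure V" "z \<notin> V" shows "cmod (disk_inv \<phi> z) = 1"
proof (rule ccontr)
  assume "cmod (disk_inv \<phi> z) \<noteq> 1"
  then have "disk_inv \<phi> z \<in> ball 0 1" using disk_inv_closure(1)[OF assms(1)] by simp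
  then have "\<phi> (disk_inv \<phi> z) \<in> \<phi> ` ball 0 1" by (rule imageI)
  then show False using assms unfolding image_ball disk_inv_closure(2)[OF assms(1)] by simp
qed

lemma disk_inv_map:
  assumes "w \<in> ball 0 1" shows "disk_inv \<phi> (\<phi> w) = w"
proof -
  have "\<phi> w \<in> V" using assms image_ball by auto
  then have "disk_inv \<phi> (\<phi> w) \<in> ball 0 1" "\<phi> (disk_inv \<phi> (\<phi> w)) = \<phi> w"
    using disk_inv_inside disk_inv_closure(2) closure_subset by auto
  then show ?thesis using inj assms by (auto dest: inj_onD)
qed

lemma continuous_disk_inv: "continuous_on V (disk_inv \<phi>)"
proof -
  obtain g where g: "g holomorphic_on \<phi> ` ball 0 1" "\<And>w. w \<in> ball 0 1 \<Longrightarrow> g (\<phi> w) = w"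
    using holomorphic_has_inverse[OF holomorphic open_ball inj] by metis
  have "disk_inv \<phi> z = g z" if "z \<in> V" for z
    using that unfolding image_ball[symmetric] by (auto simp: g(2) disk_inv_map)
  then show ?thesis
    using holomorphic_on_imp_continuous_on[OF g(1)] by (simp add: image_ball cong: continuous_on_cong)
qed

lemma AE_avoids_finite:
  assumes F: "finite F" "F \<inter> V = {}"
  shows "AE \<zeta> in arc_length. cmod \<zeta> = 1 \<and> \<phi> \<zeta> \<notin> F"
proof -
  have "AE \<zeta> in arc_length. \<not> (cmod \<zeta> = 1 \<and> \<phi> \<zeta> - c = 0)" if "c \<in> F" for c
  proof (rule boundary_zeros_null)
    show "\<phi> w - c \<noteq> 0" if "w \<in> ball 0 1" for w
      using \<open>c \<in> F\<close> F(2) image_ball that by auto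
  qed (intro holomorphic_intros continuous_intros holomorphic continuous)+
  then have "AE \<zeta> in arc_length. \<forall>c\<in>F. \<not> (cmod \<zeta> = 1 \<and> \<phi> \<zeta> - c = 0)"
    using F(1) by (intro AE_finite_allI) auto
  then show ?thesis
    using AE_arc_length_sphere by eventually_elim auto
qed

lemma compact_disk_preimage:
  assumes "closed E" shows "compact (disk_preimage \<phi> E)"
proof -
  have "closed (cball 0 1 \<inter> \<phi> -` E)"
    using continuous_closed_preimage[OF continuous _ assms] by simp
  moreover have "disk_preimage \<phi> E = cball 0 1 \<inter> (cball 0 1 \<inter> \<phi> -` E)"
    by (auto simp: disk_preimage_def)
  ultimately show ?thesis
    by (metis compact_Int_closed compact_cball)
qed

lemma disk_preimage_sets:
  assumes "closed E" shows "disk_preimage \<phi> E \<in> sets borel"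
  using compact_disk_preimage[OF assms] by (simp add: borel_compact)

text \<open>
  Nothing is known about \<open>\<phi>\<close> outside the closed disk or about \<open>g\<close> outside \<open>E\<close>, hence the
  values 0 there.
\<close>
lemma compose_measurable:
  assumes E: "closed E" and g: "(\<lambda>z. if z \<in> E then g z else 0) \<in> borel_measurable borel"
  shows "(\<lambda>\<zeta>. if \<zeta> \<in> disk_preimage \<phi> E then g (\<phi> \<zeta>) else (0::'b::{banach, second_countable_topology}))
    \<in> borel_measurable borel"
proof -
  have [measurable]: "disk_preimage \<phi> E \<in> sets borel" by (rule disk_preimage_sets[OF E])
  have m: "(\<lambda>\<zeta>. if \<zeta> \<in> cball 0 1 \<union> {} then \<phi> \<zeta> else 0) \<in> borel_measurable borel"
    by (rule borel_measurable_continuous_off_finite[OF _ continuous]) auto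
  have "(\<lambda>\<zeta>. if \<zeta> \<in> disk_preimage \<phi> E then
      (\<lambda>z. if z \<in> E then g z else 0) ((\<lambda>\<zeta>. if \<zeta> \<in> cball 0 1 \<union> {} then \<phi> \<zeta> else 0) \<zeta>) else 0) \<in> borel_measurable borel"
    using measurable_compose[OF m g] by measurable
  also have "(\<lambda>\<zeta>. if \<zeta> \<in> disk_preimage \<phi> E then
      (\<lambda>z. if z \<in> E then g z else 0) ((\<lambda>\<zeta>. if \<zeta> \<in> cball 0 1 \<union> {} then \<phi> \<zeta> else 0) \<zeta>) else 0)
      = (\<lambda>\<zeta>. if \<zeta> \<in> disk_preimage \<phi> E then g (\<phi> \<zeta>) else 0)"
    by (auto simp: disk_preimage_def)
  finally show ?thesis .
qed

end

section \<open>Piecewise continuous boundary data\<close>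

text \<open>
  A loop is injective away from its base point, so by compactness the image of the parameters far
  from \<open>t\<close> stays away from \<open>\<gamma> t\<close>: nearby points of the curve have nearby parameters.
\<close>
lemma continuous_within_path_image:
  fixes f :: "complex \<Rightarrow> real"
  assumes \<gamma>: "jordan_loop \<gamma>" and t: "0 < t" "t < 1" and f: "isCont (f \<circ> \<gamma>) t"
  shows "continuous (at (\<gamma> t) within path_image \<gamma>) f"
  unfolding continuous_within
proof (rule tendstoI)
  fix e :: real assume "e > 0"
  then have "\<forall>\<^sub>F s in nhds t. dist ((f \<circ> \<gamma>) s) ((f \<circ> \<gamma>) t) < e"
    using f unfolding isCont_def tendsto_at_iff_tendsto_nhds by (rule tendstoD[rotated])
  then obtain d where d: "d > 0" "\<And>s. dist s t < d \<Longrightarrow> dist (f (\<gamma> s)) (f (\<gamma> t)) < e"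
    unfolding eventually_nhds_metric by auto
  define K where "K = \<gamma> ` ({0..1} - ball t d)"
  have inj: "s = t" if "s \<in> {0..1}" "\<gamma> s = \<gamma> t" for s
    using \<gamma> that t unfolding jordan_loop_def simple_path_def loop_free_def by fastforce
  have "continuous_on ({0..1} - ball t d) \<gamma>"
    using \<gamma> by (auto simp: jordan_loop_def simple_path_def path_def intro: continuous_on_subset)
  moreover have "compact ({0..1} - ball t d)"
    by (rule compact_diff) auto
  ultimately have "compact K"
    unfolding K_def by (rule compact_continuous_image)
  then have "open (- K)" by (simp add: compact_imp_closed open_Compl)
  moreover have "\<gamma> t \<notin> K"
    using inj d(1) by (fastforce simp: K_def)
  ultimately have "\<forall>\<^sub>F w in at (\<gamma> t) within path_image \<gamma>. w \<in> - K"
    by (intro topological_tendstoD[OF tendsto_ident_at]) auto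
  moreover have "\<forall>\<^sub>F w in at (\<gamma> t) within path_image \<gamma>. w \<in> path_image \<gamma>"
    by (simp add: eventually_at_filter)
  ultimately show "\<forall>\<^sub>F w in at (\<gamma> t) within path_image \<gamma>. dist (f w) (f (\<gamma> t)) < e"
  proof eventually_elim
    case (elim w)
    then obtain s where s: "s \<in> {0..1}" "w = \<gamma> s" by (auto simp: path_image_def)
    with elim(1) have "dist s t < d" by (auto simp: K_def dist_commute)
    with d(2) s show ?case by simp
  qed
qed

text \<open>One-sided limits give a bound near each point; compactness makes it global.\<close>
lemma bounded_if_one_sided_limits:
  fixes g :: "real \<Rightarrow> real"
  assumes r: "\<And>t. t \<in> {0..<1} \<Longrightarrow> \<exists>l. (g \<longlongrightarrow> l) (at_right t)"
    and l: "\<And>t. t \<in> {0<..1} \<Longrightarrow> \<exists>l. (g \<longlongrightarrow> l) (at_left t)"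
  shows "bounded (g ` {0..1})"
proof -
  have loc: "\<exists>c U. open U \<and> t \<in> U \<and> (\<forall>s\<in>U \<inter> {0..1}. \<bar>g s\<bar> \<le> c)" if t: "t \<in> {0..1}" for t
  proof -
    have bd: "\<exists>c. \<forall>\<^sub>F s in F. \<bar>g s\<bar> \<le> c" if "(g \<longlongrightarrow> l) F" for l F
    proof -
      have "\<forall>\<^sub>F s in F. \<bar>g s - l\<bar> < 1" using tendstoD[OF that, of 1] by (simp add: dist_real_def)
      then have "\<forall>\<^sub>F s in F. \<bar>g s\<bar> \<le> \<bar>l\<bar> + 1" by eventually_elim linarith
      then show ?thesis by blast
    qed
    have "\<exists>c. \<forall>\<^sub>F s in at_right t. s \<le> 1 \<longrightarrow> \<bar>g s\<bar> \<le> c"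
    proof (cases "t < 1")
      case True
      then obtain c where "\<forall>\<^sub>F s in at_right t. \<bar>g s\<bar> \<le> c" using bd r[of t] t by fastforce
      then show ?thesis by (auto elim!: eventually_mono)
    next
      case False
      then have "\<forall>\<^sub>F s in at_right t. s \<le> 1 \<longrightarrow> \<bar>g s\<bar> \<le> 0"
        using t by (auto simp: eventually_at_filter)
      then show ?thesis by blast
    qed
    then obtain c1 where c1: "\<forall>\<^sub>F s in at_right t. s \<le> 1 \<longrightarrow> \<bar>g s\<bar> \<le> c1" by blast
    have "\<exists>c. \<forall>\<^sub>F s in at_left t. 0 \<le> s \<longrightarrow> \<bar>g s\<bar> \<le> c"
    proof (cases "0 < t")
      case True
      then obtain c where "\<forall>\<^sub>F s in at_left t. \<bar>g s\<bar> \<le> c" using bd l[of t] t by fastforce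
      then show ?thesis by (auto elim!: eventually_mono)
    next
      case False
      then have "\<forall>\<^sub>F s in at_left t. 0 \<le> s \<longrightarrow> \<bar>g s\<bar> \<le> 0"
        using t by (auto simp: eventually_at_filter)
      then show ?thesis by blast
    qed
    then obtain c2 where c2: "\<forall>\<^sub>F s in at_left t. 0 \<le> s \<longrightarrow> \<bar>g s\<bar> \<le> c2" by blast
    define c where "c = max (max c1 c2) \<bar>g t\<bar>"
    have "\<forall>\<^sub>F s in at t. s \<in> {0..1} \<longrightarrow> \<bar>g s\<bar> \<le> c"
      unfolding eventually_at_split using c1 c2 by (auto simp: c_def elim!: eventually_mono)
    then have "\<forall>\<^sub>F s in nhds t. s \<in> {0..1} \<longrightarrow> \<bar>g s\<bar> \<le> c"
      unfolding eventually_at_filter by eventually_elim (auto simp: c_def)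
    then show ?thesis unfolding eventually_nhds by blast
  qed
  then obtain c U where U: "\<And>t. t \<in> {0..1} \<Longrightarrow> open (U t) \<and> t \<in> U t \<and> (\<forall>s\<in>U t \<inter> {0..1}. \<bar>g s\<bar> \<le> c t)"
    by metis
  have "{0..1} \<subseteq> (\<Union>t\<in>{0..1}. U t)" using U by blast
  then obtain K where K: "K \<subseteq> {0..1}" "finite K" "{0..1} \<subseteq> (\<Union>t\<in>K. U t)"
    using compactE_image[of "{0..1::real}" "{0..1}" U] U by (metis compact_Icc)
  have "\<bar>g s\<bar> \<le> (\<Sum>t\<in>K. \<bar>c t\<bar>)" if s: "s \<in> {0..1}" for s
  proof -
    obtain t where t: "t \<in> K" "s \<in> U t" using K(3) s by blast
    then have "\<bar>g s\<bar> \<le> c t" using U K(1) s by blast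
    also have "\<dots> \<le> \<bar>c t\<bar>" by simp
    also have "\<dots> \<le> (\<Sum>t\<in>K. \<bar>c t\<bar>)" by (rule member_le_sum[OF t(1)]) (use K(2) in auto)
    finally show ?thesis .
  qed
  then show ?thesis by (intro boundedI[where B = "\<Sum>t\<in>K. \<bar>c t\<bar>"]) auto
qed

lemma piecewise_continuous_frontierD:
  assumes D: "bounded_jordan_domain n D" and f: "piecewise_continuous_frontier D f"
  obtains F where "finite F" "F \<subseteq> frontier D"
    "\<And>\<zeta>. \<zeta> \<in> frontier D - F \<Longrightarrow> continuous (at \<zeta> within frontier D) f"
    "bounded (f ` frontier D)"
proof -
  obtain \<gamma> where \<gamma>: "\<And>i. i \<in> {1..n} \<Longrightarrow> jordan_loop (\<gamma> i)"
    and disj: "disjoint_family_on (\<lambda>i. path_image (\<gamma> i)) {1..n}"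
    and fr: "frontier D = (\<Union>i\<in>{1..n}. path_image (\<gamma> i))"
    using D unfolding bounded_jordan_domain_def by blast
  have sub: "path_image (\<gamma> i) \<subseteq> frontier D" if "i \<in> {1..n}" for i using fr that by auto
  have "\<forall>i\<in>{1..n}. \<exists>E. finite E \<and> continuous_on ({0..1} - E) (f \<circ> \<gamma> i)"
    using f \<gamma> sub unfolding piecewise_continuous_frontier_def by blast
  then obtain E where E: "\<And>i. i \<in> {1..n} \<Longrightarrow> finite (E i)"
      "\<And>i. i \<in> {1..n} \<Longrightarrow> continuous_on ({0..1} - E i) (f \<circ> \<gamma> i)"
    by metis
  define F where "F = (\<Union>i\<in>{1..n}. \<gamma> i ` ((E i \<union> {0, 1}) \<inter> {0..1}))"
  have "finite F" unfolding F_def using E(1) by auto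
  moreover have "F \<subseteq> frontier D" unfolding F_def fr path_image_def by auto
  moreover have "continuous (at \<zeta> within frontier D) f" if \<zeta>: "\<zeta> \<in> frontier D - F" for \<zeta>
  proof -
    obtain i t where i: "i \<in> {1..n}" and t: "t \<in> {0..1}" "\<zeta> = \<gamma> i t"
      using \<zeta> fr by (auto simp: path_image_def)
    have "\<gamma> i t \<notin> \<gamma> i ` ((E i \<union> {0, 1}) \<inter> {0..1})" using \<zeta> i t by (auto simp: F_def)
    then have t': "t \<notin> E i" "t \<noteq> 0" "t \<noteq> 1" using t(1) by blast+
    have "open ({0<..<1} - E i)" using E(1)[OF i] by (intro open_Diff finite_imp_closed) auto
    moreover have "continuous_on ({0<..<1} - E i) (f \<circ> \<gamma> i)"
      by (rule continuous_on_subset[OF E(2)[OF i]]) auto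
    ultimately have "isCont (f \<circ> \<gamma> i) t"
      using t t' by (simp add: continuous_on_eq_continuous_at o_def)
    then have "continuous (at \<zeta> within path_image (\<gamma> i)) f"
      unfolding t(2) using t t' by (intro continuous_within_path_image \<gamma> i) auto
    moreover have "at \<zeta> within frontier D = at \<zeta> within path_image (\<gamma> i)"
    proof (rule at_within_nhd[where S = "- (\<Union>j\<in>{1..n} - {i}. path_image (\<gamma> j))"])
      show "open (- (\<Union>j\<in>{1..n} - {i}. path_image (\<gamma> j)))"
        using \<gamma> by (intro open_Compl closed_UN) (auto intro!: closed_path_image simp: jordan_loop_def simple_path_def)
      show "\<zeta> \<in> - (\<Union>j\<in>{1..n} - {i}. path_image (\<gamma> j))"
        using disj i t by (fastforce simp: disjoint_family_on_def path_image_def)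
    qed (use fr i in auto)
    ultimately show ?thesis by simp
  qed
  moreover have "bounded (f ` frontier D)"
  proof -
    have "bounded (f ` path_image (\<gamma> i))" if i: "i \<in> {1..n}" for i
    proof -
      have "bounded ((f \<circ> \<gamma> i) ` {0..1})"
        using f \<gamma>[OF i] sub[OF i] unfolding piecewise_continuous_frontier_def
        by (intro bounded_if_one_sided_limits) blast+
      then show ?thesis by (simp add: path_image_def image_comp)
    qed
    then show ?thesis unfolding fr image_UN by (intro bounded_UN) auto
  qed
  ultimately show ?thesis using that by blast
qed

text \<open>The endpoints of an arc are limits of its interior points.\<close>
lemma crosscut_subset_closure_interior:
  assumes "crosscut D \<gamma>"
  shows "path_image \<gamma> \<subseteq> closure (path_image \<gamma> \<inter> D)"
proof
  fix z assume "z \<in> path_image \<gamma>"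
  then obtain t where t: "t \<in> {0..1}" "z = \<gamma> t" by (auto simp: path_image_def)
  have arc: "arc \<gamma>" using assms by (simp add: crosscut_def)
  have in_D: "\<gamma> s \<in> path_image \<gamma> \<inter> D" if s: "s \<in> {0<..<1}" for s
  proof -
    have "\<gamma> s \<noteq> \<gamma> 0" "\<gamma> s \<noteq> \<gamma> 1"
      using arc s inj_onD[of \<gamma> "{0..1}" s 0] inj_onD[of \<gamma> "{0..1}" s 1] by (auto simp: arc_def)
    moreover have "\<gamma> s \<in> path_image \<gamma>" using s by (auto simp: path_image_def)
    ultimately show ?thesis using assms by (auto simp: crosscut_def pathstart_def pathfinish_def)
  qed
  have "continuous_on {0..1} \<gamma>" using arc by (simp add: arc_def path_def)
  then have "\<gamma> ` closure {0<..<1} \<subseteq> closure (path_image \<gamma> \<inter> D)"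
    by (intro image_closure_subset) (use in_D closure_subset in \<open>auto intro: subsetD[OF closure_subset]\<close>)
  then show "z \<in> closure (path_image \<gamma> \<inter> D)" using t by auto
qed

section \<open>Solving in a cut domain\<close>

locale dirichlet_data =
  fixes D :: "complex set" and f u :: "complex \<Rightarrow> real" and F :: "complex set" and c M :: real
  assumes D: "open D"
    and F: "finite F" "F \<inter> D = {}"
    and f_continuous: "\<And>\<zeta>. \<zeta> \<in> frontier D - F \<Longrightarrow> continuous (at \<zeta> within frontier D) f"
    and f_le: "\<And>\<zeta>. \<zeta> \<in> frontier D \<Longrightarrow> \<bar>f \<zeta>\<bar> \<le> c"
    and harmonic: "harmonic_on u D"
    and u_le: "\<And>z. z \<in> D \<Longrightarrow> \<bar>u z\<bar> \<le> M"
    and limit: "\<And>\<zeta>. \<zeta> \<in> frontier D - F \<Longrightarrow> (u \<longlongrightarrow> f \<zeta>) (at \<zeta> within D)"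
    and c: "0 \<le> c" and M: "0 \<le> M"
begin

text \<open>
  The value 0 on the boundary of \<open>D\<close> matters only at the endpoints of the cuts. It is the value that
  makes the integral equation true there, since all Poisson kernels vanish when their first
  argument is on the circle.
\<close>
definition u_ext :: "complex \<Rightarrow> real" where
  "u_ext z = (if z \<in> D then u z else 0)"

lemma abs_u_ext_le: "\<bar>u_ext z\<bar> \<le> M"
  using u_le M by (simp add: u_ext_def)

lemma u_continuous: "z \<in> D \<Longrightarrow> isCont u z"
  using harmonic unfolding harmonic_on_def by (blast intro: has_derivative_continuous)

lemma u_ext_measurable [measurable]: "u_ext \<in> borel_measurable borel"
proof -
  have "continuous_on D u" using u_continuous by (simp add: continuous_at_imp_continuous_on)
  from borel_measurable_continuous_off_finite[OF _ this, of "{}"] D show ?thesis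
    by (simp add: u_ext_def[abs_def])
qed

lemma f_measurable: "(\<lambda>z. if z \<in> frontier D then f z else 0) \<in> borel_measurable borel"
proof -
  have "continuous_on (frontier D - F) f"
    unfolding continuous_on_eq_continuous_within
    using f_continuous by (auto intro: continuous_within_subset)
  moreover have "frontier D - F \<in> sets borel"
    using F(1) by (intro sets.Diff borel_closed) (auto simp: finite_imp_closed)
  ultimately have "(\<lambda>z. if z \<in> (frontier D - F) \<union> (F \<inter> frontier D) then f z else 0) \<in> borel_measurable borel"
    using F(1) by (intro borel_measurable_continuous_off_finite) auto
  moreover have "(frontier D - F) \<union> (F \<inter> frontier D) = frontier D" by auto
  ultimately show ?thesis by simp
qed

end

text \<open>
  The topological facts about a system \<open>C\<close> of crosscuts that the analysis depends on. By
  \<open>C_closure\<close> every point of the cuts, endpoints included, is a limit of points inside \<open>D\<close>.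
\<close>
locale cut_domain =
  fixes D C :: "complex set" and \<phi> :: "complex \<Rightarrow> complex"
  assumes open_D: "open D" and compact_C: "compact C"
    and finite_ends: "finite (C \<inter> frontier D)"
    and C_closure: "C \<subseteq> closure (C \<inter> D)"
    and map_D: "riemann_map_closed \<phi> (D - C)"
begin

sublocale closed_riemann_map \<phi> "D - C"
  by standard (use map_D open_D compact_C in \<open>auto intro: open_Diff compact_imp_closed\<close>)

abbreviation A where "A \<equiv> disk_preimage \<phi> (frontier D)"
abbreviation B where "B \<equiv> disk_preimage \<phi> C"

lemma closed_C: "closed C" by (rule compact_imp_closed[OF compact_C])

lemma B_sets [measurable]: "B \<in> sets borel" by (rule disk_preimage_sets[OF closed_C])

lemma B_sphere: "\<zeta> \<in> B \<Longrightarrow> cmod \<zeta> = 1"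
  using image_ball by (auto simp: disk_preimage_def less_le)

lemma C_cases: "z \<in> C \<Longrightarrow> z \<in> D \<or> z \<in> frontier D"
  using C_closure closure_mono[of "C \<inter> D" D] by (auto simp: frontier_def interior_open[OF open_D])

lemma circle_cases:
  assumes "cmod \<zeta> = 1"
  shows "\<phi> \<zeta> \<in> frontier D \<and> \<phi> \<zeta> \<notin> D \<and> \<zeta> \<in> A \<or> \<phi> \<zeta> \<in> D \<and> \<phi> \<zeta> \<in> C \<and> \<zeta> \<in> B \<and> \<zeta> \<notin> A"
proof -
  have "\<phi> \<zeta> \<in> closure (D - C)" using assms image_cball by force
  then have "\<phi> \<zeta> \<in> closure D" using closure_mono[of "D - C" D] by auto
  then show ?thesis
    using circle_to_boundary[OF assms] assms
    by (auto simp: frontier_def interior_open[OF open_D] disk_preimage_def)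
qed

end

locale cut_solution = cut_domain D C \<phi> + dirichlet_data D f u F c M
  for D C \<phi> f u F c M
begin

text \<open>
  The boundary function of \<open>u \<circ> \<phi>\<close> on the unit circle. The sets \<open>A\<close> and \<open>B\<close> overlap in the
  preimages of endpoints of the cuts, where the second summand vanishes.
\<close>
definition bdry :: "complex \<Rightarrow> real" where
  "bdry \<zeta> = (if \<zeta> \<in> A then f (\<phi> \<zeta>) else 0) + (if \<zeta> \<in> B then u_ext (\<phi> \<zeta>) else 0)"

lemma bdry_A_measurable [measurable]: "(\<lambda>\<zeta>. if \<zeta> \<in> A then f (\<phi> \<zeta>) else 0) \<in> borel_measurable borel"
  by (rule compose_measurable[OF _ f_measurable]) simp

lemma bdry_B_measurable [measurable]: "(\<lambda>\<zeta>. if \<zeta> \<in> B then u_ext (\<phi> \<zeta>) else 0) \<in> borel_measurable borel"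
proof (rule compose_measurable[OF closed_C])
  have [measurable]: "C \<in> sets borel" using closed_C by simp
  show "(\<lambda>z. if z \<in> C then u_ext z else 0) \<in> borel_measurable borel" by measurable
qed

lemma boundary_values:
  "AE \<zeta> in arc_length. ((\<lambda>r. u (\<phi> (of_real r * \<zeta>))) \<longlongrightarrow> bdry \<zeta>) (at_left 1)"
proof -
  have "F \<inter> (D - C) = {}" using F(2) by auto
  from AE_avoids_finite[OF F(1) this] show ?thesis
  proof eventually_elim
    case (elim \<zeta>)
    then have \<zeta>: "cmod \<zeta> = 1" by simp
    have inD: "\<forall>\<^sub>F r in at_left (1::real). \<phi> (of_real r * \<zeta>) \<in> D"
      using radial_limit(2)[OF \<zeta>] by eventually_elim (use image_ball in auto)
    show ?case
    proof (cases "\<phi> \<zeta> \<in> D")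
      case True
      then have "bdry \<zeta> = u (\<phi> \<zeta>)"
        using circle_cases[OF \<zeta>] by (auto simp: bdry_def u_ext_def)
      then show ?thesis
        using isCont_tendsto_compose[OF u_continuous[OF True] radial_limit(1)[OF \<zeta>]] by simp
    next
      case False
      then have fr: "\<phi> \<zeta> \<in> frontier D - F" and "\<zeta> \<in> A"
        using circle_cases[OF \<zeta>] elim by auto
      then have "bdry \<zeta> = f (\<phi> \<zeta>)"
        using False by (auto simp: bdry_def u_ext_def)
      moreover have "filterlim (\<lambda>r. \<phi> (of_real r * \<zeta>)) (at (\<phi> \<zeta>) within D) (at_left 1)"
        unfolding filterlim_at using radial_limit(1)[OF \<zeta>] inD False
        by (auto elim!: eventually_mono)
      ultimately show ?thesis
        using filterlim_compose[OF limit[OF fr]] by simp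
    qed
  qed
qed

lemma poisson_solution:
  assumes z: "z \<in> D - C"
  shows "u z = 1 / (2 * pi) * (\<integral>\<zeta>. poisson (disk_inv \<phi> z) \<zeta> * bdry \<zeta> \<partial>arc_length)"
proof -
  obtain G where G: "G holomorphic_on ball 0 1" "\<And>w. w \<in> ball 0 1 \<Longrightarrow> u (\<phi> w) = Re (G w)"
    using harmonic_compose_is_real_part[OF harmonic D holomorphic] image_ball by blast
  have z1: "cmod (disk_inv \<phi> z) < 1" by (rule disk_inv_inside[OF z])
  have "Re (G (disk_inv \<phi> z)) = 1 / (2 * pi) * (\<integral>\<zeta>. poisson (disk_inv \<phi> z) \<zeta> * bdry \<zeta> \<partial>arc_length)"
  proof (rule poisson_representation[OF G(1) _ _ _ z1])
    show "\<bar>Re (G w)\<bar> \<le> M" if "w \<in> ball 0 1" for w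
    proof -
      have "\<phi> w \<in> \<phi> ` ball 0 1" using that by (rule imageI)
      then show ?thesis unfolding image_ball using G(2)[OF that] u_le[of "\<phi> w"] by simp
    qed
    show "bdry \<in> borel_measurable borel" unfolding bdry_def[abs_def] by measurable
    show "AE \<zeta> in arc_length. ((\<lambda>r. Re (G (of_real r * \<zeta>))) \<longlongrightarrow> bdry \<zeta>) (at_left 1)"
      using boundary_values AE_arc_length_sphere
    proof eventually_elim
      case (elim \<zeta>)
      then have "\<forall>\<^sub>F r in at_left (1::real). of_real r * \<zeta> \<in> ball 0 1"
        by (intro radial_limit(2)) simp
      then have "\<forall>\<^sub>F r in at_left (1::real). u (\<phi> (of_real r * \<zeta>)) = Re (G (of_real r * \<zeta>))"
        by eventually_elim (rule G(2))
      then show ?case using elim(1) tendsto_cong by fast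
    qed
  qed
  moreover have "u z = Re (G (disk_inv \<phi> z))"
    using G(2)[of "disk_inv \<phi> z"] disk_inv_closure(2)[of z] z z1 closure_subset[of "D - C"] by auto
  ultimately show ?thesis by simp
qed

text \<open>
  The known part of the boundary function gives \<open>H_cut\<close>; the rest is the Poisson integral of \<open>u\<close>
  itself over the cuts.
\<close>
lemma solution_split:
  assumes z: "z \<in> D - C"
  shows "u z = H_cut D f \<phi> z + 1 / (2 * pi) * (LINT \<zeta>:B|arc_length. poisson (disk_inv \<phi> z) \<zeta> * u_ext (\<phi> \<zeta>))"
proof -
  let ?P = "poisson (disk_inv \<phi> z)"
  have z1: "cmod (disk_inv \<phi> z) < 1" by (rule disk_inv_inside[OF z])
  have iA: "integrable arc_length (\<lambda>\<zeta>. ?P \<zeta> * (if \<zeta> \<in> A then f (\<phi> \<zeta>) else 0))"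
    by (rule poisson_mult_integrable[where M = c, OF bdry_A_measurable])
       (use f_le c z1 in \<open>auto simp: disk_preimage_def\<close>)
  have iB: "integrable arc_length (\<lambda>\<zeta>. ?P \<zeta> * (if \<zeta> \<in> B then u_ext (\<phi> \<zeta>) else 0))"
    by (rule poisson_mult_integrable[where M = M]) (use abs_u_ext_le M z1 in auto)
  have "(\<integral>\<zeta>. ?P \<zeta> * bdry \<zeta> \<partial>arc_length)
      = (\<integral>\<zeta>. ?P \<zeta> * (if \<zeta> \<in> A then f (\<phi> \<zeta>) else 0) \<partial>arc_length)
      + (\<integral>\<zeta>. ?P \<zeta> * (if \<zeta> \<in> B then u_ext (\<phi> \<zeta>) else 0) \<partial>arc_length)"
    unfolding bdry_def distrib_left by (rule Bochner_Integration.integral_add[OF iA iB])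
  also have "(\<integral>\<zeta>. ?P \<zeta> * (if \<zeta> \<in> A then f (\<phi> \<zeta>) else 0) \<partial>arc_length) = (LINT \<zeta>:A|arc_length. ?P \<zeta> * f (\<phi> \<zeta>))"
    unfolding set_lebesgue_integral_def by (intro Bochner_Integration.integral_cong) auto
  also have "(\<integral>\<zeta>. ?P \<zeta> * (if \<zeta> \<in> B then u_ext (\<phi> \<zeta>) else 0) \<partial>arc_length) = (LINT \<zeta>:B|arc_length. ?P \<zeta> * u_ext (\<phi> \<zeta>))"
    unfolding set_lebesgue_integral_def by (intro Bochner_Integration.integral_cong) auto
  finally show ?thesis
    unfolding poisson_solution[OF z] H_cut_def by (simp add: distrib_left)
qed

text \<open>
  If \<open>\<bar>u\<bar>\<close> exceeds the bound \<open>c\<close> of the data by at most \<open>e\<close> on the cuts, then off the cuts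
  the excess shrinks by the factor of harmonic measure.
\<close>
lemma solution_le:
  assumes z: "z \<in> D - C" and e: "e \<ge> 0" and le: "\<And>w. w \<in> C \<inter> D \<Longrightarrow> \<bar>u w\<bar> \<le> c + e"
  shows "\<bar>u z\<bar> \<le> c + e * ((LINT \<zeta>:B|arc_length. poisson (disk_inv \<phi> z) \<zeta>) / (2 * pi))"
proof -
  let ?P = "poisson (disk_inv \<phi> z)"
  have z1: "cmod (disk_inv \<phi> z) < 1" by (rule disk_inv_inside[OF z])
  have ib: "integrable arc_length (\<lambda>\<zeta>. ?P \<zeta> * \<bar>bdry \<zeta>\<bar>)"
  proof (rule poisson_mult_integrable[where M = "c + M", OF _ _ z1])
    show "(\<lambda>\<zeta>. \<bar>bdry \<zeta>\<bar>) \<in> borel_measurable borel" unfolding bdry_def by measurable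
    have "\<bar>\<bar>bdry \<zeta>\<bar>\<bar> \<le> c + M" for \<zeta>
      unfolding bdry_def abs_idempotent
      by (intro order_trans[OF abs_triangle_ineq] add_mono) (use f_le c M abs_u_ext_le in \<open>auto simp: disk_preimage_def\<close>)
    then show "AE \<zeta> in arc_length. \<bar>\<bar>bdry \<zeta>\<bar>\<bar> \<le> c + M" by simp
  qed
  have i1: "integrable arc_length ?P"
    using poisson_mult_integrable[of "\<lambda>_. 1" 1] z1 by simp
  have iB: "integrable arc_length (\<lambda>\<zeta>. ?P \<zeta> * indicator B \<zeta>)"
    by (rule poisson_mult_integrable[where M = 1]) (use z1 in \<open>auto simp: indicator_def\<close>)
  have "\<bar>\<integral>\<zeta>. ?P \<zeta> * bdry \<zeta> \<partial>arc_length\<bar> \<le> (\<integral>\<zeta>. \<bar>?P \<zeta> * bdry \<zeta>\<bar> \<partial>arc_length)"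
    by (rule integral_abs_bound)
  also have "\<dots> = (\<integral>\<zeta>. ?P \<zeta> * \<bar>bdry \<zeta>\<bar> \<partial>arc_length)"
    using poisson_nonneg z1 by (simp add: abs_mult)
  also have "\<dots> \<le> (\<integral>\<zeta>. c * ?P \<zeta> + e * (?P \<zeta> * indicator B \<zeta>) \<partial>arc_length)"
  proof (rule integral_mono_AE[OF ib])
    show "integrable arc_length (\<lambda>\<zeta>. c * ?P \<zeta> + e * (?P \<zeta> * indicator B \<zeta>))"
      using i1 iB by (intro Bochner_Integration.integrable_add integrable_mult_right)
    show "AE \<zeta> in arc_length. ?P \<zeta> * \<bar>bdry \<zeta>\<bar> \<le> c * ?P \<zeta> + e * (?P \<zeta> * indicator B \<zeta>)"
      using AE_arc_length_sphere
    proof eventually_elim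
      case (elim \<zeta>)
      then have "cmod \<zeta> = 1" by simp
      from circle_cases[OF this] have "\<bar>bdry \<zeta>\<bar> \<le> c + e * indicator B \<zeta>"
        using f_le[of "\<phi> \<zeta>"] le[of "\<phi> \<zeta>"] e by (auto simp: bdry_def u_ext_def indicator_def)
      from mult_left_mono[OF this, of "?P \<zeta>"] show ?case
        using poisson_nonneg[of "disk_inv \<phi> z" \<zeta>] z1 by (simp add: algebra_simps)
    qed
  qed
  also have "\<dots> = c * (2 * pi) + e * (LINT \<zeta>:B|arc_length. ?P \<zeta>)"
    using i1 iB z1 by (simp add: poisson_integral_one set_lebesgue_integral_def mult.commute)
  finally have "\<bar>\<integral>\<zeta>. ?P \<zeta> * bdry \<zeta> \<partial>arc_length\<bar> / (2 * pi) \<le> (c * (2 * pi) + e * (LINT \<zeta>:B|arc_length. ?P \<zeta>)) / (2 * pi)"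
    by (rule divide_right_mono) simp
  then show ?thesis
    unfolding poisson_solution[OF z] by (simp add: abs_mult add_divide_distrib)
qed

end

section \<open>Two systems of cuts\<close>

text \<open>Every open arc has positive length.\<close>
lemma closed_AE_arc_length:
  assumes B: "closed B" and ae: "AE \<zeta> in arc_length. \<zeta> \<in> B"
  shows "sphere 0 1 \<subseteq> B"
proof -
  have [measurable]: "B \<in> sets borel" using B by simp
  have "AE t in restrict_space lborel {0..<2*pi}. cis t \<in> B"
    using ae unfolding arc_length_def
    by (subst (asm) AE_distr_iff) (auto intro!: measurable_restrict_space1)
  then have ae': "AE t in lborel. t \<in> {0..<2*pi} \<longrightarrow> cis t \<in> B"
    by (subst (asm) AE_restrict_space_iff) auto
  define U where "U = {0<..<2*pi} \<inter> cis -` (- B)"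
  have "open U"
    unfolding U_def using B by (intro open_Int open_vimage continuous_intros) auto
  have "AE t in lborel. t \<notin> U"
    using ae' by eventually_elim (auto simp: U_def)
  then have "U \<in> null_sets lborel"
    using \<open>open U\<close> by (subst (asm) AE_iff_null_sets[symmetric]) auto
  then have "negligible U"
    by (simp add: negligible_iff_null_sets null_sets_completionI)
  then have "U = {}" using open_not_negligible[OF \<open>open U\<close>] by blast
  then have sub: "cis ` {0<..<2*pi} \<subseteq> B" by (auto simp: U_def)
  have "cis ` closure {0<..<2*pi} \<subseteq> B"
    by (intro image_closure_subset B sub continuous_intros)
  then have cl: "cis t \<in> B" if "0 \<le> t" "t \<le> 2*pi" for t using that by auto
  show ?thesis
  proof
    fix \<zeta> :: complex assume "\<zeta> \<in> sphere 0 1"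
    then have "cmod \<zeta> = 1" by simp
    then have "\<zeta> = cis (Arg2pi \<zeta>)"
      using Arg2pi_eq[of \<zeta>] by (simp add: cis_conv_exp)
    then show "\<zeta> \<in> B"
      using cl[of "Arg2pi \<zeta>"] Arg2pi_ge_0[of \<zeta>] Arg2pi_lt_2pi[of \<zeta>] by simp
  qed
qed

text \<open>Equality would put almost every point of the circle into \<open>B\<close>, as the Poisson kernel is positive.\<close>
lemma poisson_set_integral_less:
  assumes B: "closed B" and \<zeta>0: "cmod \<zeta>0 = 1" "\<zeta>0 \<notin> B" and x: "cmod x < 1"
  shows "(LINT \<zeta>:B|arc_length. poisson x \<zeta>) < 2 * pi"
proof (rule ccontr)
  assume neg: "\<not> ?thesis"
  have [measurable]: "B \<in> sets borel" using B by simp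
  have i1: "integrable arc_length (poisson x)"
    using poisson_mult_integrable[of "\<lambda>_. 1" 1] x by simp
  have iB: "integrable arc_length (\<lambda>\<zeta>. poisson x \<zeta> * indicator B \<zeta>)"
    by (rule poisson_mult_integrable[where M = 1]) (use x in \<open>auto simp: indicator_def\<close>)
  let ?g = "\<lambda>\<zeta>. poisson x \<zeta> - poisson x \<zeta> * indicator B \<zeta>"
  have "integral\<^sup>L arc_length ?g = 2 * pi - (LINT \<zeta>:B|arc_length. poisson x \<zeta>)"
    using i1 iB x by (simp add: poisson_integral_one set_lebesgue_integral_def mult.commute)
  then have "integral\<^sup>L arc_length ?g \<le> 0" using neg by simp
  moreover have g0: "AE \<zeta> in arc_length. 0 \<le> ?g \<zeta>"
    using poisson_nonneg x by (auto simp: indicator_def)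
  ultimately have "integral\<^sup>L arc_length ?g = 0"
    using integral_nonneg_AE[OF g0] by simp
  then have "AE \<zeta> in arc_length. ?g \<zeta> = 0"
    using i1 iB g0 by (subst (asm) integral_nonneg_eq_0_iff_AE) auto
  then have "AE \<zeta> in arc_length. \<zeta> \<in> B"
    using AE_arc_length_sphere
  proof eventually_elim
    case (elim \<zeta>)
    then have "poisson x \<zeta> > 0" by (intro poisson_pos[OF x]) simp
    with elim show ?case by (auto simp: indicator_def split: if_splits)
  qed
  from closed_AE_arc_length[OF B this] \<zeta>0 show False by auto
qed

locale two_cuts =
  S: cut_solution D S \<phi>1 f u F c M + T: cut_solution D T \<phi>2 f u F c M
  for D S T \<phi>1 \<phi>2 f u F c M +
  assumes disjoint: "S \<inter> T = {}"
    and S_end: "S \<inter> frontier D \<noteq> {}"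
begin

lemma S_closure: "S \<subseteq> closure (D - T)"
  using S.C_closure closure_mono[of "S \<inter> D" "D - T"] disjoint by auto

lemma T_closure: "T \<subseteq> closure (D - S)"
  using T.C_closure closure_mono[of "T \<inter> D" "D - S"] disjoint by auto

lemma inv2_S: "z \<in> S \<Longrightarrow> disk_inv \<phi>2 z \<in> disk_preimage \<phi>2 S"
  using S_closure T.disk_inv_closure[of z] by (auto simp: disk_preimage_def)

lemma inv1_norm: "z \<in> D \<union> T \<Longrightarrow> z \<notin> S \<Longrightarrow> cmod (disk_inv \<phi>1 z) \<le> 1"
  using T_closure S.disk_inv_closure(1)[of z] closure_subset[of "D - S"] by auto

lemma inv2_end: "z \<in> S \<Longrightarrow> z \<notin> D \<Longrightarrow> cmod (disk_inv \<phi>2 z) = 1"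
  using S_closure T.disk_inv_boundary[of z] by auto

lemma inv1_end: "z \<in> T \<Longrightarrow> z \<notin> D \<Longrightarrow> cmod (disk_inv \<phi>1 z) = 1"
  using T_closure S.disk_inv_boundary[of z] by auto

text \<open>
  The distance between the preimages of \<open>S\<close> and \<open>T\<close> keeps the Poisson kernels of the second disk
  bounded, even at the endpoints of \<open>S\<close>, whose preimages are on the circle.
\<close>
lemma separation: "\<exists>gap>0. \<forall>x\<in>disk_preimage \<phi>2 S. \<forall>\<zeta>\<in>T.B. gap \<le> cmod (x - \<zeta>)"
proof -
  have "disk_preimage \<phi>2 S \<inter> T.B = {}" using disjoint by (auto simp: disk_preimage_def)
  from separate_compact_closed[OF T.compact_disk_preimage[OF S.closed_C]
      compact_imp_closed[OF T.compact_disk_preimage[OF T.closed_C]] this]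
  show ?thesis by (auto simp: dist_norm)
qed

definition gap where "gap = (SOME gap. gap > 0 \<and> (\<forall>x\<in>disk_preimage \<phi>2 S. \<forall>\<zeta>\<in>T.B. gap \<le> cmod (x - \<zeta>)))"

lemma gap: "gap > 0" "\<And>x \<zeta>. x \<in> disk_preimage \<phi>2 S \<Longrightarrow> \<zeta> \<in> T.B \<Longrightarrow> gap \<le> cmod (x - \<zeta>)"
  using someI_ex[OF separation[unfolded Bex_def]] unfolding gap_def by blast+

lemma poisson_S_T_le:
  assumes "x \<in> disk_preimage \<phi>2 S" "\<zeta> \<in> T.B"
  shows "poisson x \<zeta> \<le> 1 / gap\<^sup>2"
  using assms by (intro poisson_le_dist gap) (auto simp: disk_preimage_def)

text \<open>
  Up to the factor \<open>2 * pi\<close>, the harmonic measure of \<open>T\<close> in \<open>D - T\<close>, transplanted to the disk.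
\<close>
definition W :: "complex \<Rightarrow> real" where
  "W x = (LINT \<zeta>:T.B|arc_length. poisson x \<zeta>)"

abbreviation m where "m \<equiv> m_cut S T \<phi>2"

lemma W_le_m: "z \<in> S \<Longrightarrow> W (disk_inv \<phi>2 z) \<le> m"
  unfolding m_cut_def W_def
proof (rule cSUP_upper)
  show "bdd_above ((\<lambda>\<zeta>. LINT \<zeta>1:T.B|arc_length. poisson (disk_inv \<phi>2 \<zeta>) \<zeta>1) ` S)"
    using poisson_set_integral_le(1)[OF T.B_sets] inv2_S
    by (intro bdd_aboveI2[where M = "2*pi"]) (auto simp: disk_preimage_def)
qed

lemma m_nonneg: "0 \<le> m"
proof -
  obtain z where z: "z \<in> S" using S_end by auto
  have "0 \<le> W (disk_inv \<phi>2 z)"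
    unfolding W_def by (rule poisson_set_integral_le(2)[OF T.B_sets]) (use inv2_S[OF z] in \<open>auto simp: disk_preimage_def\<close>)
  then show ?thesis using W_le_m[OF z] by simp
qed

lemma continuous_on_W: "continuous_on (disk_preimage \<phi>2 S) W"
  unfolding continuous_on_sequentially
proof (intro allI ballI impI, elim conjE)
  fix x a assume a: "a \<in> disk_preimage \<phi>2 S"
    and x: "\<forall>n. x n \<in> disk_preimage \<phi>2 S" and lim: "x \<longlonglongrightarrow> a"
  show "(W \<circ> x) \<longlonglongrightarrow> W a"
    unfolding W_def o_def set_lebesgue_integral_def
  proof (rule integral_dominated_convergence[where w = "\<lambda>_. 1 / gap\<^sup>2"])
    show "AE \<zeta> in arc_length. (\<lambda>n. indicator T.B \<zeta> *\<^sub>R poisson (x n) \<zeta>) \<longlonglongrightarrow> indicator T.B \<zeta> *\<^sub>R poisson a \<zeta>"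
    proof (intro AE_I2)
      fix \<zeta>
      show "(\<lambda>n. indicator T.B \<zeta> *\<^sub>R poisson (x n) \<zeta>) \<longlonglongrightarrow> indicator T.B \<zeta> *\<^sub>R poisson a \<zeta>"
      proof (cases "\<zeta> \<in> T.B")
        case True
        then have "cmod (a - \<zeta>) \<noteq> 0" using gap(1) gap(2)[OF a True] by auto
        then have "(\<lambda>n. poisson (x n) \<zeta>) \<longlonglongrightarrow> poisson a \<zeta>"
          unfolding poisson_def by (intro tendsto_intros lim) auto
        then show ?thesis by (intro tendsto_intros)
      qed simp
    qed
    show "AE \<zeta> in arc_length. norm (indicator T.B \<zeta> *\<^sub>R poisson (x n) \<zeta>) \<le> 1 / gap\<^sup>2" for n
    proof (intro AE_I2)
      fix \<zeta>
      have "0 \<le> poisson (x n) \<zeta>" using x by (intro poisson_nonneg) (auto simp: disk_preimage_def)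
      then show "norm (indicator T.B \<zeta> *\<^sub>R poisson (x n) \<zeta>) \<le> 1 / gap\<^sup>2"
        using poisson_S_T_le[of "x n" \<zeta>] x by (auto simp: indicator_def)
    qed
  qed auto
qed

text \<open>
  \<open>W\<close> is continuous on the compact preimage of \<open>S\<close>: it vanishes on the circle and is less than
  \<open>2 * pi\<close> inside, because the preimage of an endpoint of \<open>S\<close> lies outside the closed set of
  preimages of \<open>T\<close>.
\<close>
lemma m_less: "m < 2 * pi"
proof -
  obtain z0 where z0: "z0 \<in> S" "z0 \<in> frontier D" using S_end by auto
  have z0D: "z0 \<notin> D" using z0(2) S.open_D by (auto simp: frontier_def interior_open)
  let ?K = "disk_preimage \<phi>2 S"
  have "?K \<noteq> {}" using inv2_S[OF z0(1)] by blast
  from continuous_attains_sup[OF T.compact_disk_preimage[OF S.closed_C] this continuous_on_W]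
  obtain x where x: "x \<in> ?K" "\<And>y. y \<in> ?K \<Longrightarrow> W y \<le> W x" by blast
  have "W x < 2 * pi"
  proof (cases "cmod x < 1")
    case True
    have "disk_inv \<phi>2 z0 \<notin> T.B"
      using inv2_S[OF z0(1)] disjoint by (auto simp: disk_preimage_def)
    then show ?thesis
      unfolding W_def using inv2_end[OF z0(1) z0D] True
      by (intro poisson_set_integral_less compact_imp_closed[OF T.compact_disk_preimage[OF T.closed_C]])
  next
    case False
    then have "cmod x = 1" using x(1) by (auto simp: disk_preimage_def)
    then show ?thesis by (simp add: W_def poisson_on_circle)
  qed
  moreover have "m \<le> W x"
    unfolding m_cut_def W_def[symmetric] by (rule cSUP_least) (use z0 x(2) inv2_S in auto)
  ultimately show ?thesis by simp
qed

subsection \<open>Measurability and bounds for the kernel\<close>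
definition S_in_disk2 :: "complex \<Rightarrow> complex" where
  "S_in_disk2 \<zeta> = (if \<zeta> \<in> S.B then disk_inv \<phi>2 (\<phi>1 \<zeta>) else 0)"

definition T_in_disk1 :: "complex \<Rightarrow> complex" where
  "T_in_disk1 \<zeta> = (if \<zeta> \<in> T.B then disk_inv \<phi>1 (\<phi>2 \<zeta>) else 0)"

lemma S_in_disk2_measurable [measurable]: "S_in_disk2 \<in> borel_measurable borel"
  unfolding S_in_disk2_def[abs_def]
proof (rule S.compose_measurable[OF S.closed_C])
  have "continuous_on (S \<inter> D) (disk_inv \<phi>2)"
    by (rule continuous_on_subset[OF T.continuous_disk_inv]) (use disjoint in auto)
  then have "(\<lambda>z. if z \<in> (S \<inter> D) \<union> (S \<inter> frontier D) then disk_inv \<phi>2 z else 0) \<in> borel_measurable borel"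
    using S.finite_ends S.closed_C S.open_D by (intro borel_measurable_continuous_off_finite) auto
  moreover have "(S \<inter> D) \<union> (S \<inter> frontier D) = S" using S.C_cases by auto
  ultimately show "(\<lambda>z. if z \<in> S then disk_inv \<phi>2 z else 0) \<in> borel_measurable borel" by simp
qed

lemma T_in_disk1_measurable [measurable]: "T_in_disk1 \<in> borel_measurable borel"
  unfolding T_in_disk1_def[abs_def]
proof (rule T.compose_measurable[OF T.closed_C])
  have "continuous_on (T \<inter> D) (disk_inv \<phi>1)"
    by (rule continuous_on_subset[OF S.continuous_disk_inv]) (use disjoint in auto)
  then have "(\<lambda>z. if z \<in> (T \<inter> D) \<union> (T \<inter> frontier D) then disk_inv \<phi>1 z else 0) \<in> borel_measurable borel"
    using T.finite_ends T.closed_C S.open_D by (intro borel_measurable_continuous_off_finite) auto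
  moreover have "(T \<inter> D) \<union> (T \<inter> frontier D) = T" using T.C_cases by auto
  ultimately show "(\<lambda>z. if z \<in> T then disk_inv \<phi>1 z else 0) \<in> borel_measurable borel" by simp
qed

lemma S_in_disk2_B: "\<zeta> \<in> S.B \<Longrightarrow> S_in_disk2 \<zeta> \<in> disk_preimage \<phi>2 S"
  using inv2_S[of "\<phi>1 \<zeta>"] by (simp add: S_in_disk2_def disk_preimage_def)

abbreviation K where "K \<equiv> K_cut S \<phi>1 \<phi>2"

text \<open>
  The kernel outside \<open>S\<close> as a function of the preimage of \<open>z\<close> under \<open>\<phi>1\<close>. In this form it is
  jointly measurable.
\<close>
definition J :: "complex \<Rightarrow> complex \<Rightarrow> real" where
  "J x \<zeta>1 = (\<integral>\<zeta>. indicator S.B \<zeta> * (poisson (S_in_disk2 \<zeta>) \<zeta>1 * poisson x \<zeta>) \<partial>arc_length)"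

lemma K_off_S: "z \<notin> S \<Longrightarrow> K z \<zeta>1 = J (disk_inv \<phi>1 z) \<zeta>1"
  unfolding K_cut_def J_def set_lebesgue_integral_def
  by (auto simp: S_in_disk2_def indicator_def intro!: Bochner_Integration.integral_cong)

lemma K_on_S: "z \<in> S \<Longrightarrow> K z \<zeta>1 = 2 * pi * poisson (disk_inv \<phi>2 z) \<zeta>1"
  by (simp add: K_cut_def)

lemma J_circle: "cmod x = 1 \<Longrightarrow> J x \<zeta>1 = 0"
  by (simp add: J_def poisson_on_circle)

lemma J_measurable [measurable]:
  assumes [measurable]: "g \<in> borel_measurable N" "h \<in> borel_measurable N"
  shows "(\<lambda>x. J (g x) (h x)) \<in> borel_measurable N"
  unfolding J_def by (intro arc_length.borel_measurable_lebesgue_integral) measurable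

lemma J_bounds:
  assumes x: "cmod x \<le> 1" and \<zeta>1: "\<zeta>1 \<in> T.B"
  shows "0 \<le> J x \<zeta>1" "J x \<zeta>1 \<le> 2 * pi / gap\<^sup>2"
proof -
  have y: "0 \<le> poisson (S_in_disk2 \<zeta>) \<zeta>1 \<and> poisson (S_in_disk2 \<zeta>) \<zeta>1 \<le> 1 / gap\<^sup>2" if "\<zeta> \<in> S.B" for \<zeta>
    using poisson_S_T_le[OF S_in_disk2_B[OF that] \<zeta>1] S_in_disk2_B[OF that]
    by (auto intro!: poisson_nonneg simp: disk_preimage_def)
  show "0 \<le> J x \<zeta>1"
    unfolding J_def using y poisson_nonneg[OF x]
    by (intro Bochner_Integration.integral_nonneg) (auto simp: indicator_def)
  show "J x \<zeta>1 \<le> 2 * pi / gap\<^sup>2"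
  proof (cases "cmod x < 1")
    case True
    have i1: "integrable arc_length (\<lambda>\<zeta>. poisson x \<zeta> * indicator S.B \<zeta>)"
      by (rule poisson_mult_integrable[where M = 1]) (use True in \<open>auto simp: indicator_def\<close>)
    have "integrable arc_length (\<lambda>\<zeta>. poisson x \<zeta> * (indicator S.B \<zeta> * poisson (S_in_disk2 \<zeta>) \<zeta>1))"
      by (rule poisson_mult_integrable[where M = "1 / gap\<^sup>2"]) (use True y gap(1) in \<open>auto simp: indicator_def\<close>)
    then have i2: "integrable arc_length (\<lambda>\<zeta>. indicator S.B \<zeta> * (poisson (S_in_disk2 \<zeta>) \<zeta>1 * poisson x \<zeta>))"
      by (simp add: mult_ac)
    have "J x \<zeta>1 \<le> (\<integral>\<zeta>. 1 / gap\<^sup>2 * (poisson x \<zeta> * indicator S.B \<zeta>) \<partial>arc_length)"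
      unfolding J_def
    proof (rule integral_mono[OF i2])
      show "indicator S.B \<zeta> * (poisson (S_in_disk2 \<zeta>) \<zeta>1 * poisson x \<zeta>) \<le> 1 / gap\<^sup>2 * (poisson x \<zeta> * indicator S.B \<zeta>)" for \<zeta>
      proof (cases "\<zeta> \<in> S.B")
        case True
        then show ?thesis using mult_right_mono[OF conjunct2[OF y[OF True]] poisson_nonneg[OF x]] by simp
      qed simp
    qed (use i1 in auto)
    also have "\<dots> = 1 / gap\<^sup>2 * (LINT \<zeta>:S.B|arc_length. poisson x \<zeta>)"
      by (simp add: set_lebesgue_integral_def mult.commute)
    also have "\<dots> \<le> 1 / gap\<^sup>2 * (2 * pi)"
      by (intro mult_left_mono poisson_set_integral_le x) auto
    finally show ?thesis by simp
  next
    case False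
    then show ?thesis using x by (simp add: J_circle)
  qed
qed

text \<open>
  Fubini's theorem for the two Poisson kernels that make up \<open>J\<close>: integrating against \<open>J\<close> means
  solving in \<open>D - T\<close>, restricting to \<open>S\<close>, and solving in \<open>D - S\<close>.
\<close>
lemma J_integral:
  assumes x: "cmod x \<le> 1"
    and g: "(\<lambda>\<zeta>. indicator T.B \<zeta> * g \<zeta>) \<in> borel_measurable borel" "\<And>\<zeta>. \<zeta> \<in> T.B \<Longrightarrow> \<bar>g \<zeta>\<bar> \<le> N"
  shows "(LINT \<zeta>1:T.B|arc_length. J x \<zeta>1 * g \<zeta>1)
    = (LINT \<zeta>:S.B|arc_length. poisson x \<zeta> * (LINT \<zeta>1:T.B|arc_length. poisson (S_in_disk2 \<zeta>) \<zeta>1 * g \<zeta>1))"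
proof (cases "cmod x < 1")
  case False
  then have "cmod x = 1" using x by simp
  then show ?thesis by (simp add: J_circle poisson_on_circle)
next
  case True
  note [measurable] = g(1)
  let ?G = "\<lambda>\<zeta>1. indicator T.B \<zeta>1 * g \<zeta>1"
  interpret P: pair_sigma_finite arc_length arc_length ..
  interpret PF: finite_measure "arc_length \<Otimes>\<^sub>M arc_length"
    by (rule finite_measure_pair_measure) unfold_locales
  let ?f = "\<lambda>\<zeta>1 \<zeta>. indicator S.B \<zeta> * indicator T.B \<zeta>1 * poisson (S_in_disk2 \<zeta>) \<zeta>1 * poisson x \<zeta> * ?G \<zeta>1"
  define E where "E = 1 / gap\<^sup>2 * (1 / (1 - cmod x)\<^sup>2) * \<bar>N\<bar>"
  have E0: "0 \<le> E" by (simp add: E_def)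
  have bound: "\<bar>?f \<zeta>1 \<zeta>\<bar> \<le> E" for \<zeta>1 \<zeta>
  proof (cases "\<zeta> \<in> S.B \<and> \<zeta>1 \<in> T.B")
    case B: True
    have "\<bar>poisson (S_in_disk2 \<zeta>) \<zeta>1\<bar> \<le> 1 / gap\<^sup>2"
      using poisson_S_T_le[OF S_in_disk2_B] poisson_nonneg[of "S_in_disk2 \<zeta>"] B S_in_disk2_B[of \<zeta>] by (auto simp: disk_preimage_def)
    moreover have "\<bar>poisson x \<zeta>\<bar> \<le> 1 / (1 - cmod x)\<^sup>2"
      using poisson_le[OF True S.B_sphere] B poisson_nonneg[OF x] by simp
    ultimately have "\<bar>poisson (S_in_disk2 \<zeta>) \<zeta>1\<bar> * \<bar>poisson x \<zeta>\<bar> * \<bar>g \<zeta>1\<bar> \<le> E"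
      unfolding E_def using g(2)[of \<zeta>1] B by (intro mult_mono) auto
    then show ?thesis using B by (simp add: abs_mult)
  qed (use E0 in auto)
  have "(LINT \<zeta>1:T.B|arc_length. J x \<zeta>1 * g \<zeta>1) = (\<integral>\<zeta>1. (\<integral>\<zeta>. ?f \<zeta>1 \<zeta> \<partial>arc_length) \<partial>arc_length)"
    unfolding set_lebesgue_integral_def
  proof (intro Bochner_Integration.integral_cong refl)
    fix \<zeta>1
    show "indicator T.B \<zeta>1 *\<^sub>R (J x \<zeta>1 * g \<zeta>1) = (\<integral>\<zeta>. ?f \<zeta>1 \<zeta> \<partial>arc_length)"
    proof (cases "\<zeta>1 \<in> T.B")
      case True
      have "(\<integral>\<zeta>. ?f \<zeta>1 \<zeta> \<partial>arc_length) = (\<integral>\<zeta>. indicator S.B \<zeta> * (poisson (S_in_disk2 \<zeta>) \<zeta>1 * poisson x \<zeta>) * g \<zeta>1 \<partial>arc_length)"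
        using True by (intro Bochner_Integration.integral_cong) auto
      also have "\<dots> = J x \<zeta>1 * g \<zeta>1"
        unfolding J_def by (rule integral_mult_left_zero)
      finally show ?thesis using True by auto
    qed simp
  qed
  also have "\<dots> = (\<integral>\<zeta>. (\<integral>\<zeta>1. ?f \<zeta>1 \<zeta> \<partial>arc_length) \<partial>arc_length)"
  proof (rule P.Fubini_integral[symmetric])
    show "integrable (arc_length \<Otimes>\<^sub>M arc_length) (\<lambda>(\<zeta>1, \<zeta>). ?f \<zeta>1 \<zeta>)"
    proof (rule PF.integrable_const_bound[where B = E])
      show "AE z in arc_length \<Otimes>\<^sub>M arc_length. norm (case z of (\<zeta>1, \<zeta>) \<Rightarrow> ?f \<zeta>1 \<zeta>) \<le> E"
        using bound by (auto simp: case_prod_beta)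
      show "(\<lambda>(\<zeta>1, \<zeta>). ?f \<zeta>1 \<zeta>) \<in> borel_measurable (arc_length \<Otimes>\<^sub>M arc_length)"
        by measurable
    qed
  qed
  also have "\<dots> = (LINT \<zeta>:S.B|arc_length. poisson x \<zeta> * (LINT \<zeta>1:T.B|arc_length. poisson (S_in_disk2 \<zeta>) \<zeta>1 * g \<zeta>1))"
    unfolding set_lebesgue_integral_def[of arc_length S.B]
  proof (intro Bochner_Integration.integral_cong refl)
    fix \<zeta>
    have "(\<integral>\<zeta>1. ?f \<zeta>1 \<zeta> \<partial>arc_length)
        = (\<integral>\<zeta>1. indicator S.B \<zeta> * poisson x \<zeta> * (indicator T.B \<zeta>1 *\<^sub>R (poisson (S_in_disk2 \<zeta>) \<zeta>1 * g \<zeta>1)) \<partial>arc_length)"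
      by (intro Bochner_Integration.integral_cong) (auto simp: indicator_def)
    then show "(\<integral>\<zeta>1. ?f \<zeta>1 \<zeta> \<partial>arc_length)
        = indicator S.B \<zeta> *\<^sub>R (poisson x \<zeta> * (LINT \<zeta>1:T.B|arc_length. poisson (S_in_disk2 \<zeta>) \<zeta>1 * g \<zeta>1))"
      by (simp add: set_lebesgue_integral_def)
  qed
  finally show ?thesis .
qed

text \<open>
  On \<open>S\<close> this is the definition of \<open>m\<close>. Elsewhere the integral is the Poisson integral over the
  preimage of \<open>S\<close> of a function that is at most \<open>m\<close>.
\<close>
lemma K_integral_le:
  assumes z: "z \<in> D \<union> T"
  shows "(LINT \<zeta>:T.B|arc_length. K z \<zeta>) \<le> 2 * pi * m"
proof (cases "z \<in> S")
  case True
  then show ?thesis using W_le_m[OF True] by (simp add: K_on_S W_def)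
next
  case False
  let ?x = "disk_inv \<phi>1 z"
  have x: "cmod ?x \<le> 1" by (rule inv1_norm[OF z False])
  have "(LINT \<zeta>:T.B|arc_length. K z \<zeta>) = (LINT \<zeta>:T.B|arc_length. J ?x \<zeta> * 1)"
    by (simp add: K_off_S[OF False])
  also have "\<dots> = (LINT \<zeta>:S.B|arc_length. poisson ?x \<zeta> * W (S_in_disk2 \<zeta>))"
    by (subst J_integral[OF x, of _ 1]) (auto simp: W_def)
  also have "\<dots> \<le> (LINT \<zeta>:S.B|arc_length. poisson ?x \<zeta> * m)"
  proof (cases "cmod ?x < 1")
    case True
    have [measurable]: "W \<in> borel_measurable borel"
      unfolding W_def[abs_def] set_lebesgue_integral_def
      by (intro arc_length.borel_measurable_lebesgue_integral) measurable
    have Wb: "0 \<le> W (S_in_disk2 \<zeta>) \<and> W (S_in_disk2 \<zeta>) \<le> m" if "\<zeta> \<in> S.B" for \<zeta>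
      using W_le_m[of "\<phi>1 \<zeta>"] poisson_set_integral_le(2)[OF T.B_sets, of "S_in_disk2 \<zeta>"] that S_in_disk2_B[OF that]
      by (auto simp: S_in_disk2_def disk_preimage_def W_def)
    show ?thesis
      unfolding set_lebesgue_integral_def
    proof (rule integral_mono)
      have "integrable arc_length (\<lambda>\<zeta>. poisson ?x \<zeta> * (indicator S.B \<zeta> * W (S_in_disk2 \<zeta>)))"
        by (rule poisson_mult_integrable[where M = m]) (use True Wb m_nonneg in \<open>auto simp: indicator_def\<close>)
      then show "integrable arc_length (\<lambda>\<zeta>. indicator S.B \<zeta> *\<^sub>R (poisson ?x \<zeta> * W (S_in_disk2 \<zeta>)))"
        by (simp add: mult_ac)
      have "integrable arc_length (\<lambda>\<zeta>. poisson ?x \<zeta> * (indicator S.B \<zeta> * m))"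
        by (rule poisson_mult_integrable[where M = m]) (use True m_nonneg in \<open>auto simp: indicator_def\<close>)
      then show "integrable arc_length (\<lambda>\<zeta>. indicator S.B \<zeta> *\<^sub>R (poisson ?x \<zeta> * m))"
        by (simp add: mult_ac)
      show "indicator S.B \<zeta> *\<^sub>R (poisson ?x \<zeta> * W (S_in_disk2 \<zeta>)) \<le> indicator S.B \<zeta> *\<^sub>R (poisson ?x \<zeta> * m)" for \<zeta>
        using Wb[of \<zeta>] poisson_nonneg[OF x, of \<zeta>] by (auto simp: indicator_def intro: mult_left_mono)
    qed
  next
    case False
    then show ?thesis using x by (simp add: poisson_on_circle)
  qed
  also have "\<dots> = (LINT \<zeta>:S.B|arc_length. poisson ?x \<zeta>) * m"
    by (simp add: set_integral_mult_left)
  also have "\<dots> \<le> 2 * pi * m"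
    by (intro mult_right_mono poisson_set_integral_le x m_nonneg) auto
  finally show ?thesis .
qed

sublocale iterated_kernel arc_length T.B "D \<union> T" \<phi>2 K "2 * pi / gap\<^sup>2" "2 * pi * m"
proof
  show "T.B \<in> sets arc_length" by simp
  show "\<phi>2 \<zeta> \<in> D \<union> T" if "\<zeta> \<in> T.B" for \<zeta> using that by (auto simp: disk_preimage_def)
  show "(\<lambda>\<zeta>. indicator T.B \<zeta> * K z \<zeta>) \<in> borel_measurable arc_length" for z
    by (cases "z \<in> S") (simp_all add: K_on_S K_off_S)
  have "(\<lambda>(\<xi>, \<zeta>). indicator T.B \<xi> * indicator T.B \<zeta> * J (T_in_disk1 \<xi>) \<zeta>) \<in> borel_measurable (arc_length \<Otimes>\<^sub>M arc_length)"
    by measurable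
  also have "(\<lambda>(\<xi>, \<zeta>). indicator T.B \<xi> * indicator T.B \<zeta> * J (T_in_disk1 \<xi>) \<zeta>)
      = (\<lambda>(\<xi>, \<zeta>). indicator T.B \<xi> * indicator T.B \<zeta> * K (\<phi>2 \<xi>) \<zeta>)"
  proof (intro ext, clarify)
    fix \<xi> \<zeta>
    show "indicator T.B \<xi> * indicator T.B \<zeta> * J (T_in_disk1 \<xi>) \<zeta> = indicator T.B \<xi> * indicator T.B \<zeta> * K (\<phi>2 \<xi>) \<zeta>"
    proof (cases "\<xi> \<in> T.B")
      case True
      then have "\<phi>2 \<xi> \<notin> S" using disjoint by (auto simp: disk_preimage_def)
      then show ?thesis using True by (simp add: K_off_S T_in_disk1_def)
    qed simp
  qed
  finally show "(\<lambda>(\<xi>, \<zeta>). indicator T.B \<xi> * indicator T.B \<zeta> * K (\<phi>2 \<xi>) \<zeta>) \<in> borel_measurable (arc_length \<Otimes>\<^sub>M arc_length)" .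
  fix z assume z: "z \<in> D \<union> T"
  show "(LINT \<zeta>:T.B|arc_length. K z \<zeta>) \<le> 2 * pi * m" by (rule K_integral_le[OF z])
  fix \<zeta> assume \<zeta>: "\<zeta> \<in> T.B"
  show "0 \<le> K z \<zeta>"
  proof (cases "z \<in> S")
    case True
    then have "cmod (disk_inv \<phi>2 z) \<le> 1" using inv2_S by (simp add: disk_preimage_def)
    with True show ?thesis by (simp add: K_on_S poisson_nonneg)
  next
    case False
    then show ?thesis using J_bounds(1)[OF inv1_norm[OF z False] \<zeta>] by (simp add: K_off_S)
  qed
  show "K z \<zeta> \<le> 2 * pi / gap\<^sup>2"
  proof (cases "z \<in> S")
    case True
    have "2 * pi * poisson (disk_inv \<phi>2 z) \<zeta> \<le> 2 * pi * (1 / gap\<^sup>2)"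
      by (rule mult_left_mono[OF poisson_S_T_le[OF inv2_S[OF True] \<zeta>]]) simp
    also have "\<dots> = 2 * pi / gap\<^sup>2" by simp
    finally show ?thesis by (simp only: K_on_S[OF True])
  next
    case False
    then show ?thesis using J_bounds(2)[OF inv1_norm[OF z False] \<zeta>] by (simp add: K_off_S)
  qed
next
  show "0 \<le> 2 * pi / gap\<^sup>2" by simp
qed

subsection \<open>The integral equation\<close>

abbreviation h where "h \<equiv> h_cut D f S \<phi>1 \<phi>2"

lemma H_cut_circle: "cmod (disk_inv \<phi> z) = 1 \<Longrightarrow> H_cut D f \<phi> z = 0"
  by (simp add: H_cut_def poisson_on_circle)

lemma u_ext_on_S:
  assumes z: "z \<in> S"
  shows "S.u_ext z = H_cut D f \<phi>2 z
    + 1 / (2 * pi) * (LINT \<zeta>:T.B|arc_length. poisson (disk_inv \<phi>2 z) \<zeta> * S.u_ext (\<phi>2 \<zeta>))"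
proof (cases "z \<in> D")
  case True
  then show ?thesis using T.solution_split[of z] z disjoint by (auto simp: S.u_ext_def)
next
  case False
  then show ?thesis
    using inv2_end[OF z False] by (simp add: S.u_ext_def H_cut_circle poisson_on_circle)
qed

text \<open>
  In the representation of \<open>u\<close> on \<open>D - S\<close>, the values of \<open>u\<close> on \<open>S\<close> are replaced by the
  representation of \<open>u\<close> on \<open>D - T\<close>: its first part produces \<open>H3_cut\<close>, and its second part, after Fubini's
  theorem, the kernel.
\<close>
lemma integral_equation_off_S:
  assumes z: "z \<in> D" "z \<notin> S"
  shows "u z = h z + 1 / (2 * pi)\<^sup>2 * (LINT \<zeta>:T.B|arc_length. K z \<zeta> * S.u_ext (\<phi>2 \<zeta>))"
proof -
  let ?x = "disk_inv \<phi>1 z"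
  have x: "cmod ?x < 1" using S.disk_inv_inside z by auto
  define R where "R \<zeta> = (LINT \<zeta>1:T.B|arc_length. poisson (S_in_disk2 \<zeta>) \<zeta>1 * S.u_ext (\<phi>2 \<zeta>1))" for \<zeta>
  have uB: "(\<lambda>\<zeta>. indicator T.B \<zeta> * S.u_ext (\<phi>2 \<zeta>)) \<in> borel_measurable borel"
  proof -
    have "(\<lambda>\<zeta>. indicator T.B \<zeta> * S.u_ext (\<phi>2 \<zeta>)) = (\<lambda>\<zeta>. if \<zeta> \<in> T.B then S.u_ext (\<phi>2 \<zeta>) else 0)"
      by (auto simp: indicator_def)
    then show ?thesis using T.bdry_B_measurable by simp
  qed
  note [measurable] = uB
  have [measurable]: "R \<in> borel_measurable borel"
  proof -
    have "R = (\<lambda>\<zeta>. \<integral>\<zeta>1. poisson (S_in_disk2 \<zeta>) \<zeta>1 * (indicator T.B \<zeta>1 * S.u_ext (\<phi>2 \<zeta>1)) \<partial>arc_length)"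
      unfolding R_def set_lebesgue_integral_def by (simp add: mult_ac)
    also have "\<dots> \<in> borel_measurable borel"
      by (intro arc_length.borel_measurable_lebesgue_integral) measurable
    finally show ?thesis .
  qed
  have eq: "H_cut D f \<phi>2 (\<phi>1 \<zeta>) = S.u_ext (\<phi>1 \<zeta>) - 1 / (2 * pi) * R \<zeta>" if "\<zeta> \<in> S.B" for \<zeta>
    using u_ext_on_S[of "\<phi>1 \<zeta>"] that by (auto simp: R_def S_in_disk2_def disk_preimage_def)
  define N where "N = measure arc_length UNIV * (1 / gap\<^sup>2 * M)"
  have Rb: "\<bar>R \<zeta>\<bar> \<le> N" if "\<zeta> \<in> S.B" for \<zeta>
  proof -
    let ?r = "\<lambda>\<zeta>1. indicator T.B \<zeta>1 *\<^sub>R (poisson (S_in_disk2 \<zeta>) \<zeta>1 * S.u_ext (\<phi>2 \<zeta>1))"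
    have b: "\<bar>?r \<zeta>1\<bar> \<le> 1 / gap\<^sup>2 * M" for \<zeta>1
    proof (cases "\<zeta>1 \<in> T.B")
      case True
      have "\<bar>poisson (S_in_disk2 \<zeta>) \<zeta>1\<bar> \<le> 1 / gap\<^sup>2"
        using poisson_S_T_le[OF S_in_disk2_B[OF that] True] poisson_nonneg[of "S_in_disk2 \<zeta>"] S_in_disk2_B[OF that]
        by (auto simp: disk_preimage_def)
      then have "\<bar>poisson (S_in_disk2 \<zeta>) \<zeta>1\<bar> * \<bar>S.u_ext (\<phi>2 \<zeta>1)\<bar> \<le> 1 / gap\<^sup>2 * M"
        by (intro mult_mono S.abs_u_ext_le) auto
      then show ?thesis using True by (simp add: abs_mult)
    qed (use S.M in simp)
    have "?r = (\<lambda>\<zeta>1. poisson (S_in_disk2 \<zeta>) \<zeta>1 * (indicator T.B \<zeta>1 * S.u_ext (\<phi>2 \<zeta>1)))"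
      by (auto simp: mult_ac)
    then have "?r \<in> borel_measurable borel" by simp
    then have "integrable arc_length ?r"
      by (rule arc_length_integrable_bounded) (use b in auto)
    have "\<bar>R \<zeta>\<bar> \<le> (\<integral>\<zeta>1. \<bar>?r \<zeta>1\<bar> \<partial>arc_length)"
      unfolding R_def set_lebesgue_integral_def by (rule integral_abs_bound)
    also have "\<dots> \<le> (\<integral>\<zeta>1. 1 / gap\<^sup>2 * M \<partial>arc_length)"
      by (rule integral_mono) (use b \<open>integrable arc_length ?r\<close> in auto)
    also have "\<dots> = N" by (simp add: N_def)
    finally show ?thesis .
  qed
  have N: "0 \<le> N" using S.M by (simp add: N_def)
  have iu: "integrable arc_length (\<lambda>\<zeta>. poisson ?x \<zeta> * (if \<zeta> \<in> S.B then S.u_ext (\<phi>1 \<zeta>) else 0))"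
    by (rule poisson_mult_integrable[where M = M, OF S.bdry_B_measurable _ x])
       (use S.abs_u_ext_le S.M in auto)
  have iR: "integrable arc_length (\<lambda>\<zeta>. poisson ?x \<zeta> * (indicator S.B \<zeta> * R \<zeta>))"
    by (rule poisson_mult_integrable[where M = N, OF _ _ x]) (use Rb N in \<open>auto simp: indicator_def\<close>)
  have "(LINT \<zeta>:S.B|arc_length. poisson ?x \<zeta> * H_cut D f \<phi>2 (\<phi>1 \<zeta>))
     = (\<integral>\<zeta>. poisson ?x \<zeta> * (if \<zeta> \<in> S.B then S.u_ext (\<phi>1 \<zeta>) else 0)
          - 1 / (2 * pi) * (poisson ?x \<zeta> * (indicator S.B \<zeta> * R \<zeta>)) \<partial>arc_length)"
    unfolding set_lebesgue_integral_def
    by (intro Bochner_Integration.integral_cong refl) (auto simp: eq indicator_def algebra_simps)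
  also have "\<dots> = (\<integral>\<zeta>. poisson ?x \<zeta> * (if \<zeta> \<in> S.B then S.u_ext (\<phi>1 \<zeta>) else 0) \<partial>arc_length)
       - 1 / (2 * pi) * (\<integral>\<zeta>. poisson ?x \<zeta> * (indicator S.B \<zeta> * R \<zeta>) \<partial>arc_length)"
    using iu iR by (subst Bochner_Integration.integral_diff) auto
  also have "(\<integral>\<zeta>. poisson ?x \<zeta> * (if \<zeta> \<in> S.B then S.u_ext (\<phi>1 \<zeta>) else 0) \<partial>arc_length)
       = (LINT \<zeta>:S.B|arc_length. poisson ?x \<zeta> * S.u_ext (\<phi>1 \<zeta>))"
    unfolding set_lebesgue_integral_def by (intro Bochner_Integration.integral_cong) auto
  also have "(\<integral>\<zeta>. poisson ?x \<zeta> * (indicator S.B \<zeta> * R \<zeta>) \<partial>arc_length)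
       = (LINT \<zeta>:S.B|arc_length. poisson ?x \<zeta> * R \<zeta>)"
    unfolding set_lebesgue_integral_def by (intro Bochner_Integration.integral_cong) auto
  also have "(LINT \<zeta>:S.B|arc_length. poisson ?x \<zeta> * R \<zeta>) = (LINT \<zeta>:T.B|arc_length. J ?x \<zeta> * S.u_ext (\<phi>2 \<zeta>))"
    unfolding R_def by (rule J_integral[symmetric, where N = M]) (use x uB S.abs_u_ext_le in auto)
  finally have "(LINT \<zeta>:S.B|arc_length. poisson ?x \<zeta> * S.u_ext (\<phi>1 \<zeta>))
     = (LINT \<zeta>:S.B|arc_length. poisson ?x \<zeta> * H_cut D f \<phi>2 (\<phi>1 \<zeta>))
       + 1 / (2 * pi) * (LINT \<zeta>:T.B|arc_length. K z \<zeta> * S.u_ext (\<phi>2 \<zeta>))"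
    by (simp add: K_off_S[OF z(2)])
  moreover have "u z = H_cut D f \<phi>1 z + 1 / (2 * pi) * (LINT \<zeta>:S.B|arc_length. poisson ?x \<zeta> * S.u_ext (\<phi>1 \<zeta>))"
    using S.solution_split[of z] z by simp
  ultimately show ?thesis
    using z by (simp add: h_cut_def H3_cut_def distrib_left power2_eq_square)
qed

lemma integral_equation:
  assumes z: "z \<in> D \<union> T"
  shows "S.u_ext z = h z + 1 / (2 * pi)\<^sup>2 * (LINT \<zeta>:T.B|arc_length. K z \<zeta> * S.u_ext (\<phi>2 \<zeta>))"
proof (cases "z \<in> S")
  case True
  then show ?thesis
    using u_ext_on_S[OF True] by (simp add: h_cut_def K_on_S mult.assoc power2_eq_square)
next
  case False
  show ?thesis
  proof (cases "z \<in> D")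
    case True
    then show ?thesis using integral_equation_off_S[OF True False] by (simp add: S.u_ext_def)
  next
    case D: False
    then have "cmod (disk_inv \<phi>1 z) = 1" using inv1_end z by auto
    then show ?thesis
      using False D by (simp add: S.u_ext_def h_cut_def H_cut_circle H3_cut_def K_off_S J_circle poisson_on_circle)
  qed
qed

text \<open>
  A maximum principle. If \<open>\<bar>u\<bar> \<le> c + e\<close> on \<open>T\<close>, then \<open>\<bar>u\<bar> \<le> c + (m / (2 * pi)) * e\<close> on \<open>S\<close>,
  and therefore on \<open>T\<close> as well; as \<open>m < 2 * pi\<close>, repetition removes the excess.
\<close>
lemma u_le_on_T: "z \<in> T \<inter> D \<Longrightarrow> \<bar>u z\<bar> \<le> c + (m / (2 * pi)) ^ n * M"
proof (induction n arbitrary: z)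
  case 0
  then show ?case using S.u_le[of z] S.c by simp
next
  case (Suc n)
  let ?q = "m / (2 * pi)" and ?e = "(m / (2 * pi)) ^ n * M"
  have e: "0 \<le> ?e" using m_nonneg S.M by simp
  have "\<bar>u w\<bar> \<le> c + ?q * ?e" if w: "w \<in> S \<inter> D" for w
  proof -
    have "\<bar>u w\<bar> \<le> c + ?e * (W (disk_inv \<phi>2 w) / (2 * pi))"
      unfolding W_def by (rule T.solution_le[OF _ e Suc.IH]) (use w disjoint in auto)
    also have "\<dots> \<le> c + ?e * ?q"
      using W_le_m[of w] w e by (intro add_left_mono mult_left_mono divide_right_mono) auto
    finally show ?thesis by (simp add: mult.commute)
  qed
  moreover have "0 \<le> ?q * ?e" using e m_nonneg by simp
  ultimately have "\<bar>u z\<bar> \<le> c + ?q * ?e * ((LINT \<zeta>:S.B|arc_length. poisson (disk_inv \<phi>1 z) \<zeta>) / (2 * pi))"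
    using Suc.prems disjoint by (intro S.solution_le) auto
  also have "\<dots> \<le> c + ?q * ?e * 1"
    using poisson_set_integral_le(1)[OF S.B_sets, of "disk_inv \<phi>1 z"] inv1_norm[of z] Suc.prems disjoint
      \<open>0 \<le> ?q * ?e\<close>
    by (intro add_left_mono mult_left_mono) auto
  finally show ?case by (simp add: mult.assoc)
qed

lemma u_le_c:
  assumes z: "z \<in> D" shows "\<bar>u z\<bar> \<le> c"
proof -
  have T: "\<bar>u w\<bar> \<le> c + 0" if w: "w \<in> T \<inter> D" for w
  proof (rule LIMSEQ_le_const)
    have "(\<lambda>n. (m / (2 * pi)) ^ n) \<longlonglongrightarrow> 0"
      using m_less m_nonneg by (intro LIMSEQ_realpow_zero) auto
    then show "(\<lambda>n. c + (m / (2 * pi)) ^ n * M) \<longlonglongrightarrow> c + 0"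
      by (intro tendsto_add tendsto_const tendsto_mult_left_zero)
    show "\<exists>N. \<forall>n\<ge>N. \<bar>u w\<bar> \<le> c + (m / (2 * pi)) ^ n * M"
      using u_le_on_T[OF w] by blast
  qed
  show ?thesis
  proof (cases "z \<in> T")
    case True
    then show ?thesis using T[of z] z by simp
  next
    case False
    then show ?thesis using T.solution_le[of z 0] T z by auto
  qed
qed

lemma K_iter_eq_iter: "K_iter S T \<phi>1 \<phi>2 = iter"
  unfolding K_iter_def[abs_def] iter_def[abs_def] ..

lemma bounded_data_u_ext: "bounded_data S.u_ext"
proof -
  have "(\<lambda>\<zeta>. indicator T.B \<zeta> * S.u_ext (\<phi>2 \<zeta>)) = (\<lambda>\<zeta>. if \<zeta> \<in> T.B then S.u_ext (\<phi>2 \<zeta>) else 0)"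
    by (auto simp: indicator_def)
  then show ?thesis
    unfolding bounded_data_def using T.bdry_B_measurable S.abs_u_ext_le by auto
qed

lemma u_ext_le_c: "\<bar>S.u_ext z\<bar> \<le> c"
  using u_le_c S.c by (simp add: S.u_ext_def)

theorem expansion:
  assumes z: "z \<in> D"
  shows "u z = h z + (LINT \<zeta>:T.B|arc_length. K_sum S T \<phi>1 \<phi>2 z \<zeta> * h (\<phi>2 \<zeta>))"
    and "\<bar>h z + (\<Sum>k=1..t. 1 / (2*pi) ^ (2*k) * (LINT \<zeta>:T.B|arc_length. K_iter S T \<phi>1 \<phi>2 k z \<zeta> * h (\<phi>2 \<zeta>))) - u z\<bar>
      \<le> (m / (2*pi)) ^ (t+1) * (2*pi / (2*pi - m)) * c"
proof -
  have zX: "z \<in> D \<union> T" using z by simp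
  have uz: "S.u_ext z = u z" using z by (simp add: S.u_ext_def)
  have Qa: "2 * pi * m / (2 * pi)\<^sup>2 = m / (2 * pi)" by (simp add: power2_eq_square)
  have Q: "2 * pi * m < (2 * pi)\<^sup>2" using m_less by (simp add: power2_eq_square)
  have a: "(2 * pi)\<^sup>2 > 0" by simp
  note facts = bounded_data_u_ext u_ext_le_c a integral_equation
  show "u z = h z + (LINT \<zeta>:T.B|arc_length. K_sum S T \<phi>1 \<phi>2 z \<zeta> * h (\<phi>2 \<zeta>))"
    using series_representation[OF facts zX Q] unfolding uz K_sum_def[abs_def] K_iter_eq_iter power_mult by simp
  have "\<bar>h z + (\<Sum>k=1..t. 1 / (2*pi) ^ (2*k) * (LINT \<zeta>:T.B|arc_length. K_iter S T \<phi>1 \<phi>2 k z \<zeta> * h (\<phi>2 \<zeta>))) - u z\<bar>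
      \<le> (m / (2*pi)) ^ Suc t * c"
    using partial_sum_error[OF facts zX, of t] unfolding uz K_iter_eq_iter power_mult Qa by simp
  also have "\<dots> \<le> (m / (2*pi)) ^ (t+1) * (2*pi / (2*pi - m)) * c"
  proof -
    have "1 \<le> 2*pi / (2*pi - m)" using m_less m_nonneg by (simp add: field_simps)
    then have "(m / (2*pi)) ^ Suc t * 1 \<le> (m / (2*pi)) ^ Suc t * (2*pi / (2*pi - m))"
      by (rule mult_left_mono) (use m_nonneg in simp)
    from mult_right_mono[OF this S.c] show ?thesis by simp
  qed
  finally show "\<bar>h z + (\<Sum>k=1..t. 1 / (2*pi) ^ (2*k) * (LINT \<zeta>:T.B|arc_length. K_iter S T \<phi>1 \<phi>2 k z \<zeta> * h (\<phi>2 \<zeta>))) - u z\<bar>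
      \<le> (m / (2*pi)) ^ (t+1) * (2*pi / (2*pi - m)) * c" .
qed

end

lemma crosscuts_cut_domain:
  assumes D: "open D" and fin: "finite I" and cc: "\<And>j. j \<in> I \<Longrightarrow> crosscut D (\<sigma> j)"
    and C: "C = (\<Union>j\<in>I. path_image (\<sigma> j))" and \<phi>: "riemann_map_closed \<phi> (D - C)"
  shows "cut_domain D C \<phi>"
proof
  have arc: "arc (\<sigma> j)" if "j \<in> I" for j using cc[OF that] by (simp add: crosscut_def)
  show "compact C"
    unfolding C using fin arc by (intro compact_UN) (auto intro: compact_path_image arc_imp_path)
  have "C \<inter> frontier D \<subseteq> (\<Union>j\<in>I. {pathstart (\<sigma> j), pathfinish (\<sigma> j)})"
  proof
    fix z assume z: "z \<in> C \<inter> frontier D"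
    then obtain j where j: "j \<in> I" "z \<in> path_image (\<sigma> j)" by (auto simp: C)
    have "z \<notin> D" using z D by (auto simp: frontier_def interior_open)
    then show "z \<in> (\<Union>j\<in>I. {pathstart (\<sigma> j), pathfinish (\<sigma> j)})"
      using cc[OF j(1)] j by (auto simp: crosscut_def)
  qed
  then show "finite (C \<inter> frontier D)" by (rule finite_subset) (use fin in auto)
  show "C \<subseteq> closure (C \<inter> D)"
  proof
    fix z assume "z \<in> C"
    then obtain j where j: "j \<in> I" "z \<in> path_image (\<sigma> j)" by (auto simp: C)
    then have "z \<in> closure (path_image (\<sigma> j) \<inter> D)"
      using crosscut_subset_closure_interior[OF cc] by blast
    moreover have "closure (path_image (\<sigma> j) \<inter> D) \<subseteq> closure (C \<inter> D)"
      using j(1) by (intro closure_mono) (auto simp: C)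
    ultimately show "z \<in> closure (C \<inter> D)" by blast
  qed
qed (use D \<phi> in auto)

theorem theorem4p1:
  fixes D S T :: "complex set" and n :: nat
    and f u :: "complex \<Rightarrow> real"
    and \<sigma> \<tau> :: "nat \<Rightarrow> real \<Rightarrow> complex"
    and \<phi>1 \<phi>2 :: "complex \<Rightarrow> complex"
  assumes "n \<ge> 2" and "bounded_jordan_domain n D"
    and "piecewise_continuous_frontier D f"
    and "dirichlet_solution D f u"
    and "\<And>j. j \<in> {1..n-1} \<Longrightarrow> crosscut D (\<sigma> j)"
    and "\<And>j. j \<in> {1..n-1} \<Longrightarrow> crosscut D (\<tau> j)"
    and "disjoint_family_on (\<lambda>j. path_image (\<sigma> j)) {1..n-1}"
    and "disjoint_family_on (\<lambda>j. path_image (\<tau> j)) {1..n-1}"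
    and "S = (\<Union>j\<in>{1..n-1}. path_image (\<sigma> j))"
    and "T = (\<Union>j\<in>{1..n-1}. path_image (\<tau> j))"
    and "S \<inter> T = {}"
    and "region (D - S)" and "simply_connected (D - S)"
    and "region (D - T)" and "simply_connected (D - T)"
    and "riemann_map_closed \<phi>1 (D - S)" and "riemann_map_closed \<phi>2 (D - T)"
  shows "(\<forall>z\<in>D. u z = h_cut D f S \<phi>1 \<phi>2 z +
            (LINT \<zeta>1:disk_preimage \<phi>2 T|arc_length.
               K_sum S T \<phi>1 \<phi>2 z \<zeta>1 * h_cut D f S \<phi>1 \<phi>2 (\<phi>2 \<zeta>1))) \<and>
         (\<forall>z\<in>D. \<forall>t\<ge>1.
            \<bar>h_cut D f S \<phi>1 \<phi>2 z +
             (\<Sum>k=1..t. 1 / (2*pi) ^ (2*k) *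
                (LINT \<zeta>1:disk_preimage \<phi>2 T|arc_length.
                   K_iter S T \<phi>1 \<phi>2 k z \<zeta>1 * h_cut D f S \<phi>1 \<phi>2 (\<phi>2 \<zeta>1)))
             - u z\<bar>
            \<le> (m_cut S T \<phi>2 / (2*pi)) ^ (t+1) * (2*pi / (2*pi - m_cut S T \<phi>2)) * frontier_sup_norm D f)"
proof -
  have D: "open D" using assms(2) by (simp add: bounded_jordan_domain_def region_def)
  obtain F where F: "finite F" "F \<subseteq> frontier D"
      "\<And>\<zeta>. \<zeta> \<in> frontier D - F \<Longrightarrow> continuous (at \<zeta> within frontier D) f"
      "bounded (f ` frontier D)"
    using piecewise_continuous_frontierD[OF assms(2,3)] by blast
  have bdd: "bdd_above ((\<lambda>\<zeta>. \<bar>f \<zeta>\<bar>) ` frontier D)"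
    using F(4) unfolding bounded_iff by (auto intro: bdd_aboveI2)
  have fc: "\<bar>f \<zeta>\<bar> \<le> frontier_sup_norm D f" if "\<zeta> \<in> frontier D" for \<zeta>
    unfolding frontier_sup_norm_def by (rule cSUP_upper[OF that bdd])
  have sol: "harmonic_on u D" "bounded (u ` D)"
      "\<And>\<zeta>. \<zeta> \<in> frontier D \<Longrightarrow> continuous (at \<zeta> within frontier D) f \<Longrightarrow> (u \<longlongrightarrow> f \<zeta>) (at \<zeta> within D)"
    using assms(4) by (auto simp: dirichlet_solution_def)
  obtain M where M: "M > 0" "\<And>z. z \<in> D \<Longrightarrow> \<bar>u z\<bar> \<le> M"
    using sol(2) unfolding bounded_pos by auto
  have "1 \<in> {1..n-1}" using assms(1) by simp
  from assms(5)[OF this] have e: "pathstart (\<sigma> 1) \<in> frontier D"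
    by (simp add: crosscut_def)
  have eS: "pathstart (\<sigma> 1) \<in> S"
    unfolding assms(9) using \<open>1 \<in> {1..n-1}\<close> pathstart_in_path_image by blast
  have dd: "dirichlet_data D f u F (frontier_sup_norm D f) M"
  proof
    show "F \<inter> D = {}" using F(2) D by (auto simp: frontier_def interior_open)
    show "0 \<le> frontier_sup_norm D f" using fc[OF e] by (meson abs_ge_zero order_trans)
  qed (use D F fc sol M in auto)
  have cS: "cut_domain D S \<phi>1"
    by (rule crosscuts_cut_domain[OF D _ assms(5) assms(9) assms(16)]) auto
  have cT: "cut_domain D T \<phi>2"
    by (rule crosscuts_cut_domain[OF D _ assms(6) assms(10) assms(17)]) auto
  have "two_cuts D S T \<phi>1 \<phi>2 f u F (frontier_sup_norm D f) M"
    using assms(11) e eS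
    by (intro two_cuts.intro cut_solution.intro two_cuts_axioms.intro cS cT dd) auto
  from two_cuts.expansion[OF this] show ?thesis by blast
qed

end
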